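(* For all positive integers $t_1,t_2,r_2,r_3$, all complex matrices $G_{21}\in\mathbb{C}^{r_2\times t_1}$, $G_{31}\in\mathbb{C}^{r_3\times t_1}$, $G_{32}\in\mathbb{C}^{r_3\times t_2}$, and every power $P$, the cutset bound $R_{\mathrm{CS}}$ and the partial decode--forward bound $R_{\mathrm{PDF}}$ of the MIMO relay channel satisfy $$\Delta_{\mathrm{PDF}} := R_{\mathrm{CS}}-R_{\mathrm{PDF}} \le \min(t_1,r_2).$$
   Context: All logarithms are base 2, so rates and mutual informations are in bits. $(\cdot)^{\mathsf H}$ is the complex conjugate transpose. $P>0$ is the power constraint. MIMO relay channel: given complex random vectors $\mathbf{X}_1$ in $\mathbb{C}^{t_1}$ (sender) and $\mathbf{X}_2$ in $\mathbb{C}^{t_2}$ (relay), the channel outputs are $$\mathbf{Y}_2=G_{21}\mathbf{X}_1+\mathbf{Z}_2,\qquad \mathbf{Y}_3=G_{31}\mathbf{X}_1+G_{32}\mathbf{X}_2+\mathbf{Z}_3,$$ where $\mathbf{Z}_2\sim\mathrm{CN}(0,I_{r_2})$ and $\mathbf{Z}_3\sim\mathrm{CN}(0,I_{r_3})$ are (circularly symmetric) complex Gaussian, independent of each other and of the inputs (and of any auxiliary variable $\mathbf{U}$ below). Cutset bound: $$R_{\mathrm{CS}}=\sup_{F(\mathbf{x}_1,\mathbf{x}_2)}\min\{I(\mathbf{X}_1,\mathbf{X}_2;\mathbf{Y}_3),\ I(\mathbf{X}_1;\mathbf{Y}_2,\mathbf{Y}_3\mid\mathbf{X}_2)\},$$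 the supremum being over all joint distributions of $(\mathbf{X}_1,\mathbf{X}_2)$ with $\mathsf{E}(\mathbf{X}_j^{\mathsf H}\mathbf{X}_j)\le P$, $j=1,2$. It is a known fact that $R_{\mathrm{CS}}=\max_K\min\{\log|I_{r_3}+G_{3*}KG_{3*}^{\mathsf H}|,\ \log|I_{r_2+r_3}+G_{*1}K_{1|2}G_{*1}^{\mathsf H}|\}$, where $G_{3*}=[G_{31}\ G_{32}]$, $G_{*1}=\begin{bmatrix} G_{21} \\ G_{31} \end{bmatrix}$, and the maximum is over $K=\begin{bmatrix} K_1 & K_{12} \\ K_{12}^{\mathsf H} & K_2 \end{bmatrix}\succeq0$ of size $(t_1+t_2)\times(t_1+t_2)$ with $\mathrm{tr}(K_j)\le P$, $j=1,2$, and $K_{1|2}=K_1-K_{12}K_2^{-1}K_{12}^{\mathsf H}$ (generalized inverse if $K_2$ is singular). Partial decode--forward bound: $$R_{\mathrm{PDF}}=\sup\min\{I(\mathbf{X}_1,\mathbf{X}_2;\mathbf{Y}_3),\ I(\mathbf{U};\mathbf{Y}_2\mid\mathbf{X}_2)+I(\mathbf{X}_1;\mathbf{Y}_3\mid\mathbf{X}_2,\mathbf{U})\},$$ the supremum being over all joint distributions $F(\mathbf{u},\mathbf{x}_1,\mathbf{x}_2)$ with $\mathsf{E}(\mathbf{X}_j^{\mathsf H}\mathbf{X}_j)\le P$, $j=1,2$, where $\mathbf{U}$ is an arbitrary auxiliary random vector. *)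

theory Defs
  imports "HOL-Probability.Probability"
begin

(* CN(0, I_n). Independent components with E |z_i|^2 = 1, so real and imaginary part each have
   variance 1/2. lborel on complex^'n is the 2n-dimensional Lebesgue measure, and norm is the
   Hermitian norm. *)
definition std_cgaussian :: "(complex ^ 'n::finite) measure" where
  "std_cgaussian = density lborel (\<lambda>z. ennreal (exp (- (norm z)\<^sup>2) / pi ^ CARD('n)))"

(* Sample points are (w, z2, z3): w is distributed according to the input law F and is independent
   of the noise vectors z2, z3, which are independent of each other. *)
definition relay_space ::
  "'w measure \<Rightarrow> ('w \<times> (complex ^ 'r2::finite) \<times> (complex ^ 'r3::finite)) measure" where
  "relay_space F = F \<Otimes>\<^sub>M (std_cgaussian \<Otimes>\<^sub>M std_cgaussian)"

(* E (X^H X) <= P. The nonnegative integral makes an infinite second moment violate the bound. *)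
definition power_constraint :: "'w measure \<Rightarrow> ('w \<Rightarrow> complex ^ 't::finite) \<Rightarrow> real \<Rightarrow> bool" where
  "power_constraint F X P \<longleftrightarrow> (\<integral>\<^sup>+ w. ennreal ((norm (X w))\<^sup>2) \<partial>F) \<le> ennreal P"

(* Argument order in the conditional mutual informations below: the library defines
   I(A; B | C) as I(A; (B, C)) - I(A; C), with real-valued mutual informations. The notion is
   symmetric in A and B, but the difference is only meaningful if both terms are finite. Channel
   outputs carry Gaussian noise, so with the output as A both terms are finite under the power
   constraint. With an input as A they need not be: for example, I(X1; X2) is infinite if
   X1 = X2 has a continuous distribution. *)

definition cutset_rate ::
  "complex ^ 't1::finite ^ 'r2::finite \<Rightarrow> complex ^ 't1 ^ 'r3::finite \<Rightarrow> complex ^ 't2::finite ^ 'r3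
   \<Rightarrow> ((complex ^ 't1) \<times> (complex ^ 't2)) measure \<Rightarrow> real" where
  "cutset_rate G21 G31 G32 F =
    (let M = relay_space F;
         X1 = (\<lambda>((x1, x2), z2, z3). x1);
         X2 = (\<lambda>((x1, x2), z2, z3). x2);
         Y2 = (\<lambda>((x1, x2), z2, z3). G21 *v x1 + z2);
         Y3 = (\<lambda>((x1, x2), z2, z3). G31 *v x1 + G32 *v x2 + z3)
     in min (prob_space.mutual_information M 2 (borel \<Otimes>\<^sub>M borel) borel (\<lambda>\<omega>. (X1 \<omega>, X2 \<omega>)) Y3)
            (prob_space.conditional_mutual_information M 2 (borel \<Otimes>\<^sub>M borel) borel borel
               (\<lambda>\<omega>. (Y2 \<omega>, Y3 \<omega>)) X1 X2))"

definition R_CS ::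
  "complex ^ 't1::finite ^ 'r2::finite \<Rightarrow> complex ^ 't1 ^ 'r3::finite \<Rightarrow> complex ^ 't2::finite ^ 'r3
   \<Rightarrow> real \<Rightarrow> ereal" where
  "R_CS G21 G31 G32 P =
    Sup {ereal (cutset_rate G21 G31 G32 F) | F.
           prob_space F \<and> sets F = sets (borel \<Otimes>\<^sub>M borel) \<and>
           power_constraint F fst P \<and> power_constraint F snd P}"

(* The auxiliary vector U has arbitrary dimension m, which is quantified inside the supremum and
   hence cannot be a type: U takes values in the space of extensional functions {..<m} -> complex. *)
definition aux_space :: "nat \<Rightarrow> (nat \<Rightarrow> complex) measure" where
  "aux_space m = (\<Pi>\<^sub>M i\<in>{..<m}. borel)"

definition pdf_rate ::
  "complex ^ 't1::finite ^ 'r2::finite \<Rightarrow> complex ^ 't1 ^ 'r3::finite \<Rightarrow> complex ^ 't2::finite ^ 'r3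
   \<Rightarrow> nat \<Rightarrow> ((nat \<Rightarrow> complex) \<times> (complex ^ 't1) \<times> (complex ^ 't2)) measure \<Rightarrow> real" where
  "pdf_rate G21 G31 G32 m F =
    (let M = relay_space F;
         U = (\<lambda>((u, x1, x2), z2, z3). u);
         X1 = (\<lambda>((u, x1, x2), z2, z3). x1);
         X2 = (\<lambda>((u, x1, x2), z2, z3). x2);
         Y2 = (\<lambda>((u, x1, x2), z2, z3). G21 *v x1 + z2);
         Y3 = (\<lambda>((u, x1, x2), z2, z3). G31 *v x1 + G32 *v x2 + z3)
     in min (prob_space.mutual_information M 2 (borel \<Otimes>\<^sub>M borel) borel (\<lambda>\<omega>. (X1 \<omega>, X2 \<omega>)) Y3)
            (prob_space.conditional_mutual_information M 2 borel (aux_space m) borel Y2 U X2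
             + prob_space.conditional_mutual_information M 2 borel borel (borel \<Otimes>\<^sub>M aux_space m)
                 Y3 X1 (\<lambda>\<omega>. (X2 \<omega>, U \<omega>))))"

definition R_PDF ::
  "complex ^ 't1::finite ^ 'r2::finite \<Rightarrow> complex ^ 't1 ^ 'r3::finite \<Rightarrow> complex ^ 't2::finite ^ 'r3
   \<Rightarrow> real \<Rightarrow> ereal" where
  "R_PDF G21 G31 G32 P =
    Sup {ereal (pdf_rate G21 G31 G32 m F) | m F.
           prob_space F \<and> sets F = sets (aux_space m \<Otimes>\<^sub>M (borel \<Otimes>\<^sub>M borel)) \<and>
           power_constraint F (\<lambda>(u, x1, x2). x1) P \<and> power_constraint F (\<lambda>(u, x1, x2). x2) P}"

end

theory Submission
  imports Defs
begin

text \<open>Given an input law for the cutset bound, let \<open>U = G21 X1 + Z2'\<close>, where \<open>Z2'\<close> is an independent copy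
  of the relay noise. Since \<open>(U, Y3)\<close> and \<open>(Y2, Y3)\<close> have the same law given the inputs, the chain rule shows
  that the partial decode-forward sum falls short of the second cutset term by exactly
  \<open>h(Y2 | U, X2) - h(Z2)\<close>. Let \<open>L\<close> be an isometry from a space of complex dimension
  \<open>k = min(t1, r2)\<close> whose range contains that of \<open>G21\<close>. Comparing the conditional density of \<open>Y2\<close> with the
  one of \<open>L (L\<^sup>* U + N) + Z2\<close>, \<open>N\<close> standard Gaussian, bounds the loss by \<open>k\<close> bits (Gibbs' inequality).
  All conditional densities exist and are bounded because they are dominated by the noise density, so no
  regular conditional distributions are needed; their logarithms are integrable by comparison with a
  Gaussian density.\<close>

subsection \<open>Gaussian measures on Euclidean spaces\<close>

text \<open>\<open>Y2\<close> itself cannot serve as the auxiliary variable, because the channel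
  noise has to be independent of it; a copy with fresh noise is the admissible substitute. It does
  not touch the law of the inputs, so the power constraints and the first term of the minimum stay
  the same. The price is that \<open>Y2\<close> differs from its copy by \<open>Z2 - Z2'\<close>,
  which has twice the variance of the noise. This costs one bit per complex direction, but only in
  directions that the signal can occupy; the comparison density therefore doubles the variance along
  the range of \<open>L\<close> only. For linear \<open>f\<close> the mean of
  \<open>|f (Z2 - Z2')|^2\<close> is twice that of \<open>|f Z2|^2\<close>, so its exponent has the
  same mean as that of the noise density, and the loss is the logarithm of the normalising constant
  \<open>sqrt 2 ^ DIM('v)\<close>: half a bit per real dimension. Mutual information is here a
  real-valued integral whose value is meaningless when it diverges, so entropies may be cancelled
  only once every logarithm involved is known to be integrable. Likewise the final difference is
  taken in \<open>ereal\<close>, which is why finiteness of \<open>R_PDF\<close> is proved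
  separately.\<close>

definition gauss :: "'a::euclidean_space \<Rightarrow> real" where
  "gauss x = exp (- (norm x)\<^sup>2) / sqrt pi ^ DIM('a)"

lemma gauss_pos: "0 < gauss x"
  by (simp add: gauss_def)

lemma gauss_nonneg [simp]: "0 \<le> gauss x"
  by (simp add: gauss_def)

text \<open>The normalising factor \<open>sqrt pi\<close> exceeds 1. Every output density is an
  average of shifted copies of \<open>gauss\<close>, so this one bound makes all of them at most 1
  and their logarithms at most 0.\<close>

lemma gauss_le_1: "gauss x \<le> 1"
proof -
  have "1 \<le> sqrt pi" using pi_ge_two by (simp add: real_le_rsqrt)
  then have "1 \<le> sqrt pi ^ DIM('a)" by (rule one_le_power)
  moreover have "exp (- (norm x)\<^sup>2) \<le> 1" by simp
  ultimately show ?thesis unfolding gauss_def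
    by (smt (verit) divide_le_eq_1)
qed

lemma gauss_measurable [measurable]: "gauss \<in> borel_measurable borel"
  unfolding gauss_def by measurable

lemma gauss_minus [simp]: "gauss (- x) = gauss x"
  by (simp add: gauss_def)

lemma ln_gauss: "ln (gauss (x::'a::euclidean_space)) = - (norm x)\<^sup>2 - real DIM('a) * ln (sqrt pi)"
  by (simp add: gauss_def ln_div ln_realpow)

lemma gauss_Pair: "gauss (x, y) = gauss x * gauss y"
  by (simp add: gauss_def norm_Pair power_add exp_add[symmetric])

lemma nn_integral_lborel_shift:
  fixes a :: "'a::euclidean_space"
  assumes [measurable]: "f \<in> borel_measurable borel"
  shows "(\<integral>\<^sup>+x. f (a + x) \<partial>lborel) = (\<integral>\<^sup>+x. f x \<partial>lborel)"
proof -
  have "(\<integral>\<^sup>+x. f x \<partial>lborel) = (\<integral>\<^sup>+x. f x \<partial>distr lborel borel ((+) a))"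
    by (simp add: lborel_distr_plus)
  also have "\<dots> = (\<integral>\<^sup>+x. f (a + x) \<partial>lborel)"
    by (subst nn_integral_distr) auto
  finally show ?thesis by simp
qed

lemma nn_integral_exp_neg_square:
  assumes c: "0 < c"
  shows "(\<integral>\<^sup>+x. ennreal (exp (- (c * x\<^sup>2))) \<partial>lborel) = ennreal (sqrt (pi / c))"
proof -
  \<comment> \<open>\<open>normal_density\<close> has the exponent \<open>x^2 / (2 * s^2)\<close>,
    hence this \<open>s\<close>.\<close>
  define s where "s = 1 / sqrt (2 * c)"
  have s: "s > 0" "2 * s\<^sup>2 = 1 / c" using c by (auto simp: s_def power_divide)
  have "exp (- (c * x\<^sup>2)) = sqrt (pi / c) * normal_density 0 s x" for x
  proof -
    have "x\<^sup>2 / (2 * s\<^sup>2) = c * x\<^sup>2" using s c by (simp add: field_simps)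
    moreover have "sqrt (2 * pi * s\<^sup>2) = sqrt (pi / c)"
      using s(2) by (metis mult.assoc mult.commute times_divide_eq_right mult.right_neutral)
    ultimately show ?thesis using c by (simp add: normal_density_def)
  qed
  then have "(\<integral>\<^sup>+x. ennreal (exp (- (c * x\<^sup>2))) \<partial>lborel)
      = ennreal (sqrt (pi / c)) * (\<integral>\<^sup>+x. ennreal (normal_density 0 s x) \<partial>lborel)"
    using c by (simp add: ennreal_mult nn_integral_cmult)
  also have "(\<integral>\<^sup>+x. ennreal (normal_density 0 s x) \<partial>lborel) = 1"
    using s by (simp add: nn_integral_eq_integral)
  finally show ?thesis by simp
qed

text \<open>The integrand is a product over \<open>Basis\<close>. Three values of \<open>c\<close>
  occur later: 1 for the normalisation, 1/2 for the second moment and 2 for the completed square in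
  \<open>predictive_integral\<close>.\<close>

lemma nn_integral_gaussian:
  fixes a :: "'a::euclidean_space"
  assumes c: "0 < c"
  shows "(\<integral>\<^sup>+x. ennreal (exp (- (c * (norm (x - a))\<^sup>2))) \<partial>lborel) = ennreal (sqrt (pi / c) ^ DIM('a))"
proof -
  have eq: "exp (- (c * (norm x)\<^sup>2)) = (\<Prod>b\<in>Basis. exp (- (c * (x \<bullet> b)\<^sup>2)))" for x :: 'a
    unfolding exp_sum[OF finite_Basis, symmetric] power2_norm_eq_inner
    by (subst euclidean_inner) (simp add: sum_distrib_left sum_negf power2_eq_square)
  have "(\<integral>\<^sup>+x. ennreal (exp (- (c * (norm (x - a))\<^sup>2))) \<partial>lborel)
      = (\<integral>\<^sup>+x. ennreal (exp (- (c * (norm ((a + x) - a))\<^sup>2))) \<partial>lborel)"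
    by (rule nn_integral_lborel_shift[symmetric]) measurable
  also have "\<dots> = (\<integral>\<^sup>+x. (\<Prod>b\<in>Basis. ennreal (exp (- (c * (x \<bullet> b)\<^sup>2)))) \<partial>(lborel::'a measure))"
    by (simp add: eq prod_ennreal)
  also have "\<dots> = (\<Prod>b\<in>(Basis::'a set). \<integral>\<^sup>+x. ennreal (exp (- (c * x\<^sup>2))) \<partial>lborel)"
    by (rule nn_integral_lborel_prod) auto
  also have "\<dots> = ennreal (sqrt (pi / c) ^ DIM('a))"
    using c by (simp add: nn_integral_exp_neg_square ennreal_power)
  finally show ?thesis .
qed

lemma nn_integral_gauss: "(\<integral>\<^sup>+x. ennreal (gauss (x - a)) \<partial>lborel) = 1"
proof -
  have "(\<integral>\<^sup>+x. ennreal (gauss (x - a)) \<partial>lborel)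
      = (\<integral>\<^sup>+x. ennreal (exp (- (1 * (norm (x - a))\<^sup>2))) * ennreal (1 / sqrt pi ^ DIM('a)) \<partial>lborel)"
    by (simp add: gauss_def ennreal_mult[symmetric])
  also have "\<dots> = ennreal (sqrt pi ^ DIM('a)) * ennreal (1 / sqrt pi ^ DIM('a))"
    by (subst nn_integral_multc, measurable, subst nn_integral_gaussian) auto
  finally show ?thesis by (simp add: ennreal_mult[symmetric])
qed

abbreviation gauss_measure :: "'a::euclidean_space measure" where
  "gauss_measure \<equiv> density lborel (\<lambda>x. ennreal (gauss x))"

lemma prob_space_gauss: "prob_space (gauss_measure :: 'a::euclidean_space measure)"
  by (rule prob_spaceI) (use nn_integral_gauss[of "0::'a"] in \<open>simp add: emeasure_density\<close>)

text \<open>\<open>complex ^ 'n\<close> has real dimension \<open>2 * CARD('n)\<close>, which turns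
  \<open>sqrt pi\<close> into \<open>pi\<close>. From here on the analysis takes place in real
  Euclidean spaces, which also include pairs of outputs.\<close>

lemma std_cgaussian_eq: "(std_cgaussian :: (complex ^ 'n::finite) measure) = gauss_measure"
proof -
  have "sqrt pi ^ (CARD('n) * 2) = pi ^ CARD('n)"
    by (metis power_even_eq mult.commute power2_eq_square real_sqrt_mult_self abs_of_pos pi_gt_zero power_mult power_commutes)
  then show ?thesis by (simp add: std_cgaussian_def gauss_def)
qed

text \<open>Squared norms and dimensions add up in pairs, so independent noises form one Gaussian
  vector and \<open>(Y2, Y3)\<close> can be treated like a single output.\<close>

lemma gauss_measure_Pair:
  "(gauss_measure \<Otimes>\<^sub>M gauss_measure :: ('a::euclidean_space \<times> 'b::euclidean_space) measure) = gauss_measure"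
proof -
  interpret G: prob_space "gauss_measure :: 'b measure" by (rule prob_space_gauss)
  have "(gauss_measure \<Otimes>\<^sub>M gauss_measure :: ('a \<times> 'b) measure)
     = density (lborel \<Otimes>\<^sub>M lborel) (\<lambda>(x, y). ennreal (gauss x) * ennreal (gauss y))"
    by (rule pair_measure_density) (auto intro: sigma_finite_lborel G.sigma_finite_measure_axioms)
  also have "\<dots> = gauss_measure"
    by (simp add: lborel_prod split_beta' ennreal_mult'[symmetric] gauss_Pair[symmetric])
  finally show ?thesis .
qed

text \<open>Half of the exponential decay is spent on absorbing the square; the other half is still
  integrable.\<close>

lemma norm_square_exp_le:
  "(norm x)\<^sup>2 * exp (- (norm x)\<^sup>2) \<le> 2 * exp (- ((1/2) * (norm x)\<^sup>2))"
proof -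
  define t where "t = (norm x)\<^sup>2"
  have "t / 2 \<le> exp (t / 2)" using exp_ge_add_one_self[of "t/2"] by linarith
  then have "t * exp (- t) \<le> 2 * exp (t / 2) * exp (- t)" by (intro mult_right_mono) auto
  also have "\<dots> = 2 * exp (- ((1/2) * t))" by (simp add: exp_add[symmetric])
  finally show ?thesis by (simp add: t_def)
qed

lemma nn_integral_norm_square_gauss:
  "(\<integral>\<^sup>+x. ennreal ((norm x)\<^sup>2) \<partial>(gauss_measure :: 'a::euclidean_space measure)) < \<infinity>"
proof -
  let ?c = "1 / sqrt pi ^ DIM('a)"
  have "(\<integral>\<^sup>+x. ennreal ((norm x)\<^sup>2) \<partial>(gauss_measure :: 'a measure))
      = (\<integral>\<^sup>+x. ennreal (gauss x * (norm x)\<^sup>2) \<partial>(lborel :: 'a measure))"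
    by (subst nn_integral_density) (auto simp: ennreal_mult)
  also have "\<dots> \<le> (\<integral>\<^sup>+x. ennreal (2 * ?c) * ennreal (exp (- ((1/2) * (norm (x - 0))\<^sup>2))) \<partial>(lborel :: 'a measure))"
  proof (rule nn_integral_mono)
    fix x :: 'a
    have "gauss x * (norm x)\<^sup>2 = ?c * ((norm x)\<^sup>2 * exp (- (norm x)\<^sup>2))" by (simp add: gauss_def)
    also have "\<dots> \<le> ?c * (2 * exp (- ((1/2) * (norm x)\<^sup>2)))"
      by (rule mult_left_mono[OF norm_square_exp_le]) simp
    finally show "ennreal (gauss x * (norm x)\<^sup>2) \<le> ennreal (2 * ?c) * ennreal (exp (- ((1/2) * (norm (x - 0))\<^sup>2)))"
      by (simp add: ennreal_mult[symmetric] ac_simps)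
  qed
  also have "\<dots> = ennreal (2 * ?c) * ennreal (sqrt (pi / (1/2)) ^ DIM('a))"
    by (subst nn_integral_cmult, measurable, subst nn_integral_gaussian) auto
  also have "\<dots> < \<infinity>" by (simp add: ennreal_mult_less_top)
  finally show ?thesis .
qed

subsection \<open>Bounded densities and mutual information\<close>

text \<open>The zero set of a density is null for the law with that density. Quotients and
  logarithms of densities at random points may therefore be split almost surely, away from the
  default value of \<open>ln 0\<close>.\<close>

lemma distributed_density_pos:
  fixes f :: "'b \<Rightarrow> real"
  assumes "distributed M N X (\<lambda>x. ennreal (f x))"
  shows "AE \<omega> in M. 0 < f (X \<omega>)"
proof -
  note [measurable] = distributed_measurable[OF assms]
  have [measurable]: "(\<lambda>x. ennreal (f x)) \<in> borel_measurable N"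
    using assms by (rule distributed_borel_measurable)
  have "AE x in density N (\<lambda>x. ennreal (f x)). 0 < ennreal (f x)"
    by (subst AE_density) auto
  then have "AE x in distr M N X. 0 < ennreal (f x)"
    unfolding distributed_distr_eq_density[OF assms] .
  then have "AE \<omega> in M. 0 < ennreal (f (X \<omega>))"
    by (rule AE_distrD[rotated]) measurable
  then show ?thesis by (simp add: ennreal_less_zero_iff)
qed

text \<open>Apply \<open>ln r <= r - 1\<close> to the ratio \<open>r = q / f\<close>, whose mean is
  at most the total mass of \<open>q\<close>. The same inequality bounds \<open>ln f\<close> from
  below by an integrable function, and \<open>ln C\<close> bounds it from above, so integrability
  for the unknown density \<open>f\<close> is a conclusion.\<close>

lemma (in prob_space) gibbs_inequality:
  fixes f q :: "'b \<Rightarrow> real"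
  assumes D: "distributed M N X (\<lambda>x. ennreal (f x))"
    and f_nonneg: "\<And>x. 0 \<le> f x" and f_le: "\<And>x. f x \<le> C"
    and q_meas [measurable]: "q \<in> borel_measurable N" and q_pos: "\<And>x. 0 < q x"
    and q_int: "(\<integral>\<^sup>+x. ennreal (q x) \<partial>N) \<le> 1"
    and q_ln: "integrable M (\<lambda>\<omega>. ln (q (X \<omega>)))"
  shows "integrable M (\<lambda>\<omega>. ln (f (X \<omega>)))"
    and "(\<integral>\<omega>. ln (q (X \<omega>)) \<partial>M) \<le> (\<integral>\<omega>. ln (f (X \<omega>)) \<partial>M)"
proof -
  note [measurable] = distributed_measurable[OF D]
  have [measurable]: "f \<in> borel_measurable N"
    using f_nonneg D by (intro distributed_real_measurable)
  have pos: "AE \<omega> in M. 0 < f (X \<omega>)" by (rule distributed_density_pos[OF D])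
  have "(\<integral>\<^sup>+\<omega>. ennreal (q (X \<omega>) / f (X \<omega>)) \<partial>M) = (\<integral>\<^sup>+x. ennreal (f x) * ennreal (q x / f x) \<partial>N)"
    by (rule distributed_nn_integral[OF D, symmetric]) measurable
  also have "\<dots> \<le> (\<integral>\<^sup>+x. ennreal (q x) \<partial>N)"
  proof (rule nn_integral_mono)
    fix x
    \<comment> \<open>At zeros of \<open>f\<close> the quotient is 0 by convention. The mass of
      \<open>q\<close> there is lost, which only helps the upper bound.\<close>
    have "f x * (q x / f x) \<le> q x" using q_pos[of x] by (cases "f x = 0") auto
    then show "ennreal (f x) * ennreal (q x / f x) \<le> ennreal (q x)"
      using f_nonneg by (simp add: ennreal_mult'[symmetric] ennreal_leI)
  qed
  finally have r1: "(\<integral>\<^sup>+\<omega>. ennreal (q (X \<omega>) / f (X \<omega>)) \<partial>M) \<le> 1" using q_int by order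
  have r_nn: "0 \<le> q (X \<omega>) / f (X \<omega>)" for \<omega>
    using f_nonneg q_pos by (simp add: less_imp_le)
  have r_int: "integrable M (\<lambda>\<omega>. q (X \<omega>) / f (X \<omega>))"
    using r1 r_nn by (intro integrableI_nonneg) (auto intro: le_less_trans)
  have r_le: "(\<integral>\<omega>. q (X \<omega>) / f (X \<omega>) \<partial>M) \<le> 1"
    using r1 r_nn r_int by (simp add: nn_integral_eq_integral)
  have lower: "AE \<omega> in M. ln (q (X \<omega>)) - q (X \<omega>) / f (X \<omega>) + 1 \<le> ln (f (X \<omega>))"
    using pos
  proof eventually_elim
    fix \<omega> assume p: "0 < f (X \<omega>)"
    have "ln (q (X \<omega>) / f (X \<omega>)) \<le> q (X \<omega>) / f (X \<omega>) - 1"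
      using p q_pos by (intro ln_le_minus_one) simp
    then show "ln (q (X \<omega>)) - q (X \<omega>) / f (X \<omega>) + 1 \<le> ln (f (X \<omega>))"
      using p q_pos[of "X \<omega>"] by (simp add: ln_div)
  qed
  have bound: "AE \<omega> in M. norm (ln (f (X \<omega>))) \<le> \<bar>ln (q (X \<omega>)) - q (X \<omega>) / f (X \<omega>) + 1\<bar> + \<bar>ln C\<bar>"
    using lower pos
  proof eventually_elim
    fix \<omega> assume "0 < f (X \<omega>)" and l: "ln (q (X \<omega>)) - q (X \<omega>) / f (X \<omega>) + 1 \<le> ln (f (X \<omega>))"
    then have "ln (f (X \<omega>)) \<le> ln C" using f_le by (smt (verit) ln_le_cancel_iff)
    with l show "norm (ln (f (X \<omega>))) \<le> \<bar>ln (q (X \<omega>)) - q (X \<omega>) / f (X \<omega>) + 1\<bar> + \<bar>ln C\<bar>" by simp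
  qed
  show f_int: "integrable M (\<lambda>\<omega>. ln (f (X \<omega>)))"
    by (rule Bochner_Integration.integrable_bound[where f="\<lambda>\<omega>. \<bar>ln (q (X \<omega>)) - q (X \<omega>) / f (X \<omega>) + 1\<bar> + \<bar>ln C\<bar>"])
      (use q_ln r_int bound in auto)
  have "(\<integral>\<omega>. ln (q (X \<omega>)) - q (X \<omega>) / f (X \<omega>) + 1 \<partial>M) \<le> (\<integral>\<omega>. ln (f (X \<omega>)) \<partial>M)"
    by (rule integral_mono_AE) (use q_ln r_int f_int lower in auto)
  moreover have "(\<integral>\<omega>. ln (q (X \<omega>)) - q (X \<omega>) / f (X \<omega>) + 1 \<partial>M)
      = (\<integral>\<omega>. ln (q (X \<omega>)) \<partial>M) - (\<integral>\<omega>. q (X \<omega>) / f (X \<omega>) \<partial>M) + 1"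
    using q_ln r_int by (simp add: prob_space)
  ultimately show "(\<integral>\<omega>. ln (q (X \<omega>)) \<partial>M) \<le> (\<integral>\<omega>. ln (f (X \<omega>)) \<partial>M)" using r_le by simp
qed

text \<open>With the law of \<open>B\<close> as second reference measure, \<open>f\<close> is the
  density of \<open>A\<close> conditional on \<open>B\<close> and \<open>B\<close> itself has
  density 1, so mutual information is a difference of two entropies. \<open>S'\<close> may carry
  another measure than \<open>S\<close> (\<open>borel\<close> against \<open>lborel\<close>), to
  which a definition through laws is blind.\<close>

lemma (in prob_space) mutual_information_densities:
  fixes f :: "'b \<times> 'c \<Rightarrow> real" and g :: "'b \<Rightarrow> real"
  assumes S: "sigma_finite_measure S" and S': "sets S' = sets S"
    and B [measurable]: "B \<in> M \<rightarrow>\<^sub>M T"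
    and Df: "distributed M (S \<Otimes>\<^sub>M distr M T B) (\<lambda>\<omega>. (A \<omega>, B \<omega>)) (\<lambda>x. ennreal (f x))"
    and Dg: "distributed M S A (\<lambda>x. ennreal (g x))"
    and f0: "\<And>x. 0 \<le> f x" and g0: "\<And>x. 0 \<le> g x"
    and fi: "integrable M (\<lambda>\<omega>. ln (f (A \<omega>, B \<omega>)))" and gi: "integrable M (\<lambda>\<omega>. ln (g (A \<omega>)))"
  shows "mutual_information 2 S' T A B
      = ((\<integral>\<omega>. ln (f (A \<omega>, B \<omega>)) \<partial>M) - (\<integral>\<omega>. ln (g (A \<omega>)) \<partial>M)) / ln 2"
    and "mutual_information 2 T S' B A
      = ((\<integral>\<omega>. ln (f (A \<omega>, B \<omega>)) \<partial>M) - (\<integral>\<omega>. ln (g (A \<omega>)) \<partial>M)) / ln 2"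
proof -
  interpret information_space M 2 by standard simp
  interpret T: prob_space "distr M T B" by (rule prob_space_distr) (rule B)
  let ?T = "distr M T B"
  have [measurable]: "f \<in> borel_measurable (S \<Otimes>\<^sub>M ?T)"
    using f0 Df by (intro distributed_real_measurable)
  have [measurable]: "g \<in> borel_measurable S"
    using g0 Dg by (intro distributed_real_measurable)
  note [measurable] = distributed_measurable[OF Df] distributed_measurable[OF Dg]
  have DB: "distributed M ?T B (\<lambda>x. ennreal 1)"
    by (auto simp: distributed_def density_1 intro!: distr_cong)
  have Df': "distributed M (?T \<Otimes>\<^sub>M S) (\<lambda>\<omega>. (B \<omega>, A \<omega>)) (\<lambda>x. ennreal (f (snd x, fst x)))"
    using distributed_swap[OF S T.sigma_finite_measure_axioms Df] by (simp add: split_beta')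
  have lim: "(\<integral>\<omega>. log 2 (f (A \<omega>, B \<omega>) / g (A \<omega>)) \<partial>M)
      = ((\<integral>\<omega>. ln (f (A \<omega>, B \<omega>)) \<partial>M) - (\<integral>\<omega>. ln (g (A \<omega>)) \<partial>M)) / ln 2"
  proof -
    have "(\<integral>\<omega>. log 2 (f (A \<omega>, B \<omega>) / g (A \<omega>)) \<partial>M)
        = (\<integral>\<omega>. (ln (f (A \<omega>, B \<omega>)) - ln (g (A \<omega>))) / ln 2 \<partial>M)"
    proof (rule integral_cong_AE)
      show "AE \<omega> in M. log 2 (f (A \<omega>, B \<omega>) / g (A \<omega>)) = (ln (f (A \<omega>, B \<omega>)) - ln (g (A \<omega>))) / ln 2"
        using distributed_density_pos[OF Df] distributed_density_pos[OF Dg]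
        by eventually_elim (simp add: log_def ln_div)
    qed measurable
    then show ?thesis using fi gi by simp
  qed
  have "sets (S' \<Otimes>\<^sub>M T) = sets (S \<Otimes>\<^sub>M ?T)" by (rule sets_pair_measure_cong) (simp_all add: S')
  then have "mutual_information 2 S' T A B = mutual_information 2 S ?T A B"
    unfolding mutual_information_def
    by (simp add: distr_cong[OF refl S' refl] distr_cong[OF refl _ refl, of "S' \<Otimes>\<^sub>M T" "S \<Otimes>\<^sub>M ?T"] distr_cong[OF refl sets_distr refl])
  also have "\<dots> = (\<integral>x. f x * log 2 (f x / (g (fst x) * 1)) \<partial>(S \<Otimes>\<^sub>M ?T))"
    by (rule mutual_information_distr[OF S T.sigma_finite_measure_axioms Dg _ DB _ Df]) (auto simp: f0 g0)
  also have "\<dots> = (\<integral>\<omega>. log 2 (f (A \<omega>, B \<omega>) / g (A \<omega>)) \<partial>M)"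
    by (subst distributed_integral[OF Df]) (auto simp: f0)
  finally show "mutual_information 2 S' T A B
      = ((\<integral>\<omega>. ln (f (A \<omega>, B \<omega>)) \<partial>M) - (\<integral>\<omega>. ln (g (A \<omega>)) \<partial>M)) / ln 2"
    by (simp only: lim)
  have "sets (T \<Otimes>\<^sub>M S') = sets (?T \<Otimes>\<^sub>M S)" by (rule sets_pair_measure_cong) (simp_all add: S')
  then have "mutual_information 2 T S' B A = mutual_information 2 ?T S B A"
    unfolding mutual_information_def
    by (simp add: distr_cong[OF refl S' refl] distr_cong[OF refl _ refl, of "T \<Otimes>\<^sub>M S'" "?T \<Otimes>\<^sub>M S"] distr_cong[OF refl sets_distr refl])
  also have "\<dots> = (\<integral>x. f (snd x, fst x) * log 2 (f (snd x, fst x) / (1 * g (snd x))) \<partial>(?T \<Otimes>\<^sub>M S))"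
    by (rule mutual_information_distr[OF T.sigma_finite_measure_axioms S DB _ Dg _ Df']) (auto simp: f0 g0)
  also have "\<dots> = (\<integral>\<omega>. log 2 (f (A \<omega>, B \<omega>) / g (A \<omega>)) \<partial>M)"
    by (subst distributed_integral[OF Df']) (auto simp: f0)
  finally show "mutual_information 2 T S' B A
      = ((\<integral>\<omega>. ln (f (A \<omega>, B \<omega>)) \<partial>M) - (\<integral>\<omega>. ln (g (A \<omega>)) \<partial>M)) / ln 2"
    by (simp only: lim)
qed

text \<open>Only the joint law of \<open>X\<close> and \<open>Y\<close> enters. This moves rates
  from different relay spaces to a common sample space, where their terms can be compared.\<close>

lemma mutual_information_distr_transfer:
  assumes M: "prob_space M" and T [measurable]: "T \<in> M \<rightarrow>\<^sub>M N"
    and X [measurable]: "X \<in> N \<rightarrow>\<^sub>M S" and Y [measurable]: "Y \<in> N \<rightarrow>\<^sub>M R"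
  shows "prob_space.mutual_information (distr M N T) b S R X Y
    = prob_space.mutual_information M b S R (\<lambda>\<omega>. X (T \<omega>)) (\<lambda>\<omega>. Y (T \<omega>))"
proof -
  interpret M: prob_space M by fact
  interpret N: prob_space "distr M N T" by (rule M.prob_space_distr) (rule T)
  show ?thesis
    unfolding M.mutual_information_def N.mutual_information_def
    by (simp add: distr_distr comp_def)
qed

text \<open>Domination implies absolute continuity, and the Radon-Nikodym derivative can exceed
  \<open>C\<close> only on a null set. Truncating it there gives the bound at every point, the form
  in which \<open>gibbs_inequality\<close> asks for it.\<close>

lemma dominated_bounded_density:
  assumes N: "sigma_finite_measure N" and X [measurable]: "X \<in> M \<rightarrow>\<^sub>M N" and C: "0 \<le> C"
    and dom: "\<And>S. S \<in> sets N \<Longrightarrow> emeasure (distr M N X) S \<le> ennreal C * emeasure N S"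
  shows "\<exists>f. (\<forall>x. 0 \<le> f x \<and> f x \<le> C) \<and> distributed M N X (\<lambda>x. ennreal (f x))"
proof -
  interpret N: sigma_finite_measure N by fact
  have "absolutely_continuous N (distr M N X)"
    unfolding absolutely_continuous_def
  proof
    fix S assume S: "S \<in> null_sets N"
    have "emeasure (distr M N X) S \<le> 0" using dom[OF null_setsD2[OF S]] by (simp add: null_setsD1[OF S])
    then show "S \<in> null_sets (distr M N X)" using null_setsD2[OF S] by (intro null_setsI) auto
  qed
  then obtain h where [measurable]: "h \<in> borel_measurable N" and h: "density N h = distr M N X"
    using N.Radon_Nikodym[of "distr M N X"] by auto
  have ae: "AE x in N. h x \<le> ennreal C"
  proof -
    \<comment> \<open>The set where \<open>h\<close> exceeds \<open>C\<close> is cut into pieces of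
      finite measure, because the integral of a difference can be split only if the subtracted
      integral is finite.\<close>
    obtain A :: "nat \<Rightarrow> 'a set" where A: "range A \<subseteq> sets N" "(\<Union>i. A i) = space N" "\<And>i. emeasure N (A i) \<noteq> \<infinity>"
      using N.sigma_finite by metis
    have "AE x in N. x \<in> A i \<longrightarrow> h x \<le> ennreal C" for i
    proof -
      have [measurable]: "A i \<in> sets N" using A by auto
      define S where "S = {x \<in> A i. ennreal C < h x}"
      have "S = A i \<inter> {x\<in>space N. ennreal C < h x}"
        using A sets.sets_into_space[of "A i" N] by (auto simp: S_def)
      then have [measurable]: "S \<in> sets N" by simp
      have "emeasure N S \<le> emeasure N (A i)" by (rule emeasure_mono) (auto simp: S_def)
      then have fin: "emeasure N S < \<infinity>" using A(3)[of i] by (auto simp: less_top[symmetric] top_unique)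
      have c: "(\<integral>\<^sup>+x. ennreal C * indicator S x \<partial>N) = ennreal C * emeasure N S"
        by (simp add: nn_integral_cmult)
      \<comment> \<open>The excess of \<open>h\<close> over \<open>C\<close> on \<open>S\<close>
        integrates to the law of \<open>X\<close> minus \<open>C\<close> times \<open>N\<close>,
        both at \<open>S\<close>; by domination this truncated difference is 0.\<close>
      have "(\<integral>\<^sup>+x. h x * indicator S x - ennreal C * indicator S x \<partial>N)
        = (\<integral>\<^sup>+x. h x * indicator S x \<partial>N) - (\<integral>\<^sup>+x. ennreal C * indicator S x \<partial>N)"
      proof (rule nn_integral_diff)
        show "(\<integral>\<^sup>+x. ennreal C * indicator S x \<partial>N) \<noteq> \<infinity>"
          using fin by (simp add: c ennreal_mult_eq_top_iff)
        show "AE x in N. ennreal C * indicator S x \<le> h x * indicator S x"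
          by (auto simp: indicator_def S_def)
      qed auto
      also have "\<dots> = emeasure (distr M N X) S - ennreal C * emeasure N S"
        by (simp add: c h[symmetric] emeasure_density)
      also have "\<dots> = 0"
      proof -
        have "ennreal C * emeasure N S < top" using fin by (simp add: ennreal_mult_less_top)
        then have "emeasure (distr M N X) S < top" using dom[of S] by (auto intro: le_less_trans)
        then show ?thesis using dom[of S] by (simp add: diff_eq_0_iff_ennreal)
      qed
      finally have "AE x in N. h x * indicator S x - ennreal C * indicator S x = 0"
        by (subst (asm) nn_integral_0_iff_AE) auto
      then show ?thesis
      proof eventually_elim
        fix x assume "h x * indicator S x - ennreal C * indicator S x = 0"
        then show "x \<in> A i \<longrightarrow> h x \<le> ennreal C"
          by (cases "ennreal C < h x") (auto simp: S_def dest: ennreal_minus_eq_0)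
      qed
    qed
    then have "AE x in N. \<forall>i. x \<in> A i \<longrightarrow> h x \<le> ennreal C" unfolding AE_all_countable by blast
    then show ?thesis using AE_space
    proof eventually_elim
      fix x assume *: "\<forall>i. x \<in> A i \<longrightarrow> h x \<le> ennreal C" and "x \<in> space N"
      then obtain i where "x \<in> A i" using A(2) by blast
      with * show "h x \<le> ennreal C" by blast
    qed
  qed
  \<comment> \<open>The minimum equals \<open>h\<close> almost everywhere, so it is still a density
    of the same law.\<close>
  define f where "f x = enn2real (min (h x) (ennreal C))" for x
  have fin: "min (h x) (ennreal C) < top" for x
    by (simp add: min_less_iff_disj)
  have f_le: "f x \<le> C" for x
    unfolding f_def using C by (intro enn2real_leI) auto
  have ef: "ennreal (f x) = min (h x) (ennreal C)" for x
    unfolding f_def using fin by (rule ennreal_enn2real)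
  have "distributed M N X (\<lambda>x. ennreal (f x))"
    unfolding distributed_def h[symmetric] ef
    by (auto intro!: density_cong simp: min_absorb1 eventually_mono[OF ae])
  then show ?thesis using f_le by (auto intro!: exI[of _ f] simp: f_def)
qed

subsection \<open>Outputs with additive Gaussian noise\<close>

lemma nn_integral_lborel_pair_distr:
  fixes k :: "'a::euclidean_space \<times> 'c \<Rightarrow> ennreal"
  assumes M: "prob_space M" and [measurable]: "B \<in> M \<rightarrow>\<^sub>M T" "k \<in> borel_measurable (borel \<Otimes>\<^sub>M T)"
  shows "(\<integral>\<^sup>+x. k x \<partial>(lborel \<Otimes>\<^sub>M distr M T B)) = (\<integral>\<^sup>+\<omega>. \<integral>\<^sup>+a. k (a, B \<omega>) \<partial>lborel \<partial>M)"
proof -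
  interpret M: prob_space M by fact
  interpret D: prob_space "distr M T B" by (rule M.prob_space_distr) measurable
  interpret P: pair_sigma_finite "lborel :: 'a measure" "distr M T B" ..
  have "(\<integral>\<^sup>+x. k x \<partial>(lborel \<Otimes>\<^sub>M distr M T B)) = (\<integral>\<^sup>+b. \<integral>\<^sup>+a. k (a, b) \<partial>lborel \<partial>distr M T B)"
    by (rule P.nn_integral_snd[symmetric]) measurable
  also have "\<dots> = (\<integral>\<^sup>+\<omega>. \<integral>\<^sup>+a. k (a, B \<omega>) \<partial>lborel \<partial>M)"
    by (rule nn_integral_distr) measurable
  finally show ?thesis .
qed

lemma (in prob_space) distributed_lborel_pair_distrI:
  fixes f :: "'c::euclidean_space \<times> 'd \<Rightarrow> ennreal"
  assumes [measurable]: "A \<in> borel_measurable M" "B \<in> M \<rightarrow>\<^sub>M T" "f \<in> borel_measurable (borel \<Otimes>\<^sub>M T)"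
    and eq: "\<And>S. S \<in> sets (borel \<Otimes>\<^sub>M T) \<Longrightarrow>
      (\<integral>\<^sup>+\<omega>. indicator S (A \<omega>, B \<omega>) \<partial>M) = (\<integral>\<^sup>+\<omega>. \<integral>\<^sup>+a. f (a, B \<omega>) * indicator S (a, B \<omega>) \<partial>lborel \<partial>M)"
  shows "distributed M (lborel \<Otimes>\<^sub>M distr M T B) (\<lambda>\<omega>. (A \<omega>, B \<omega>)) f"
  unfolding distributed_def
proof (intro conjI)
  show "distr M (lborel \<Otimes>\<^sub>M distr M T B) (\<lambda>\<omega>. (A \<omega>, B \<omega>)) = density (lborel \<Otimes>\<^sub>M distr M T B) f"
  proof (rule measure_eqI)
    fix S assume "S \<in> sets (distr M (lborel \<Otimes>\<^sub>M distr M T B) (\<lambda>\<omega>. (A \<omega>, B \<omega>)))"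
    then have S': "S \<in> sets (lborel \<Otimes>\<^sub>M distr M T B)" by simp
    have "sets (lborel \<Otimes>\<^sub>M distr M T B) = sets (borel \<Otimes>\<^sub>M T)"
      by (rule sets_pair_measure_cong) auto
    with S' have S [measurable]: "S \<in> sets (borel \<Otimes>\<^sub>M T)" by simp
    note [measurable] = S'
    have "emeasure (distr M (lborel \<Otimes>\<^sub>M distr M T B) (\<lambda>\<omega>. (A \<omega>, B \<omega>))) S
        = (\<integral>\<^sup>+x. indicator S x \<partial>distr M (lborel \<Otimes>\<^sub>M distr M T B) (\<lambda>\<omega>. (A \<omega>, B \<omega>)))" by simp
    also have "\<dots> = (\<integral>\<^sup>+\<omega>. indicator S (A \<omega>, B \<omega>) \<partial>M)"
      by (rule nn_integral_distr) measurable
    also have "\<dots> = (\<integral>\<^sup>+\<omega>. \<integral>\<^sup>+a. f (a, B \<omega>) * indicator S (a, B \<omega>) \<partial>lborel \<partial>M)"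
      by (rule eq[OF S])
    also have "\<dots> = (\<integral>\<^sup>+x. f x * indicator S x \<partial>(lborel \<Otimes>\<^sub>M distr M T B))"
      by (rule nn_integral_lborel_pair_distr[OF prob_space_axioms, symmetric]) measurable
    also have "\<dots> = emeasure (density (lborel \<Otimes>\<^sub>M distr M T B) f) S"
      by (rule emeasure_density[symmetric]) measurable
    finally show "emeasure (distr M (lborel \<Otimes>\<^sub>M distr M T B) (\<lambda>\<omega>. (A \<omega>, B \<omega>))) S
      = emeasure (density (lborel \<Otimes>\<^sub>M distr M T B) f) S" .
  qed simp
qed measurable

text \<open>One equation of laws says both that \<open>Z\<close> is standard Gaussian and that it is
  independent of \<open>W\<close>. The role of \<open>W\<close> is to collect all randomness other
  than \<open>Z\<close>, so that signals and side information are functions of it.\<close>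

definition gaussian_noise :: "'a measure \<Rightarrow> ('a \<Rightarrow> 'c::euclidean_space) \<Rightarrow> 'n measure \<Rightarrow> ('a \<Rightarrow> 'n) \<Rightarrow> bool" where
  "gaussian_noise M Z N W \<longleftrightarrow> Z \<in> borel_measurable M \<and> W \<in> M \<rightarrow>\<^sub>M N \<and>
    distr M (borel \<Otimes>\<^sub>M N) (\<lambda>\<omega>. (Z \<omega>, W \<omega>)) = gauss_measure \<Otimes>\<^sub>M distr M N W"

text \<open>Fubini separates the noise from \<open>W\<close>, and translation invariance turns the
  integral over the noise into one over the output. Given \<open>W\<close>, the output thus has the
  density \<open>gauss\<close> shifted by the signal.\<close>

lemma (in prob_space) nn_integral_additive_noise:
  fixes Z :: "'a \<Rightarrow> 'c::euclidean_space"
  assumes noise: "gaussian_noise M Z N W"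
    and [measurable]: "h \<in> borel_measurable N" "b \<in> N \<rightarrow>\<^sub>M T" "k \<in> borel_measurable (borel \<Otimes>\<^sub>M T)"
  shows "(\<integral>\<^sup>+\<omega>. k (h (W \<omega>) + Z \<omega>, b (W \<omega>)) \<partial>M)
    = (\<integral>\<^sup>+\<omega>. \<integral>\<^sup>+a. ennreal (gauss (a - h (W \<omega>))) * k (a, b (W \<omega>)) \<partial>lborel \<partial>M)"
proof -
  have [measurable]: "Z \<in> borel_measurable M" "W \<in> M \<rightarrow>\<^sub>M N"
    using noise by (simp_all add: gaussian_noise_def)
  interpret D: prob_space "distr M N W" by (rule prob_space_distr) measurable
  interpret G: prob_space "gauss_measure :: 'c measure" by (rule prob_space_gauss)
  interpret P: pair_sigma_finite "gauss_measure :: 'c measure" "distr M N W" ..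
  have "(\<integral>\<^sup>+\<omega>. k (h (W \<omega>) + Z \<omega>, b (W \<omega>)) \<partial>M)
      = (\<integral>\<^sup>+x. k (h (snd x) + fst x, b (snd x)) \<partial>distr M (borel \<Otimes>\<^sub>M N) (\<lambda>\<omega>. (Z \<omega>, W \<omega>)))"
    by (subst nn_integral_distr) auto
  also have "distr M (borel \<Otimes>\<^sub>M N) (\<lambda>\<omega>. (Z \<omega>, W \<omega>)) = gauss_measure \<Otimes>\<^sub>M distr M N W"
    using noise by (simp add: gaussian_noise_def)
  also have "(\<integral>\<^sup>+x. k (h (snd x) + fst x, b (snd x)) \<partial>(gauss_measure \<Otimes>\<^sub>M distr M N W))
      = (\<integral>\<^sup>+w. \<integral>\<^sup>+z. k (h w + z, b w) \<partial>gauss_measure \<partial>distr M N W)"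
    by (subst P.nn_integral_snd[symmetric]) auto
  also have "\<dots> = (\<integral>\<^sup>+\<omega>. \<integral>\<^sup>+z. k (h (W \<omega>) + z, b (W \<omega>)) \<partial>gauss_measure \<partial>M)"
    by (rule nn_integral_distr) measurable
  also have "\<dots> = (\<integral>\<^sup>+\<omega>. \<integral>\<^sup>+a. ennreal (gauss (a - h (W \<omega>))) * k (a, b (W \<omega>)) \<partial>lborel \<partial>M)"
  proof (rule nn_integral_cong)
    fix \<omega> assume \<omega>: "\<omega> \<in> space M"
    then have [measurable]: "b (W \<omega>) \<in> space T" by (auto intro: measurable_space)
    have "(\<integral>\<^sup>+z. k (h (W \<omega>) + z, b (W \<omega>)) \<partial>gauss_measure)
        = (\<integral>\<^sup>+z. ennreal (gauss ((h (W \<omega>) + z) - h (W \<omega>))) * k (h (W \<omega>) + z, b (W \<omega>)) \<partial>lborel)"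
      by (subst nn_integral_density) auto
    also have "\<dots> = (\<integral>\<^sup>+a. ennreal (gauss (a - h (W \<omega>))) * k (a, b (W \<omega>)) \<partial>lborel)"
      by (rule nn_integral_lborel_shift) measurable
    finally show "(\<integral>\<^sup>+z. k (h (W \<omega>) + z, b (W \<omega>)) \<partial>gauss_measure)
      = (\<integral>\<^sup>+a. ennreal (gauss (a - h (W \<omega>))) * k (a, b (W \<omega>)) \<partial>lborel)" .
  qed
  finally show ?thesis .
qed

text \<open>Bounding the shifted Gaussian in \<open>nn_integral_additive_noise\<close> by 1
  dominates the joint law by Lebesgue measure times the law of the side information. The side
  information need not determine the signal, so the density is in general not explicit.\<close>

lemma (in prob_space) additive_noise_conditional_density:
  fixes Z :: "'a \<Rightarrow> 'c::euclidean_space"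
  assumes noise: "gaussian_noise M Z N W"
    and h [measurable]: "h \<in> borel_measurable N" and b [measurable]: "b \<in> N \<rightarrow>\<^sub>M T"
  obtains f :: "'c \<times> 'd \<Rightarrow> real" where "\<And>x. 0 \<le> f x" "\<And>x. f x \<le> 1"
    "distributed M (lborel \<Otimes>\<^sub>M distr M T (\<lambda>\<omega>. b (W \<omega>))) (\<lambda>\<omega>. (h (W \<omega>) + Z \<omega>, b (W \<omega>))) (\<lambda>x. ennreal (f x))"
proof -
  have [measurable]: "Z \<in> borel_measurable M" "W \<in> M \<rightarrow>\<^sub>M N"
    using noise by (simp_all add: gaussian_noise_def)
  let ?N = "lborel \<Otimes>\<^sub>M distr M T (\<lambda>\<omega>. b (W \<omega>)) :: ('c \<times> 'd) measure"
  interpret D: prob_space "distr M T (\<lambda>\<omega>. b (W \<omega>))" by (rule prob_space_distr) measurable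
  interpret P: pair_sigma_finite "lborel :: 'c measure" "distr M T (\<lambda>\<omega>. b (W \<omega>))" ..
  have "\<exists>f. (\<forall>x. 0 \<le> f x \<and> f x \<le> 1) \<and>
      distributed M ?N (\<lambda>\<omega>. (h (W \<omega>) + Z \<omega>, b (W \<omega>))) (\<lambda>x. ennreal (f x))"
  proof (rule dominated_bounded_density)
    show "sigma_finite_measure ?N" ..
    show "(\<lambda>\<omega>. (h (W \<omega>) + Z \<omega>, b (W \<omega>))) \<in> M \<rightarrow>\<^sub>M ?N" by measurable
    fix S assume S': "S \<in> sets ?N"
    have "sets ?N = sets (borel \<Otimes>\<^sub>M T)" by (rule sets_pair_measure_cong) auto
    with S' have S [measurable]: "S \<in> sets (borel \<Otimes>\<^sub>M T)" by simp
    note [measurable] = S'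
    have "emeasure (distr M ?N (\<lambda>\<omega>. (h (W \<omega>) + Z \<omega>, b (W \<omega>)))) S
        = (\<integral>\<^sup>+x. indicator S x \<partial>distr M ?N (\<lambda>\<omega>. (h (W \<omega>) + Z \<omega>, b (W \<omega>))))" by simp
    also have "\<dots> = (\<integral>\<^sup>+\<omega>. indicator S (h (W \<omega>) + Z \<omega>, b (W \<omega>)) \<partial>M)"
      by (rule nn_integral_distr) measurable
    also have "\<dots> = (\<integral>\<^sup>+\<omega>. \<integral>\<^sup>+a. ennreal (gauss (a - h (W \<omega>))) * indicator S (a, b (W \<omega>)) \<partial>lborel \<partial>M)"
      by (rule nn_integral_additive_noise[OF noise]) measurable
    also have "\<dots> \<le> (\<integral>\<^sup>+\<omega>. \<integral>\<^sup>+a. indicator S (a, b (W \<omega>)) \<partial>lborel \<partial>M)"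
      using gauss_le_1 by (intro nn_integral_mono) (auto simp: indicator_def)
    also have "\<dots> = (\<integral>\<^sup>+x. indicator S x \<partial>?N)"
      by (rule nn_integral_lborel_pair_distr[OF prob_space_axioms, symmetric]) measurable
    finally show "emeasure (distr M ?N (\<lambda>\<omega>. (h (W \<omega>) + Z \<omega>, b (W \<omega>)))) S \<le> ennreal 1 * emeasure ?N S"
      by simp
  qed simp
  then show ?thesis using that by blast
qed

lemma (in prob_space) additive_noise_density:
  fixes Z :: "'a \<Rightarrow> 'c::euclidean_space"
  assumes noise: "gaussian_noise M Z N W"
    and h [measurable]: "h \<in> borel_measurable N"
  obtains g :: "'c \<Rightarrow> real" where "\<And>x. 0 \<le> g x" "\<And>x. g x \<le> 1"
    "distributed M lborel (\<lambda>\<omega>. h (W \<omega>) + Z \<omega>) (\<lambda>x. ennreal (g x))"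
proof -
  have [measurable]: "Z \<in> borel_measurable M" "W \<in> M \<rightarrow>\<^sub>M N"
    using noise by (simp_all add: gaussian_noise_def)
  have "\<exists>g. (\<forall>x. 0 \<le> g x \<and> g x \<le> 1) \<and>
      distributed M lborel (\<lambda>\<omega>. h (W \<omega>) + Z \<omega>) (\<lambda>x. ennreal (g x))"
  proof (rule dominated_bounded_density)
    fix S :: "'c set" assume "S \<in> sets lborel"
    then have [measurable]: "S \<in> sets borel" by simp
    have "emeasure (distr M lborel (\<lambda>\<omega>. h (W \<omega>) + Z \<omega>)) S
        = (\<integral>\<^sup>+x. indicator S x \<partial>distr M lborel (\<lambda>\<omega>. h (W \<omega>) + Z \<omega>))" by simp
    \<comment> \<open>Constant side information \<open>()\<close> reduces the claim to the
      conditional formula.\<close>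
    also have "\<dots> = (\<integral>\<^sup>+\<omega>. indicator S (fst (h (W \<omega>) + Z \<omega>, ())) \<partial>M)"
      by (subst nn_integral_distr) auto
    also have "\<dots> = (\<integral>\<^sup>+\<omega>. \<integral>\<^sup>+a. ennreal (gauss (a - h (W \<omega>))) * indicator S (fst (a, ())) \<partial>lborel \<partial>M)"
      by (rule nn_integral_additive_noise[OF noise, where b="\<lambda>_. ()" and T="count_space UNIV"]) measurable
    also have "\<dots> \<le> (\<integral>\<^sup>+\<omega>. \<integral>\<^sup>+a. indicator S a \<partial>lborel \<partial>M)"
      using gauss_le_1 by (intro nn_integral_mono) (auto simp: indicator_def)
    also have "\<dots> = emeasure lborel S" by (simp add: emeasure_space_1)
    finally show "emeasure (distr M lborel (\<lambda>\<omega>. h (W \<omega>) + Z \<omega>)) S \<le> ennreal 1 * emeasure lborel S" by simp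
  qed (auto intro: sigma_finite_lborel)
  then show ?thesis using that by blast
qed

text \<open>Here the side information determines the signal, so the conditional density is known: at
  the actual output it is the noise density at the actual noise.\<close>

lemma (in prob_space) gaussian_channel_density:
  fixes Z :: "'a \<Rightarrow> 'c::euclidean_space" and h :: "'d \<Rightarrow> 'c"
  assumes noise: "gaussian_noise M Z N W"
    and b [measurable]: "b \<in> N \<rightarrow>\<^sub>M T" and h [measurable]: "h \<in> borel_measurable T"
  shows "distributed M (lborel \<Otimes>\<^sub>M distr M T (\<lambda>\<omega>. b (W \<omega>))) (\<lambda>\<omega>. (h (b (W \<omega>)) + Z \<omega>, b (W \<omega>)))
    (\<lambda>x. ennreal (gauss (fst x - h (snd x))))"
proof -
  have [measurable]: "Z \<in> borel_measurable M" "W \<in> M \<rightarrow>\<^sub>M N"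
    using noise by (simp_all add: gaussian_noise_def)
  show ?thesis
  proof (rule distributed_lborel_pair_distrI)
    fix S assume [measurable]: "S \<in> sets (borel \<Otimes>\<^sub>M T :: ('c \<times> 'd) measure)"
    show "(\<integral>\<^sup>+\<omega>. indicator S (h (b (W \<omega>)) + Z \<omega>, b (W \<omega>)) \<partial>M)
      = (\<integral>\<^sup>+\<omega>. \<integral>\<^sup>+a. ennreal (gauss (fst (a, b (W \<omega>)) - h (snd (a, b (W \<omega>))))) * indicator S (a, b (W \<omega>)) \<partial>lborel \<partial>M)"
      unfolding fst_conv snd_conv
      by (rule nn_integral_additive_noise[OF noise]) measurable
  qed measurable
qed

text \<open>Integrating a test set first over \<open>A'\<close> by \<open>D2\<close> and then over
  \<open>A\<close> by \<open>D1\<close> produces the product: the chain rule for densities.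
  Conditioning on the code \<open>\<phi> (A \<omega>)\<close> loses nothing because of
  \<open>\<psi>\<close>; the code appears because \<open>f2\<close> stems from an auxiliary variable
  with values in that space.\<close>

lemma (in prob_space) conditional_density_chain:
  fixes A :: "'a \<Rightarrow> 'c::euclidean_space" and A' :: "'a \<Rightarrow> 'd::euclidean_space"
    and f1 :: "'c \<times> 'e \<Rightarrow> real" and f2 :: "'d \<times> 'e \<times> 'f \<Rightarrow> real"
  assumes D1: "distributed M (lborel \<Otimes>\<^sub>M distr M T X) (\<lambda>\<omega>. (A \<omega>, X \<omega>)) (\<lambda>x. ennreal (f1 x))"
    and D2: "distributed M (lborel \<Otimes>\<^sub>M distr M (T \<Otimes>\<^sub>M R) (\<lambda>\<omega>. (X \<omega>, \<phi> (A \<omega>))))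
      (\<lambda>\<omega>. (A' \<omega>, X \<omega>, \<phi> (A \<omega>))) (\<lambda>x. ennreal (f2 x))"
    and X [measurable]: "X \<in> M \<rightarrow>\<^sub>M T" and A [measurable]: "A \<in> borel_measurable M" and A' [measurable]: "A' \<in> borel_measurable M"
    and \<phi> [measurable]: "\<phi> \<in> borel \<rightarrow>\<^sub>M R" and \<psi> [measurable]: "\<psi> \<in> R \<rightarrow>\<^sub>M borel" and inv: "\<And>a. \<psi> (\<phi> a) = a"
    and f1_nn: "\<And>x. 0 \<le> f1 x" and f2_nn: "\<And>x. 0 \<le> f2 x"
  shows "distributed M (lborel \<Otimes>\<^sub>M distr M T X) (\<lambda>\<omega>. ((A \<omega>, A' \<omega>), X \<omega>))
    (\<lambda>x. ennreal (f1 (fst (fst x), snd x) * f2 (snd (fst x), snd x, \<phi> (fst (fst x)))))"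
proof -
  have "f1 \<in> borel_measurable (lborel \<Otimes>\<^sub>M distr M T X)"
    using f1_nn D1 by (rule distributed_real_measurable)
  then have f1m [measurable]: "f1 \<in> borel_measurable (borel \<Otimes>\<^sub>M T)"
    by (simp cong: measurable_cong_sets sets_pair_measure_cong)
  have "f2 \<in> borel_measurable (lborel \<Otimes>\<^sub>M distr M (T \<Otimes>\<^sub>M R) (\<lambda>\<omega>. (X \<omega>, \<phi> (A \<omega>))))"
    using f2_nn D2 by (rule distributed_real_measurable)
  then have f2m [measurable]: "f2 \<in> borel_measurable (borel \<Otimes>\<^sub>M (T \<Otimes>\<^sub>M R))"
    by (simp cong: measurable_cong_sets sets_pair_measure_cong)
  show ?thesis
  proof (rule distributed_lborel_pair_distrI)
    show "(\<lambda>x. ennreal (f1 (fst (fst x), snd x) * f2 (snd (fst x), snd x, \<phi> (fst (fst x)))))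
      \<in> borel_measurable (borel \<Otimes>\<^sub>M T)"
      unfolding borel_prod[symmetric] by measurable
    fix S assume S: "S \<in> sets (borel \<Otimes>\<^sub>M T :: (('c \<times> 'd) \<times> 'e) measure)"
    then have [measurable]: "S \<in> sets ((borel \<Otimes>\<^sub>M borel) \<Otimes>\<^sub>M T)" unfolding borel_prod .
    define K where "K y = (\<integral>\<^sup>+a'. ennreal (f2 (a', snd y, \<phi> (fst y))) * indicator S ((fst y, a'), snd y) \<partial>lborel)" for y
    have [measurable]: "K \<in> borel_measurable (borel \<Otimes>\<^sub>M T)" unfolding K_def by measurable
    \<comment> \<open>\<open>\<psi>\<close> recovers \<open>A\<close> from its code, which makes the
      indicator a function of the triple described by \<open>D2\<close>.\<close>
    have "(\<integral>\<^sup>+\<omega>. indicator S ((A \<omega>, A' \<omega>), X \<omega>) \<partial>M)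
       = (\<integral>\<^sup>+\<omega>. (\<lambda>(a', x, u). indicator S ((\<psi> u, a'), x)) (A' \<omega>, X \<omega>, \<phi> (A \<omega>)) \<partial>M)"
      by (simp add: inv)
    also have "\<dots> = (\<integral>\<^sup>+y. ennreal (f2 y) * (\<lambda>(a', x, u). indicator S ((\<psi> u, a'), x)) y
        \<partial>(lborel \<Otimes>\<^sub>M distr M (T \<Otimes>\<^sub>M R) (\<lambda>\<omega>. (X \<omega>, \<phi> (A \<omega>)))))"
      by (rule distributed_nn_integral[OF D2, symmetric]) measurable
    also have "\<dots> = (\<integral>\<^sup>+\<omega>. \<integral>\<^sup>+a'. ennreal (f2 (a', X \<omega>, \<phi> (A \<omega>))) * indicator S ((A \<omega>, a'), X \<omega>) \<partial>lborel \<partial>M)"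
      by (subst nn_integral_lborel_pair_distr[OF prob_space_axioms]) (measurable, simp add: inv)
    also have "\<dots> = (\<integral>\<^sup>+\<omega>. K (A \<omega>, X \<omega>) \<partial>M)" by (simp add: K_def)
    also have "\<dots> = (\<integral>\<^sup>+y. ennreal (f1 y) * K y \<partial>(lborel \<Otimes>\<^sub>M distr M T X))"
      by (rule distributed_nn_integral[OF D1, symmetric]) measurable
    also have "\<dots> = (\<integral>\<^sup>+\<omega>. \<integral>\<^sup>+a. ennreal (f1 (a, X \<omega>)) * K (a, X \<omega>) \<partial>lborel \<partial>M)"
      by (rule nn_integral_lborel_pair_distr[OF prob_space_axioms]) measurable
    also have "\<dots> = (\<integral>\<^sup>+\<omega>. \<integral>\<^sup>+a. ennreal (f1 (a, X \<omega>)) *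
        (\<integral>\<^sup>+a'. ennreal (f2 (a', X \<omega>, \<phi> a)) * indicator S ((a, a'), X \<omega>) \<partial>lborel) \<partial>lborel \<partial>M)"
      by (simp add: K_def)
    also have "\<dots> = (\<integral>\<^sup>+\<omega>. \<integral>\<^sup>+y. ennreal (f1 (fst y, X \<omega>)) * (ennreal (f2 (snd y, X \<omega>, \<phi> (fst y))) * indicator S (y, X \<omega>)) \<partial>lborel \<partial>M)"
    proof (rule nn_integral_cong)
      fix \<omega> assume "\<omega> \<in> space M"
      then have [measurable]: "X \<omega> \<in> space T" by (auto intro: measurable_space)
      have "(\<integral>\<^sup>+a. ennreal (f1 (a, X \<omega>)) *
        (\<integral>\<^sup>+a'. ennreal (f2 (a', X \<omega>, \<phi> a)) * indicator S ((a, a'), X \<omega>) \<partial>lborel) \<partial>lborel)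
        = (\<integral>\<^sup>+a. \<integral>\<^sup>+a'. ennreal (f1 (a, X \<omega>)) * (ennreal (f2 (a', X \<omega>, \<phi> a)) * indicator S ((a, a'), X \<omega>)) \<partial>lborel \<partial>lborel)"
        by (subst nn_integral_cmult) auto
      also have "\<dots> = (\<integral>\<^sup>+y. ennreal (f1 (fst y, X \<omega>)) * (ennreal (f2 (snd y, X \<omega>, \<phi> (fst y))) * indicator S (y, X \<omega>)) \<partial>(lborel \<Otimes>\<^sub>M lborel))"
        by (subst lborel.nn_integral_fst[symmetric]) auto
      also have "\<dots> = (\<integral>\<^sup>+y. ennreal (f1 (fst y, X \<omega>)) * (ennreal (f2 (snd y, X \<omega>, \<phi> (fst y))) * indicator S (y, X \<omega>)) \<partial>lborel)"
        by (simp add: lborel_prod)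
      finally show "(\<integral>\<^sup>+a. ennreal (f1 (a, X \<omega>)) *
        (\<integral>\<^sup>+a'. ennreal (f2 (a', X \<omega>, \<phi> a)) * indicator S ((a, a'), X \<omega>) \<partial>lborel) \<partial>lborel)
        = (\<integral>\<^sup>+y. ennreal (f1 (fst y, X \<omega>)) * (ennreal (f2 (snd y, X \<omega>, \<phi> (fst y))) * indicator S (y, X \<omega>)) \<partial>lborel)" .
    qed
    finally show "(\<integral>\<^sup>+\<omega>. indicator S ((A \<omega>, A' \<omega>), X \<omega>) \<partial>M) =
      (\<integral>\<^sup>+\<omega>. \<integral>\<^sup>+y. ennreal (f1 (fst (fst (y, X \<omega>)), snd (y, X \<omega>)) * f2 (snd (fst (y, X \<omega>)), snd (y, X \<omega>), \<phi> (fst (fst (y, X \<omega>)))))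
        * indicator S (y, X \<omega>) \<partial>lborel \<partial>M)"
      by (simp add: ennreal_mult f1_nn f2_nn mult.assoc)
  qed measurable
qed

subsection \<open>Entropy bounds from a Gaussian reference density\<close>

lemma distr_pair_snd:
  assumes "prob_space P" "prob_space Q"
  shows "distr (P \<Otimes>\<^sub>M Q) Q snd = Q"
proof -
  interpret PP: prob_space P by fact
  interpret QQ: prob_space Q by fact
  interpret pair_prob_space P Q ..
  have "distr (P \<Otimes>\<^sub>M Q) Q snd = distr (distr (Q \<Otimes>\<^sub>M P) (P \<Otimes>\<^sub>M Q) (\<lambda>(x, y). (y, x))) Q snd"
    by (rule arg_cong[where f="\<lambda>N. distr N Q snd", OF distr_pair_swap])
  also have "\<dots> = distr (Q \<Otimes>\<^sub>M P) Q fst"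
    by (subst distr_distr) (auto simp: comp_def split_beta')
  also have "\<dots> = Q" by (rule PP.distr_pair_fst)
  finally show ?thesis .
qed

text \<open>Each section of \<open>q\<close> has mass at most 1, hence so has its average over the
  law of \<open>B\<close>, and Gibbs' inequality applies. Any such kernel yields an upper bound on
  the conditional entropy of \<open>A\<close> given \<open>B\<close>.\<close>

lemma (in prob_space) conditional_density_ln:
  fixes A :: "'a \<Rightarrow> 'c::euclidean_space"
  assumes D: "distributed M (lborel \<Otimes>\<^sub>M distr M T B) (\<lambda>\<omega>. (A \<omega>, B \<omega>)) (\<lambda>x. ennreal (f x))"
    and B [measurable]: "B \<in> M \<rightarrow>\<^sub>M T"
    and f: "\<And>x. 0 \<le> f x" "\<And>x. f x \<le> 1"
    and q [measurable]: "q \<in> borel_measurable (borel \<Otimes>\<^sub>M T)" and q_pos: "\<And>x. 0 < q x"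
    and q_int: "\<And>b. b \<in> space T \<Longrightarrow> (\<integral>\<^sup>+a. ennreal (q (a, b)) \<partial>lborel) \<le> 1"
    and q_ln: "integrable M (\<lambda>\<omega>. ln (q (A \<omega>, B \<omega>)))"
  shows "integrable M (\<lambda>\<omega>. ln (f (A \<omega>, B \<omega>)))"
    and "(\<integral>\<omega>. ln (q (A \<omega>, B \<omega>)) \<partial>M) \<le> (\<integral>\<omega>. ln (f (A \<omega>, B \<omega>)) \<partial>M)"
proof -
  have qm: "q \<in> borel_measurable (lborel \<Otimes>\<^sub>M distr M T B)"
    by (simp cong: measurable_cong_sets sets_pair_measure_cong)
  have "(\<integral>\<^sup>+x. ennreal (q x) \<partial>(lborel \<Otimes>\<^sub>M distr M T B)) = (\<integral>\<^sup>+\<omega>. \<integral>\<^sup>+a. ennreal (q (a, B \<omega>)) \<partial>lborel \<partial>M)"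
    by (rule nn_integral_lborel_pair_distr[OF prob_space_axioms]) measurable
  also have "\<dots> \<le> (\<integral>\<^sup>+\<omega>. 1 \<partial>M)"
    using measurable_space[OF B] by (intro nn_integral_mono q_int)
  finally have "(\<integral>\<^sup>+x. ennreal (q x) \<partial>(lborel \<Otimes>\<^sub>M distr M T B)) \<le> 1" by (simp add: emeasure_space_1)
  note * = gibbs_inequality[OF D f qm q_pos this q_ln]
  show "integrable M (\<lambda>\<omega>. ln (f (A \<omega>, B \<omega>)))"
    and "(\<integral>\<omega>. ln (q (A \<omega>, B \<omega>)) \<partial>M) \<le> (\<integral>\<omega>. ln (f (A \<omega>, B \<omega>)) \<partial>M)"
    by (fact *)+
qed

lemma (in prob_space) integrable_ln_gauss:
  "integrable M (\<lambda>\<omega>. (norm (A \<omega>))\<^sup>2) \<Longrightarrow> integrable M (\<lambda>\<omega>. ln (gauss (A \<omega>)))"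
  by (simp add: ln_gauss)

lemma (in prob_space) conditional_density_ln_integrable:
  fixes A :: "'a \<Rightarrow> 'c::euclidean_space"
  assumes D: "distributed M (lborel \<Otimes>\<^sub>M distr M T B) (\<lambda>\<omega>. (A \<omega>, B \<omega>)) (\<lambda>x. ennreal (f x))"
    and B: "B \<in> M \<rightarrow>\<^sub>M T"
    and f: "\<And>x. 0 \<le> f x" "\<And>x. f x \<le> 1"
    and A2: "integrable M (\<lambda>\<omega>. (norm (A \<omega>))\<^sup>2)"
  shows "integrable M (\<lambda>\<omega>. ln (f (A \<omega>, B \<omega>)))"
  \<comment> \<open>The comparison kernel ignores the side information; the second moment of
    \<open>A\<close> makes its logarithm integrable.\<close>
  by (rule conditional_density_ln(1)[OF D B f, where q="\<lambda>x. gauss (fst x)"])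
    (use nn_integral_gauss[of "0::'c"] in \<open>auto simp: gauss_pos integrable_ln_gauss[OF A2]\<close>)

text \<open>The comparison density is the standard Gaussian, whose cross entropy is finite by the
  second moment. The second claim later bounds the entropy of \<open>Y3\<close> uniformly over the
  admissible inputs.\<close>

lemma (in prob_space) density_ln:
  fixes A :: "'a \<Rightarrow> 'c::euclidean_space"
  assumes D: "distributed M lborel A (\<lambda>x. ennreal (g x))"
    and g: "\<And>x. 0 \<le> g x" "\<And>x. g x \<le> 1"
    and A2: "integrable M (\<lambda>\<omega>. (norm (A \<omega>))\<^sup>2)"
  shows "integrable M (\<lambda>\<omega>. ln (g (A \<omega>)))"
    and "(\<integral>\<omega>. ln (gauss (A \<omega>)) \<partial>M) \<le> (\<integral>\<omega>. ln (g (A \<omega>)) \<partial>M)"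
proof -
  have "(\<integral>\<^sup>+x. ennreal (gauss x) \<partial>(lborel :: 'c measure)) \<le> 1"
    using nn_integral_gauss[of "0::'c"] by simp
  note * = gibbs_inequality[OF D g _ gauss_pos this integrable_ln_gauss[OF A2]]
  show "integrable M (\<lambda>\<omega>. ln (g (A \<omega>)))" by (rule *) measurable
  show "(\<integral>\<omega>. ln (gauss (A \<omega>)) \<partial>M) \<le> (\<integral>\<omega>. ln (g (A \<omega>)) \<partial>M)" by (rule *) measurable
qed

lemma distr_gauss_measure_uminus:
  "distr gauss_measure borel uminus = (gauss_measure :: 'a::euclidean_space measure)"
proof -
  have "lborel = distr lborel borel (uminus :: 'a \<Rightarrow> 'a)"
    using lborel_affine[of "-1" "0::'a"] by (simp add: density_1)
  then have "(gauss_measure :: 'a measure) = density (distr lborel borel uminus) (\<lambda>x. ennreal (gauss x))"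
    by simp
  also have "\<dots> = distr (density lborel (\<lambda>x. ennreal (gauss (- x)))) borel uminus"
    by (subst density_distr) auto
  finally show ?thesis by simp
qed

lemma integrable_norm_square_gauss:
  "integrable (gauss_measure :: 'a::euclidean_space measure) (\<lambda>x. (norm x)\<^sup>2)"
  using nn_integral_norm_square_gauss[where 'a='a]
  by (intro integrableI_nonneg) auto

lemma bounded_linear_square_integrable:
  assumes "bounded_linear f" and [measurable]: "X \<in> borel_measurable M"
    and "integrable M (\<lambda>\<omega>. (norm (X \<omega>))\<^sup>2)"
  shows "integrable M (\<lambda>\<omega>. (norm (f (X \<omega>)))\<^sup>2)"
proof -
  interpret bounded_linear f by fact
  obtain K where K: "\<And>x. norm (f x) \<le> norm x * K" using bounded by blast
  have [measurable]: "f \<in> borel_measurable borel"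
    by (rule borel_measurable_continuous_onI) (rule continuous_on[OF continuous_on_id, simplified])
  show ?thesis
  proof (rule Bochner_Integration.integrable_bound)
    show "integrable M (\<lambda>\<omega>. K\<^sup>2 * (norm (X \<omega>))\<^sup>2)" using assms(3) by simp
    have "(norm (f x))\<^sup>2 \<le> K\<^sup>2 * (norm x)\<^sup>2" for x
      using power_mono[OF K, of x 2] by (simp add: power_mult_distrib mult.commute)
    then show "AE \<omega> in M. norm ((norm (f (X \<omega>)))\<^sup>2) \<le> norm (K\<^sup>2 * (norm (X \<omega>))\<^sup>2)" by simp
  qed measurable
qed

lemma norm_add_square_le: "(norm (x + y))\<^sup>2 \<le> 2 * (norm x)\<^sup>2 + 2 * (norm y)\<^sup>2"
  for x y :: "'a::real_normed_vector"
proof -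
  have "(norm (x + y))\<^sup>2 \<le> (norm x + norm y)\<^sup>2"
    by (intro power_mono norm_triangle_ineq) simp
  also have "\<dots> \<le> 2 * (norm x)\<^sup>2 + 2 * (norm y)\<^sup>2"
    using sum_squares_bound[of "norm x" "norm y"] by (simp add: power2_sum)
  finally show ?thesis .
qed

lemma norm_add_square_integrable:
  fixes X Y :: "'a \<Rightarrow> 'b::euclidean_space"
  assumes [measurable]: "X \<in> borel_measurable M" "Y \<in> borel_measurable M"
    and X: "integrable M (\<lambda>\<omega>. (norm (X \<omega>))\<^sup>2)" and Y: "integrable M (\<lambda>\<omega>. (norm (Y \<omega>))\<^sup>2)"
  shows "integrable M (\<lambda>\<omega>. (norm (X \<omega> + Y \<omega>))\<^sup>2)"
  by (rule Bochner_Integration.integrable_bound[where f="\<lambda>\<omega>. 2 * (norm (X \<omega>))\<^sup>2 + 2 * (norm (Y \<omega>))\<^sup>2"])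
    (use X Y norm_add_square_le in auto)

text \<open>For independent centred \<open>Z\<close> and \<open>Z'\<close> of equal law,
  \<open>f (Z - Z')\<close> has twice the second moment of \<open>f Z\<close>. The integrand is the
  difference of exponents that arises when \<open>predictive\<close> is compared with
  \<open>gauss\<close>; its vanishing mean leaves only a normalising constant.\<close>

lemma (in prob_space) gaussian_cross_moment:
  fixes Z Z' :: "'a \<Rightarrow> 'c::euclidean_space" and f :: "'c \<Rightarrow> 'v::euclidean_space"
  assumes D: "distributed M lborel (\<lambda>\<omega>. (Z \<omega>, Z' \<omega>)) (\<lambda>x. ennreal (gauss x))" and f: "linear f"
  shows "integrable M (\<lambda>\<omega>. (norm (Z \<omega>))\<^sup>2)" "integrable M (\<lambda>\<omega>. (norm (Z' \<omega>))\<^sup>2)"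
    and "integrable M (\<lambda>\<omega>. (norm (f (Z \<omega>)))\<^sup>2 - (norm (f (Z \<omega> - Z' \<omega>)))\<^sup>2 / 2)"
    and "(\<integral>\<omega>. (norm (f (Z \<omega>)))\<^sup>2 - (norm (f (Z \<omega> - Z' \<omega>)))\<^sup>2 / 2 \<partial>M) = 0"
proof -
  interpret bounded_linear f using f by (simp add: linear_conv_bounded_linear)
  have [measurable]: "f \<in> borel_measurable borel"
    by (rule borel_measurable_continuous_onI) (rule continuous_on[OF continuous_on_id, simplified])
  have pair [measurable]: "(\<lambda>\<omega>. (Z \<omega>, Z' \<omega>)) \<in> borel_measurable M"
    using distributed_measurable[OF D] by simp
  have [measurable]: "Z \<in> borel_measurable M" "Z' \<in> borel_measurable M"
    using measurable_compose[OF pair, of fst borel] measurable_compose[OF pair, of snd borel]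
    by (simp_all add: borel_prod[symmetric])
  interpret G: prob_space "gauss_measure :: 'c measure" by (rule prob_space_gauss)
  interpret P: pair_prob_space "gauss_measure :: 'c measure" "gauss_measure :: 'c measure" ..
  have law: "distr M (borel \<Otimes>\<^sub>M borel) (\<lambda>\<omega>. (Z \<omega>, Z' \<omega>)) = gauss_measure \<Otimes>\<^sub>M gauss_measure"
    unfolding gauss_measure_Pair borel_prod
    using distributed_distr_eq_density[OF D] by (simp add: distr_cong[OF refl sets_lborel refl])
  have dZ: "distr M borel Z = gauss_measure" and dZ': "distr M borel Z' = gauss_measure"
  proof -
    have "distr M borel Z = distr (distr M (borel \<Otimes>\<^sub>M borel) (\<lambda>\<omega>. (Z \<omega>, Z' \<omega>))) borel fst"
      by (subst distr_distr) (auto simp: comp_def)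
    also have "\<dots> = distr (gauss_measure \<Otimes>\<^sub>M (gauss_measure :: 'c measure)) gauss_measure fst"
      unfolding law by (rule distr_cong) auto
    finally show "distr M borel Z = gauss_measure" by (simp add: G.distr_pair_fst)
    have "distr M borel Z' = distr (distr M (borel \<Otimes>\<^sub>M borel) (\<lambda>\<omega>. (Z \<omega>, Z' \<omega>))) borel snd"
      by (subst distr_distr) (auto simp: comp_def)
    also have "\<dots> = distr ((gauss_measure :: 'c measure) \<Otimes>\<^sub>M gauss_measure) gauss_measure snd"
      unfolding law by (rule distr_cong) auto
    also have "\<dots> = gauss_measure" by (rule distr_pair_snd) (rule prob_space_gauss)+
    finally show "distr M borel Z' = gauss_measure" .
  qed
  have int: "integrable M (\<lambda>\<omega>. g (X \<omega>)) \<longleftrightarrow> integrable gauss_measure g"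
    and expectation: "(\<integral>\<omega>. g (X \<omega>) \<partial>M) = (\<integral>x. g x \<partial>gauss_measure)"
    if "distr M borel X = gauss_measure" "g \<in> borel_measurable borel" "X \<in> borel_measurable M"
    for X :: "'a \<Rightarrow> 'c" and g :: "'c \<Rightarrow> real"
    using that(2,3) by (simp_all add: that(1)[symmetric] integrable_distr_eq integral_distr)
  show Zi: "integrable M (\<lambda>\<omega>. (norm (Z \<omega>))\<^sup>2)"
    by (subst int[OF dZ]) (auto simp: integrable_norm_square_gauss)
  show Zi': "integrable M (\<lambda>\<omega>. (norm (Z' \<omega>))\<^sup>2)"
    by (subst int[OF dZ']) (auto simp: integrable_norm_square_gauss)
  have fZi: "integrable M (\<lambda>\<omega>. (norm (f (Z \<omega>)))\<^sup>2)" and fZi': "integrable M (\<lambda>\<omega>. (norm (f (Z' \<omega>)))\<^sup>2)"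
    by (rule bounded_linear_square_integrable[OF bounded_linear_axioms _ Zi], measurable)
      (rule bounded_linear_square_integrable[OF bounded_linear_axioms _ Zi'], measurable)
  have eq: "(\<integral>\<omega>. (norm (f (Z \<omega>)))\<^sup>2 \<partial>M) = (\<integral>\<omega>. (norm (f (Z' \<omega>)))\<^sup>2 \<partial>M)"
    using expectation[OF dZ, of "\<lambda>x. (norm (f x))\<^sup>2"] expectation[OF dZ', of "\<lambda>x. (norm (f x))\<^sup>2"] by simp
  have ci: "integrable M (\<lambda>\<omega>. f (Z \<omega>) \<bullet> f (Z' \<omega>))"
  proof (rule Bochner_Integration.integrable_bound)
    show "integrable M (\<lambda>\<omega>. (norm (f (Z \<omega>)))\<^sup>2 + (norm (f (Z' \<omega>)))\<^sup>2)" using fZi fZi' by simp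
    have "norm (x \<bullet> y) \<le> (norm x)\<^sup>2 + (norm y)\<^sup>2" for x y :: 'v
      using Cauchy_Schwarz_ineq2[of x y] sum_squares_bound[of "norm x" "norm y"]
        mult_nonneg_nonneg[OF norm_ge_zero[of x] norm_ge_zero[of y]] by simp
    then show "AE \<omega> in M. norm (f (Z \<omega>) \<bullet> f (Z' \<omega>)) \<le> norm ((norm (f (Z \<omega>)))\<^sup>2 + (norm (f (Z' \<omega>)))\<^sup>2)"
      by simp
  qed measurable
  have c0: "(\<integral>\<omega>. f (Z \<omega>) \<bullet> f (Z' \<omega>) \<partial>M) = 0"
  proof -
    \<comment> \<open>The cross term is odd under the sign change of the first coordinate, which
      preserves the joint law, so its mean is 0 without any computation of covariances.\<close>
    define h where "h = (\<lambda>(x, y). f x \<bullet> f y)"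
    have [measurable]: "h \<in> borel_measurable (borel \<Otimes>\<^sub>M borel)" by (simp add: h_def)
    have "gauss_measure \<Otimes>\<^sub>M gauss_measure
        = (distr gauss_measure borel uminus \<Otimes>\<^sub>M distr gauss_measure borel (\<lambda>x. x) :: ('c \<times> 'c) measure)"
      by (simp add: distr_gauss_measure_uminus distr_id2)
    also have "\<dots> = distr (gauss_measure \<Otimes>\<^sub>M gauss_measure) (borel \<Otimes>\<^sub>M borel) (\<lambda>(x, y). (- x, y))"
      by (rule pair_measure_distr) (auto simp: distr_id2 intro: G.sigma_finite_measure_axioms)
    finally have sym: "(gauss_measure \<Otimes>\<^sub>M gauss_measure :: ('c \<times> 'c) measure)
      = distr (gauss_measure \<Otimes>\<^sub>M gauss_measure) (borel \<Otimes>\<^sub>M borel) (\<lambda>(x, y). (- x, y))" .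
    have "(\<integral>x. h x \<partial>(gauss_measure \<Otimes>\<^sub>M gauss_measure))
        = (\<integral>x. h x \<partial>distr (gauss_measure \<Otimes>\<^sub>M gauss_measure) (borel \<Otimes>\<^sub>M borel) (\<lambda>(x, y). (- x, y)))"
      by (rule arg_cong[where f="\<lambda>N. integral\<^sup>L N h", OF sym])
    also have "\<dots> = (\<integral>x. h ((\<lambda>(x, y). (- x, y)) x) \<partial>(gauss_measure \<Otimes>\<^sub>M gauss_measure))"
      by (rule integral_distr) measurable
    also have "\<dots> = - (\<integral>x. h x \<partial>(gauss_measure \<Otimes>\<^sub>M gauss_measure))"
      by (simp add: h_def split_beta' linear_neg[OF f])
    finally have "(\<integral>x. h x \<partial>(gauss_measure \<Otimes>\<^sub>M gauss_measure)) = 0" by simp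
    moreover have "(\<integral>x. h x \<partial>(gauss_measure \<Otimes>\<^sub>M gauss_measure)) = (\<integral>\<omega>. f (Z \<omega>) \<bullet> f (Z' \<omega>) \<partial>M)"
      unfolding law[symmetric] by (subst integral_distr) (auto simp: h_def)
    ultimately show ?thesis by simp
  qed
  have pointwise: "(norm (f x))\<^sup>2 - (norm (f (x - y)))\<^sup>2 / 2
      = ((norm (f x))\<^sup>2 - (norm (f y))\<^sup>2) / 2 + f x \<bullet> f y" for x y
    by (simp add: diff power2_norm_eq_inner inner_diff_left inner_diff_right inner_commute field_simps)
  show "integrable M (\<lambda>\<omega>. (norm (f (Z \<omega>)))\<^sup>2 - (norm (f (Z \<omega> - Z' \<omega>)))\<^sup>2 / 2)"
    unfolding pointwise using fZi fZi' ci by simp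
  show "(\<integral>\<omega>. (norm (f (Z \<omega>)))\<^sup>2 - (norm (f (Z \<omega> - Z' \<omega>)))\<^sup>2 / 2 \<partial>M) = 0"
    unfolding pointwise using fZi fZi' ci eq c0 by simp
qed

text \<open>The density at \<open>y\<close> of \<open>L (L\<^sup>* u + N) + Z\<close> with independent standard Gaussian \<open>N\<close> and \<open>Z\<close>, for isometric \<open>L\<close>.\<close>

definition predictive :: "('v::euclidean_space \<Rightarrow> 'a::euclidean_space) \<Rightarrow> 'a \<Rightarrow> 'a \<Rightarrow> real" where
  "predictive L u y = exp (- (norm (y - L (adjoint L y)))\<^sup>2 - (norm (adjoint L (y - u)))\<^sup>2 / 2)
     / (sqrt pi ^ DIM('a) * sqrt 2 ^ DIM('v))"

lemma isometry_inner:
  assumes "linear L" and "\<And>x. norm (L x) = norm x"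
  shows "L x \<bullet> L y = x \<bullet> y"
  unfolding dot_norm by (metis assms linear_add)

lemma adjoint_isometry:
  fixes L :: "'v::euclidean_space \<Rightarrow> 'a::euclidean_space"
  assumes L: "linear L" and iso: "\<And>x. norm (L x) = norm x"
  shows "adjoint L (L x) = x"
proof -
  have "z \<bullet> adjoint L (L x) = z \<bullet> x" for z
    using adjoint_works[OF L] isometry_inner[OF L iso] by simp
  then show ?thesis by (metis vector_eq_ldot)
qed

text \<open>\<open>L (adjoint L y)\<close> is the orthogonal projection of \<open>y\<close> to the
  range of \<open>L\<close>, so the squared distance to a point of the range splits.\<close>

lemma isometry_Pythagoras:
  fixes L :: "'v::euclidean_space \<Rightarrow> 'a::euclidean_space"
  assumes L: "linear L" and iso: "\<And>x. norm (L x) = norm x"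
  shows "(norm (y - L x))\<^sup>2 = (norm (y - L (adjoint L y)))\<^sup>2 + (norm (adjoint L y - x))\<^sup>2"
proof -
  let ?A = "adjoint L"
  have adj: "L z \<bullet> y = z \<bullet> ?A y" for z y using adjoint_works[OF L] by simp
  have A: "linear ?A" using L by (rule adjoint_linear)
  have "(y - L (?A y)) \<bullet> L (?A y - x) = 0"
    by (subst inner_commute) (simp add: adj linear_diff[OF A] adjoint_isometry[OF L iso])
  moreover have "y - L x = (y - L (?A y)) + L (?A y - x)" by (simp add: linear_diff[OF L])
  ultimately show ?thesis
    by (metis norm_add_Pythagorean iso orthogonal_def)
qed

lemma predictive_measurable [measurable]:
  fixes L :: "'v::euclidean_space \<Rightarrow> 'a::euclidean_space"
  assumes L: "linear L" and [measurable]: "f \<in> borel_measurable M" "g \<in> borel_measurable M"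
  shows "(\<lambda>x. predictive L (f x) (g x)) \<in> borel_measurable M"
proof -
  have [measurable]: "L \<in> borel_measurable borel" "adjoint L \<in> borel_measurable borel"
    using L adjoint_linear[OF L] by (auto intro!: borel_measurable_continuous_onI linear_continuous_on
        simp: linear_conv_bounded_linear)
  show ?thesis unfolding predictive_def by measurable
qed

text \<open>The function is a mixture over \<open>x\<close> of the densities
  \<open>gauss (y - L x)\<close>, with mixing density \<open>gauss (x - adjoint L u)\<close>. Fubini
  reduces its mass to that of these Gaussians, so Lebesgue measure need not be split along the range
  of \<open>L\<close>.\<close>

lemma predictive_integral:
  fixes L :: "'v::euclidean_space \<Rightarrow> 'a::euclidean_space"
  assumes L: "linear L" and iso: "\<And>x. norm (L x) = norm x"
  shows "(\<integral>\<^sup>+y. ennreal (predictive L u y) \<partial>lborel) = 1"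
proof -
  let ?A = "adjoint L"
  have A: "linear ?A" using L by (rule adjoint_linear)
  have [measurable]: "L \<in> borel_measurable borel" "?A \<in> borel_measurable borel"
    using L A by (auto intro!: borel_measurable_continuous_onI linear_continuous_on
        simp: linear_conv_bounded_linear)
  have "ennreal (predictive L u y) = (\<integral>\<^sup>+x. ennreal (gauss (y - L x)) * ennreal (gauss (x - ?A u)) \<partial>lborel)" for y
  proof -
    \<comment> \<open>Completing the square: the squared distances to two points add up to half the
      squared distance between them plus twice the squared distance to their midpoint
      \<open>m\<close>.\<close>
    define m where "m = (1/2) *\<^sub>R (?A y + ?A u)"
    define c where "c = exp (- (norm (y - L (?A y)))\<^sup>2 - (norm (?A (y - u)))\<^sup>2 / 2) / (sqrt pi ^ DIM('a) * sqrt pi ^ DIM('v))"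
    have "(norm (?A y - x))\<^sup>2 + (norm (x - ?A u))\<^sup>2 = (norm (?A (y - u)))\<^sup>2 / 2 + 2 * (norm (x - m))\<^sup>2" for x
      unfolding m_def linear_diff[OF A] power2_norm_eq_inner
      by (simp add: inner_diff_left inner_diff_right inner_add_left inner_add_right inner_commute field_simps)
    then have "(norm (y - L x))\<^sup>2 + (norm (x - ?A u))\<^sup>2
        = (norm (y - L (?A y)))\<^sup>2 + (norm (?A (y - u)))\<^sup>2 / 2 + 2 * (norm (x - m))\<^sup>2" for x
      by (simp add: isometry_Pythagoras[OF L iso, of y x] add.assoc)
    then have "- (norm (y - L x))\<^sup>2 - (norm (x - ?A u))\<^sup>2
        = - (norm (y - L (?A y)))\<^sup>2 - (norm (?A (y - u)))\<^sup>2 / 2 + - (2 * (norm (x - m))\<^sup>2)" for x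
      by (smt (verit))
    then have "gauss (y - L x) * gauss (x - ?A u) = c * exp (- (2 * (norm (x - m))\<^sup>2))" for x
      unfolding gauss_def c_def times_divide_times_eq mult_exp_exp
      by (simp add: exp_add[symmetric])
    then have "(\<integral>\<^sup>+x. ennreal (gauss (y - L x)) * ennreal (gauss (x - ?A u)) \<partial>lborel)
        = (\<integral>\<^sup>+x. ennreal c * ennreal (exp (- (2 * (norm (x - m))\<^sup>2))) \<partial>lborel)"
      by (simp add: ennreal_mult[symmetric] c_def)
    also have "\<dots> = ennreal c * ennreal (sqrt (pi / 2) ^ DIM('v))"
      by (subst nn_integral_cmult, measurable, subst nn_integral_gaussian) auto
    also have "\<dots> = ennreal (c * sqrt (pi / 2) ^ DIM('v))"
      by (simp add: ennreal_mult[symmetric] c_def)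
    \<comment> \<open>The powers of \<open>sqrt pi\<close> for \<open>'v\<close> cancel and
      \<open>sqrt 2\<close> stays in the denominator. This constant will be the whole loss.\<close>
    also have "c * sqrt (pi / 2) ^ DIM('v) = predictive L u y"
      by (simp add: c_def predictive_def real_sqrt_divide power_divide)
    finally show ?thesis by simp
  qed
  then have "(\<integral>\<^sup>+y. ennreal (predictive L u y) \<partial>lborel)
      = (\<integral>\<^sup>+y. \<integral>\<^sup>+x. ennreal (gauss (y - L x)) * ennreal (gauss (x - ?A u)) \<partial>lborel \<partial>lborel)" by simp
  also have "\<dots> = (\<integral>\<^sup>+x. \<integral>\<^sup>+y. ennreal (gauss (y - L x)) * ennreal (gauss (x - ?A u)) \<partial>lborel \<partial>lborel)"
    by (rule lborel_pair.Fubini') measurable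
  also have "\<dots> = (\<integral>\<^sup>+x. ennreal (gauss (x - ?A u)) \<partial>lborel)"
    by (simp add: nn_integral_multc nn_integral_gauss)
  also have "\<dots> = 1" by (rule nn_integral_gauss)
  finally show ?thesis .
qed

text \<open>Take \<open>predictive\<close> around \<open>\<psi> (B \<omega>)\<close> as comparison
  kernel. Its exponent is free of the signal: it sees \<open>A\<close> only orthogonally to the
  range of \<open>L\<close> and in the difference to \<open>\<psi> (B \<omega>)\<close>. Up to a
  term of mean 0 it is the exponent of the noise density, and \<open>sqrt 2 ^ DIM('v)\<close> gives
  the loss, here in nats.\<close>

lemma (in prob_space) conditional_density_ln_predictive:
  fixes A Z Z' :: "'a \<Rightarrow> 'c::euclidean_space" and L :: "'v::euclidean_space \<Rightarrow> 'c"
  assumes D: "distributed M (lborel \<Otimes>\<^sub>M distr M T B) (\<lambda>\<omega>. (A \<omega>, B \<omega>)) (\<lambda>x. ennreal (f x))"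
    and B [measurable]: "B \<in> M \<rightarrow>\<^sub>M T"
    and f: "\<And>x. 0 \<le> f x" "\<And>x. f x \<le> 1"
    and \<psi> [measurable]: "\<psi> \<in> T \<rightarrow>\<^sub>M borel"
    and L: "linear L" and iso: "\<And>x. norm (L x) = norm x"
    and A: "\<And>\<omega>. A \<omega> = L (K \<omega>) + Z \<omega>" and B': "\<And>\<omega>. \<psi> (B \<omega>) = L (K \<omega>) + Z' \<omega>"
    and Z: "distributed M lborel (\<lambda>\<omega>. (Z \<omega>, Z' \<omega>)) (\<lambda>x. ennreal (gauss x))"
  shows "(\<integral>\<omega>. ln (gauss (Z \<omega>)) \<partial>M) - real DIM('v) / 2 * ln 2 \<le> (\<integral>\<omega>. ln (f (A \<omega>, B \<omega>)) \<partial>M)"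
proof -
  define q where "q x = predictive L (\<psi> (snd x)) (fst x)" for x
  let ?L = "adjoint L"
  let ?d = "\<lambda>\<omega>. (norm (?L (Z \<omega>)))\<^sup>2 - (norm (?L (Z \<omega> - Z' \<omega>)))\<^sup>2 / 2"
  have lin: "linear ?L" using L by (rule adjoint_linear)
  note Zs = gaussian_cross_moment[OF Z lin]
  have lnq: "ln (q (A \<omega>, B \<omega>)) = ln (gauss (Z \<omega>)) - real DIM('v) / 2 * ln 2 + ?d \<omega>" for \<omega>
  proof -
    have "(norm (Z \<omega> - L 0))\<^sup>2 = (norm (Z \<omega> - L (?L (Z \<omega>))))\<^sup>2 + (norm (?L (Z \<omega>) - 0))\<^sup>2"
      by (rule isometry_Pythagoras[OF L iso])
    then have 1: "(norm (Z \<omega>))\<^sup>2 = (norm (Z \<omega> - L (?L (Z \<omega>))))\<^sup>2 + (norm (?L (Z \<omega>)))\<^sup>2"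
      by (simp add: linear_0[OF L])
    \<comment> \<open>The signal \<open>L (K \<omega>)\<close> is its own projection and
      cancels.\<close>
    have 2: "A \<omega> - L (?L (A \<omega>)) = Z \<omega> - L (?L (Z \<omega>))"
      by (simp add: A linear_add[OF lin] linear_add[OF L] adjoint_isometry[OF L iso])
    have 3: "A \<omega> - \<psi> (B \<omega>) = Z \<omega> - Z' \<omega>" by (simp add: A B')
    show ?thesis
      unfolding q_def predictive_def fst_conv snd_conv 2 3 ln_gauss 1
      by (simp add: ln_div ln_mult ln_realpow ln_sqrt algebra_simps)
  qed
  have "(\<integral>\<omega>. ln (q (A \<omega>, B \<omega>)) \<partial>M) \<le> (\<integral>\<omega>. ln (f (A \<omega>, B \<omega>)) \<partial>M)"
  proof (rule conditional_density_ln(2)[OF D B f])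
    show "q \<in> borel_measurable (borel \<Otimes>\<^sub>M T)" unfolding q_def by (rule predictive_measurable[OF L]) measurable
    show "0 < q x" for x by (simp add: q_def predictive_def)
    show "(\<integral>\<^sup>+a. ennreal (q (a, b)) \<partial>lborel) \<le> 1" for b
      by (simp add: q_def predictive_integral[OF L iso])
    show "integrable M (\<lambda>\<omega>. ln (q (A \<omega>, B \<omega>)))"
      unfolding lnq using Zs(3) integrable_ln_gauss[OF Zs(1)] by simp
  qed
  moreover have "(\<integral>\<omega>. ln (q (A \<omega>, B \<omega>)) \<partial>M) = (\<integral>\<omega>. ln (gauss (Z \<omega>)) \<partial>M) - real DIM('v) / 2 * ln 2"
    unfolding lnq using Zs(3,4) integrable_ln_gauss[OF Zs(1)] by (simp add: prob_space)
  ultimately show ?thesis by simp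
qed

subsection \<open>Independence and coordinates\<close>

lemma (in prob_space) gaussian_noise_distr:
  assumes "gaussian_noise M Z N W"
  shows "distr M borel Z = gauss_measure"
proof -
  have [measurable]: "Z \<in> borel_measurable M" "W \<in> M \<rightarrow>\<^sub>M N"
    and law: "distr M (borel \<Otimes>\<^sub>M N) (\<lambda>\<omega>. (Z \<omega>, W \<omega>)) = gauss_measure \<Otimes>\<^sub>M distr M N W"
    using assms by (simp_all add: gaussian_noise_def)
  interpret W: prob_space "distr M N W" by (rule prob_space_distr) measurable
  have "distr M borel Z = distr (distr M (borel \<Otimes>\<^sub>M N) (\<lambda>\<omega>. (Z \<omega>, W \<omega>))) borel fst"
    by (subst distr_distr) (auto simp: comp_def)
  also have "\<dots> = distr (gauss_measure \<Otimes>\<^sub>M distr M N W) gauss_measure fst"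
    unfolding law by (rule distr_cong) auto
  also have "\<dots> = gauss_measure" by (rule W.distr_pair_fst)
  finally show ?thesis .
qed

lemma (in prob_space) gaussian_noise_product_law:
  fixes Z :: "'a \<Rightarrow> 'c::euclidean_space"
  assumes Z [measurable]: "Z \<in> borel_measurable M" and W [measurable]: "W \<in> M \<rightarrow>\<^sub>M Q"
    and Q: "prob_space Q"
    and law: "distr M (Q \<Otimes>\<^sub>M borel) (\<lambda>\<omega>. (W \<omega>, Z \<omega>)) = Q \<Otimes>\<^sub>M gauss_measure"
  shows "gaussian_noise M Z Q W"
proof -
  interpret G: prob_space "gauss_measure :: 'c measure" by (rule prob_space_gauss)
  interpret Q: prob_space Q by fact
  interpret pp: pair_prob_space "gauss_measure :: 'c measure" Q ..
  have "distr M Q W = distr (distr M (Q \<Otimes>\<^sub>M borel) (\<lambda>\<omega>. (W \<omega>, Z \<omega>))) Q fst"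
    by (subst distr_distr) (auto simp: comp_def)
  also have "\<dots> = Q" unfolding law by (rule G.distr_pair_fst)
  finally have W': "distr M Q W = Q" .
  have "distr M (borel \<Otimes>\<^sub>M Q) (\<lambda>\<omega>. (Z \<omega>, W \<omega>))
      = distr (distr M (Q \<Otimes>\<^sub>M borel) (\<lambda>\<omega>. (W \<omega>, Z \<omega>))) (borel \<Otimes>\<^sub>M Q) (\<lambda>(x, y). (y, x))"
    by (subst distr_distr) (auto simp: comp_def)
  also have "\<dots> = distr (Q \<Otimes>\<^sub>M gauss_measure) (gauss_measure \<Otimes>\<^sub>M Q) (\<lambda>(x, y). (y, x))"
    unfolding law by (rule distr_cong) (auto intro!: sets_pair_measure_cong)
  also have "\<dots> = gauss_measure \<Otimes>\<^sub>M Q" by (rule pp.distr_pair_swap[symmetric])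
  finally show ?thesis by (simp add: gaussian_noise_def W')
qed

text \<open>Nested products are associative only up to a map. The second version also moves the
  middle factor to the end, which isolates the relay noise.\<close>

lemma distr_pair_assoc:
  assumes "prob_space A" "prob_space B" "prob_space C"
  shows "distr (A \<Otimes>\<^sub>M (B \<Otimes>\<^sub>M C)) ((A \<Otimes>\<^sub>M B) \<Otimes>\<^sub>M C) (\<lambda>\<omega>. ((fst \<omega>, fst (snd \<omega>)), snd (snd \<omega>)))
      = (A \<Otimes>\<^sub>M B) \<Otimes>\<^sub>M C"
    and "distr (A \<Otimes>\<^sub>M (B \<Otimes>\<^sub>M C)) ((A \<Otimes>\<^sub>M C) \<Otimes>\<^sub>M B) (\<lambda>\<omega>. ((fst \<omega>, snd (snd \<omega>)), fst (snd \<omega>)))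
      = (A \<Otimes>\<^sub>M C) \<Otimes>\<^sub>M B"
proof -
  interpret A: prob_space A by fact
  interpret B: prob_space B by fact
  interpret C: prob_space C by fact
  interpret BC: pair_prob_space B C ..
  interpret AB: pair_prob_space A B ..
  interpret AC: pair_prob_space A C ..
  have Fubini: "(\<integral>\<^sup>+\<omega>. f \<omega> \<partial>(A \<Otimes>\<^sub>M (B \<Otimes>\<^sub>M C))) = (\<integral>\<^sup>+a. \<integral>\<^sup>+b. \<integral>\<^sup>+c. f (a, b, c) \<partial>C \<partial>B \<partial>A)"
    if [measurable]: "f \<in> borel_measurable (A \<Otimes>\<^sub>M (B \<Otimes>\<^sub>M C))" for f
    by (subst BC.nn_integral_fst[symmetric]) (auto intro!: nn_integral_cong simp: C.nn_integral_fst[symmetric])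
  show "distr (A \<Otimes>\<^sub>M (B \<Otimes>\<^sub>M C)) ((A \<Otimes>\<^sub>M B) \<Otimes>\<^sub>M C) (\<lambda>\<omega>. ((fst \<omega>, fst (snd \<omega>)), snd (snd \<omega>)))
      = (A \<Otimes>\<^sub>M B) \<Otimes>\<^sub>M C"
  proof (rule pair_measure_eqI[symmetric])
    fix S U assume [measurable]: "S \<in> sets (A \<Otimes>\<^sub>M B)" "U \<in> sets C"
    have "emeasure (distr (A \<Otimes>\<^sub>M (B \<Otimes>\<^sub>M C)) ((A \<Otimes>\<^sub>M B) \<Otimes>\<^sub>M C) (\<lambda>\<omega>. ((fst \<omega>, fst (snd \<omega>)), snd (snd \<omega>)))) (S \<times> U)
        = (\<integral>\<^sup>+x. indicator (S \<times> U) x \<partial>distr (A \<Otimes>\<^sub>M (B \<Otimes>\<^sub>M C)) ((A \<Otimes>\<^sub>M B) \<Otimes>\<^sub>M C) (\<lambda>\<omega>. ((fst \<omega>, fst (snd \<omega>)), snd (snd \<omega>))))"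
      by simp
    also have "\<dots> = (\<integral>\<^sup>+\<omega>. indicator S (fst \<omega>, fst (snd \<omega>)) * indicator U (snd (snd \<omega>)) \<partial>(A \<Otimes>\<^sub>M (B \<Otimes>\<^sub>M C)))"
      by (subst nn_integral_distr) (auto simp: indicator_times)
    also have "\<dots> = (\<integral>\<^sup>+a. \<integral>\<^sup>+b. indicator S (a, b) * emeasure C U \<partial>B \<partial>A)"
      by (subst Fubini) (auto simp: nn_integral_cmult)
    also have "\<dots> = (\<integral>\<^sup>+x. indicator S x * emeasure C U \<partial>(A \<Otimes>\<^sub>M B))"
      by (subst B.nn_integral_fst[symmetric]) auto
    also have "\<dots> = emeasure (A \<Otimes>\<^sub>M B) S * emeasure C U" by (simp add: nn_integral_multc)
    finally show "emeasure (A \<Otimes>\<^sub>M B) S * emeasure C U =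
      emeasure (distr (A \<Otimes>\<^sub>M (B \<Otimes>\<^sub>M C)) ((A \<Otimes>\<^sub>M B) \<Otimes>\<^sub>M C) (\<lambda>\<omega>. ((fst \<omega>, fst (snd \<omega>)), snd (snd \<omega>)))) (S \<times> U)"
      by simp
  qed (auto intro: AB.sigma_finite_measure_axioms C.sigma_finite_measure_axioms)
  show "distr (A \<Otimes>\<^sub>M (B \<Otimes>\<^sub>M C)) ((A \<Otimes>\<^sub>M C) \<Otimes>\<^sub>M B) (\<lambda>\<omega>. ((fst \<omega>, snd (snd \<omega>)), fst (snd \<omega>)))
      = (A \<Otimes>\<^sub>M C) \<Otimes>\<^sub>M B"
  proof (rule pair_measure_eqI[symmetric])
    fix S U assume [measurable]: "S \<in> sets (A \<Otimes>\<^sub>M C)" "U \<in> sets B"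
    have "emeasure (distr (A \<Otimes>\<^sub>M (B \<Otimes>\<^sub>M C)) ((A \<Otimes>\<^sub>M C) \<Otimes>\<^sub>M B) (\<lambda>\<omega>. ((fst \<omega>, snd (snd \<omega>)), fst (snd \<omega>)))) (S \<times> U)
        = (\<integral>\<^sup>+x. indicator (S \<times> U) x \<partial>distr (A \<Otimes>\<^sub>M (B \<Otimes>\<^sub>M C)) ((A \<Otimes>\<^sub>M C) \<Otimes>\<^sub>M B) (\<lambda>\<omega>. ((fst \<omega>, snd (snd \<omega>)), fst (snd \<omega>))))"
      by simp
    also have "\<dots> = (\<integral>\<^sup>+\<omega>. indicator S (fst \<omega>, snd (snd \<omega>)) * indicator U (fst (snd \<omega>)) \<partial>(A \<Otimes>\<^sub>M (B \<Otimes>\<^sub>M C)))"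
      by (subst nn_integral_distr) (auto simp: indicator_times)
    also have "\<dots> = (\<integral>\<^sup>+a. (\<integral>\<^sup>+c. indicator S (a, c) \<partial>C) * emeasure B U \<partial>A)"
    proof (subst Fubini, measurable, rule nn_integral_cong)
      fix a assume [measurable]: "a \<in> space A"
      show "(\<integral>\<^sup>+b. \<integral>\<^sup>+c. indicator S (fst (a, b, c), snd (snd (a, b, c))) * indicator U (fst (snd (a, b, c))) \<partial>C \<partial>B)
        = (\<integral>\<^sup>+c. indicator S (a, c) \<partial>C) * emeasure B U"
        by (simp add: nn_integral_multc nn_integral_cmult)
    qed
    also have "\<dots> = (\<integral>\<^sup>+a. \<integral>\<^sup>+c. indicator S (a, c) \<partial>C \<partial>A) * emeasure B U"
      by (rule nn_integral_multc) measurable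
    also have "\<dots> = emeasure (A \<Otimes>\<^sub>M C) S * emeasure B U"
      by (subst C.nn_integral_fst) auto
    finally show "emeasure (A \<Otimes>\<^sub>M C) S * emeasure B U =
      emeasure (distr (A \<Otimes>\<^sub>M (B \<Otimes>\<^sub>M C)) ((A \<Otimes>\<^sub>M C) \<Otimes>\<^sub>M B) (\<lambda>\<omega>. ((fst \<omega>, snd (snd \<omega>)), fst (snd \<omega>)))) (S \<times> U)"
      by simp
  qed (auto intro: AC.sigma_finite_measure_axioms B.sigma_finite_measure_axioms)
qed

lemma distributed_lborelI:
  assumes "X \<in> borel_measurable M" and "distr M borel X = density lborel f" and "f \<in> borel_measurable borel"
  shows "distributed M lborel X f"
  using assms by (simp add: distributed_def distr_cong[OF refl sets_lborel refl])

lemma bounded_linear_matrix_vector_mult_complex: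
  "bounded_linear ((*v) (G :: complex ^ 'n::finite ^ 'm::finite))"
proof -
  have "linear ((*v) G)"
    by (rule linearI)
      (simp_all add: vec_eq_iff matrix_vector_mult_def scaleR_sum_right distrib_left sum.distrib)
  then show ?thesis by (simp add: linear_conv_bounded_linear)
qed

lemma matrix_vector_mult_complex_measurable [measurable]:
  "(*v) (G :: complex ^ 'n::finite ^ 'm::finite) \<in> borel_measurable borel"
  by (intro borel_measurable_continuous_onI linear_continuous_on bounded_linear_matrix_vector_mult_complex)

text \<open>The dimension of the auxiliary vector is a number in \<open>R_PDF\<close>, while the
  relay output carries its dimension in the type. These maps pass between the two without loss of
  information.\<close>

lemma aux_space_coordinates:
  obtains \<phi> :: "complex ^ 'n::finite \<Rightarrow> nat \<Rightarrow> complex" and \<psi>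
  where "\<phi> \<in> borel \<rightarrow>\<^sub>M aux_space CARD('n)" "\<psi> \<in> aux_space CARD('n) \<rightarrow>\<^sub>M borel" "\<And>v. \<psi> (\<phi> v) = v"
proof -
  obtain e :: "'n \<Rightarrow> nat" where e: "bij_betw e UNIV {..<CARD('n)}"
    using ex_bij_betw_finite_nat[of "UNIV :: 'n set"] by (auto simp: atLeast0LessThan)
  \<comment> \<open>Restriction to the index set makes the function extensional, as the points of
    \<open>aux_space\<close> have to be.\<close>
  define \<phi> :: "complex ^ 'n \<Rightarrow> nat \<Rightarrow> complex" where "\<phi> v = (\<lambda>i\<in>{..<CARD('n)}. v $ inv e i)" for v
  define \<psi> :: "(nat \<Rightarrow> complex) \<Rightarrow> complex ^ 'n" where "\<psi> u = (\<chi> j. u (e j))" for u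
  have ei: "e j \<in> {..<CARD('n)}" for j using e by (auto simp: bij_betw_def)
  have "inv e (e j) = j" for j using e by (simp add: bij_betw_def)
  then have "\<psi> (\<phi> v) = v" for v using ei by (simp add: \<psi>_def \<phi>_def vec_eq_iff)
  moreover have "\<phi> \<in> borel \<rightarrow>\<^sub>M aux_space CARD('n)"
    unfolding \<phi>_def aux_space_def
    by (intro measurable_restrict borel_measurable_continuous_onI continuous_intros)
  moreover have "\<psi> \<in> aux_space CARD('n) \<rightarrow>\<^sub>M borel"
  proof -
    have [measurable]: "(\<lambda>u. u (e j)) \<in> borel_measurable (aux_space CARD('n))" for j
      unfolding aux_space_def by (rule measurable_component_singleton[OF ei])
    show ?thesis
      by (rule borel_measurable_euclidean_space[THEN iffD2])
        (auto simp: Basis_vec_def inner_axis \<psi>_def)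
  qed
  ultimately show ?thesis using that by blast
qed

text \<open>The range of \<open>G\<close> has dimension at most \<open>DIM('b)\<close> and is
  enlarged to a subspace of exactly that dimension, for which \<open>le\<close> leaves room;
  subspaces of equal dimension are isometric. The isometry is only real-linear, which suffices
  because the loss counts real dimensions.\<close>

lemma isometry_covering_range:
  fixes G :: "'b::euclidean_space \<Rightarrow> 'a::euclidean_space"
  assumes G: "linear G" and le: "DIM('b) \<le> DIM('a)"
  obtains L :: "'b \<Rightarrow> 'a" where "linear L" "\<And>x. norm (L x) = norm x" "range G \<subseteq> range L"
proof -
  have d: "dim (range G) \<le> DIM('b)" using dim_image_le[OF G, of UNIV] by simp
  obtain B where B: "independent B" "range G \<subseteq> span B" "card B = dim (range G)"
    using basis_exists[of "range G"] by metis
  let ?C = "extend_basis B"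
  have C: "independent ?C" "span ?C = UNIV" "B \<subseteq> ?C"
    using B(1) by (simp_all add: independent_extend_basis span_extend_basis extend_basis_superset)
  have "finite ?C" using C(1) by (rule independent_imp_finite)
  moreover have "card ?C = DIM('a)" using C(1,2) by (metis dim_UNIV dim_span_eq_card_independent)
  ultimately obtain E where E: "B \<subseteq> E" "E \<subseteq> ?C" "card E = DIM('b)"
    using exists_subset_between[OF _ _ C(3), of "DIM('b)"] B(3) d le by metis
  have "dim (UNIV :: 'b set) = dim (span E)"
    using independent_mono[OF C(1) E(2)] E(3) by (simp add: dim_eq_card_independent)
  then obtain L :: "'b \<Rightarrow> 'a" where "linear L" "L ` UNIV = span E" "\<And>x. norm (L x) = norm x"
    using isometries_subspaces[OF subspace_UNIV subspace_span] by (metis UNIV_I)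
  moreover have "range G \<subseteq> span E" using B(2) span_mono[OF E(1)] by blast
  ultimately show ?thesis using that by blast
qed

text \<open>One version per position of the Gaussian factor: end of a pair for the joint noise
  \<open>(Z2, Z3)\<close>, end of a triple for \<open>Z3\<close>, middle of a triple for
  \<open>Z2\<close>.\<close>

lemma gaussian_noise_factor:
  fixes A :: "'a measure" and B :: "'b measure"
  assumes A: "prob_space A" and B: "prob_space B"
  shows "gaussian_noise (A \<Otimes>\<^sub>M (gauss_measure :: 'c::euclidean_space measure)) snd A fst"
    and "gaussian_noise (A \<Otimes>\<^sub>M (B \<Otimes>\<^sub>M (gauss_measure :: 'c measure))) (\<lambda>\<omega>. snd (snd \<omega>))
      (A \<Otimes>\<^sub>M B) (\<lambda>\<omega>. (fst \<omega>, fst (snd \<omega>)))"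
    and "gaussian_noise (A \<Otimes>\<^sub>M ((gauss_measure :: 'c measure) \<Otimes>\<^sub>M B)) (\<lambda>\<omega>. fst (snd \<omega>))
      (A \<Otimes>\<^sub>M B) (\<lambda>\<omega>. (fst \<omega>, snd (snd \<omega>)))"
proof -
  let ?g = "gauss_measure :: 'c measure"
  have g: "prob_space ?g" by (rule prob_space_gauss)
  interpret a1: prob_space "A \<Otimes>\<^sub>M ?g" by (rule prob_space_pair[OF A g])
  interpret a2: prob_space "A \<Otimes>\<^sub>M (B \<Otimes>\<^sub>M ?g)" by (rule prob_space_pair[OF A prob_space_pair[OF B g]])
  interpret a3: prob_space "A \<Otimes>\<^sub>M (?g \<Otimes>\<^sub>M B)" by (rule prob_space_pair[OF A prob_space_pair[OF g B]])
  have AB: "prob_space (A \<Otimes>\<^sub>M B)" by (rule prob_space_pair[OF A B])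
  have "distr (A \<Otimes>\<^sub>M ?g) (A \<Otimes>\<^sub>M borel) (\<lambda>\<omega>. (fst \<omega>, snd \<omega>)) = A \<Otimes>\<^sub>M ?g"
    by (subst prod.collapse, rule distr_id2) (rule sets_pair_measure_cong; simp)
  then show "gaussian_noise (A \<Otimes>\<^sub>M ?g) snd A fst"
    by (intro a1.gaussian_noise_product_law A) auto
  have "distr (A \<Otimes>\<^sub>M (B \<Otimes>\<^sub>M ?g)) ((A \<Otimes>\<^sub>M B) \<Otimes>\<^sub>M borel) (\<lambda>\<omega>. ((fst \<omega>, fst (snd \<omega>)), snd (snd \<omega>)))
      = (A \<Otimes>\<^sub>M B) \<Otimes>\<^sub>M ?g"
    by (subst distr_pair_assoc(1)[OF A B g, symmetric]) (rule distr_cong; auto intro!: sets_pair_measure_cong)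
  then show "gaussian_noise (A \<Otimes>\<^sub>M (B \<Otimes>\<^sub>M ?g)) (\<lambda>\<omega>. snd (snd \<omega>)) (A \<Otimes>\<^sub>M B) (\<lambda>\<omega>. (fst \<omega>, fst (snd \<omega>)))"
    by (intro a2.gaussian_noise_product_law AB) auto
  have "distr (A \<Otimes>\<^sub>M (?g \<Otimes>\<^sub>M B)) ((A \<Otimes>\<^sub>M B) \<Otimes>\<^sub>M borel) (\<lambda>\<omega>. ((fst \<omega>, snd (snd \<omega>)), fst (snd \<omega>)))
      = (A \<Otimes>\<^sub>M B) \<Otimes>\<^sub>M ?g"
    by (subst distr_pair_assoc(2)[OF A g B, symmetric]) (rule distr_cong; auto intro!: sets_pair_measure_cong)
  then show "gaussian_noise (A \<Otimes>\<^sub>M (?g \<Otimes>\<^sub>M B)) (\<lambda>\<omega>. fst (snd \<omega>)) (A \<Otimes>\<^sub>M B) (\<lambda>\<omega>. (fst \<omega>, snd (snd \<omega>)))"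
    by (intro a3.gaussian_noise_product_law AB) auto
qed

lemma (in prob_space) gaussian_noise_square_integrable:
  fixes Z :: "'a \<Rightarrow> 'c::euclidean_space"
  assumes "gaussian_noise M Z N W"
  shows "integrable M (\<lambda>\<omega>. (norm (Z \<omega>))\<^sup>2)"
proof -
  have [measurable]: "Z \<in> borel_measurable M" using assms by (simp add: gaussian_noise_def)
  have "integrable (distr M borel Z) (\<lambda>x. (norm x)\<^sup>2)"
    using integrable_norm_square_gauss gaussian_noise_distr[OF assms] by simp
  then show ?thesis by (subst (asm) integrable_distr_eq) auto
qed

text \<open>When \<open>B\<close> determines the signal, the conditional density of the output
  equals the noise density at the noise, so the information is output entropy minus noise
  entropy.\<close>

lemma (in prob_space) mutual_information_gaussian_channel:
  fixes Z :: "'a \<Rightarrow> 'c::euclidean_space" and h :: "'d \<Rightarrow> 'c"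
  assumes noise: "gaussian_noise M Z N W"
    and b [measurable]: "b \<in> N \<rightarrow>\<^sub>M T" and h [measurable]: "h \<in> borel_measurable T"
    and A: "\<And>\<omega>. A \<omega> = h (b (W \<omega>)) + Z \<omega>" and B: "\<And>\<omega>. B \<omega> = b (W \<omega>)"
    and Dg: "distributed M lborel A (\<lambda>x. ennreal (g x))" and g: "\<And>x. 0 \<le> g x" "\<And>x. g x \<le> 1"
    and A2: "integrable M (\<lambda>\<omega>. (norm (A \<omega>))\<^sup>2)"
  shows "mutual_information 2 borel T A B = ((\<integral>\<omega>. ln (gauss (Z \<omega>)) \<partial>M) - (\<integral>\<omega>. ln (g (A \<omega>)) \<partial>M)) / ln 2"
    and "mutual_information 2 T borel B A = ((\<integral>\<omega>. ln (gauss (Z \<omega>)) \<partial>M) - (\<integral>\<omega>. ln (g (A \<omega>)) \<partial>M)) / ln 2"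
proof -
  have [measurable]: "W \<in> M \<rightarrow>\<^sub>M N" using noise by (simp add: gaussian_noise_def)
  have B_eq: "B = (\<lambda>\<omega>. b (W \<omega>))" and A_eq: "A = (\<lambda>\<omega>. h (b (W \<omega>)) + Z \<omega>)" using A B by auto
  have Bm [measurable]: "B \<in> M \<rightarrow>\<^sub>M T" unfolding B_eq by measurable
  have D: "distributed M (lborel \<Otimes>\<^sub>M distr M T B) (\<lambda>\<omega>. (A \<omega>, B \<omega>)) (\<lambda>x. ennreal (gauss (fst x - h (snd x))))"
    using gaussian_channel_density[OF noise b h] by (simp add: A_eq B_eq)
  have Z_eq: "A \<omega> - h (B \<omega>) = Z \<omega>" for \<omega> by (simp add: A B)
  have Zi: "integrable M (\<lambda>\<omega>. ln (gauss (Z \<omega>)))"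
    by (rule integrable_ln_gauss[OF gaussian_noise_square_integrable[OF noise]])
  note gi = density_ln(1)[OF Dg g A2]
  show "mutual_information 2 borel T A B = ((\<integral>\<omega>. ln (gauss (Z \<omega>)) \<partial>M) - (\<integral>\<omega>. ln (g (A \<omega>)) \<partial>M)) / ln 2"
    using mutual_information_densities(1)[OF sigma_finite_lborel sets_lborel[symmetric] Bm D Dg _ g(1) _ gi] Zi
    by (simp add: Z_eq)
  show "mutual_information 2 T borel B A = ((\<integral>\<omega>. ln (gauss (Z \<omega>)) \<partial>M) - (\<integral>\<omega>. ln (g (A \<omega>)) \<partial>M)) / ln 2"
    using mutual_information_densities(2)[OF sigma_finite_lborel sets_lborel[symmetric] Bm D Dg _ g(1) _ gi] Zi
    by (simp add: Z_eq)
qed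

subsection \<open>The channel with an auxiliary copy of the relay output\<close>

locale cutset_input =
  fixes G21 :: "complex ^ 't1::finite ^ 'r2::finite"
    and G31 :: "complex ^ 't1 ^ 'r3::finite"
    and G32 :: "complex ^ 't2::finite ^ 'r3"
    and P :: real
    and F :: "((complex ^ 't1) \<times> (complex ^ 't2)) measure"
  assumes prob_F: "prob_space F" and sets_F [measurable_cong]: "sets F = sets (borel \<Otimes>\<^sub>M borel)"
    and power: "power_constraint F fst P" "power_constraint F snd P"
begin

text \<open>Sample points are \<open>(((x1, x2), z2'), (z2, z3))\<close>, where \<open>z2'\<close> is the extra copy of the relay noise.\<close>

definition \<Omega> :: "((((complex ^ 't1) \<times> (complex ^ 't2)) \<times> (complex ^ 'r2)) \<times> ((complex ^ 'r2) \<times> (complex ^ 'r3))) measure" where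
  "\<Omega> = (F \<Otimes>\<^sub>M gauss_measure) \<Otimes>\<^sub>M (gauss_measure \<Otimes>\<^sub>M gauss_measure)"

lemma sets_\<Omega> [measurable_cong]:
  "sets \<Omega> = sets (((borel \<Otimes>\<^sub>M borel) \<Otimes>\<^sub>M borel) \<Otimes>\<^sub>M (borel \<Otimes>\<^sub>M borel))"
  unfolding \<Omega>_def by (intro sets_pair_measure_cong) (simp_all add: sets_F)

lemma prob_F\<gamma>: "prob_space (F \<Otimes>\<^sub>M (gauss_measure :: (complex ^ 'r2) measure))"
  by (rule prob_space_pair[OF prob_F prob_space_gauss])

sublocale prob_space \<Omega>
  unfolding \<Omega>_def
  by (rule prob_space_pair[OF prob_F\<gamma> prob_space_pair[OF prob_space_gauss prob_space_gauss]])

definition "X1 \<omega> = fst (fst (fst \<omega>))" for \<omega> :: "(((complex ^ 't1) \<times> (complex ^ 't2)) \<times> (complex ^ 'r2)) \<times> ((complex ^ 'r2) \<times> (complex ^ 'r3))"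
definition "X2 \<omega> = snd (fst (fst \<omega>))" for \<omega> :: "(((complex ^ 't1) \<times> (complex ^ 't2)) \<times> (complex ^ 'r2)) \<times> ((complex ^ 'r2) \<times> (complex ^ 'r3))"
definition "Z2' \<omega> = snd (fst \<omega>)" for \<omega> :: "(((complex ^ 't1) \<times> (complex ^ 't2)) \<times> (complex ^ 'r2)) \<times> ((complex ^ 'r2) \<times> (complex ^ 'r3))"
definition "Z2 \<omega> = fst (snd \<omega>)" for \<omega> :: "(((complex ^ 't1) \<times> (complex ^ 't2)) \<times> (complex ^ 'r2)) \<times> ((complex ^ 'r2) \<times> (complex ^ 'r3))"
definition "Z3 \<omega> = snd (snd \<omega>)" for \<omega> :: "(((complex ^ 't1) \<times> (complex ^ 't2)) \<times> (complex ^ 'r2)) \<times> ((complex ^ 'r2) \<times> (complex ^ 'r3))"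
text \<open>The auxiliary variable before its encoding in \<open>aux_space\<close>. The fresh noise
  \<open>Z2'\<close> keeps it independent of the channel noises.\<close>

definition "V \<omega> = G21 *v X1 \<omega> + Z2' \<omega>"
definition "Y2 \<omega> = G21 *v X1 \<omega> + Z2 \<omega>"
definition "Y3 \<omega> = G31 *v X1 \<omega> + G32 *v X2 \<omega> + Z3 \<omega>"

lemmas rv_defs = X1_def X2_def Z2'_def Z2_def Z3_def V_def Y2_def Y3_def

lemma rv_measurable [measurable]:
  "X1 \<in> borel_measurable \<Omega>" "X2 \<in> borel_measurable \<Omega>" "Z2' \<in> borel_measurable \<Omega>" "Z2 \<in> borel_measurable \<Omega>"
  "Z3 \<in> borel_measurable \<Omega>" "V \<in> borel_measurable \<Omega>" "Y2 \<in> borel_measurable \<Omega>" "Y3 \<in> borel_measurable \<Omega>"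
  unfolding rv_defs[abs_def] by measurable

lemma distr_fst_fst: "distr \<Omega> F (\<lambda>\<omega>. fst (fst \<omega>)) = F"
proof -
  let ?N = "gauss_measure \<Otimes>\<^sub>M gauss_measure :: ((complex ^ 'r2) \<times> (complex ^ 'r3)) measure"
  let ?G = "gauss_measure :: (complex ^ 'r2) measure"
  interpret N: prob_space ?N by (rule prob_space_pair[OF prob_space_gauss prob_space_gauss])
  interpret G: prob_space ?G by (rule prob_space_gauss)
  have "distr \<Omega> F (\<lambda>\<omega>. fst (fst \<omega>)) = distr (distr \<Omega> (F \<Otimes>\<^sub>M ?G) fst) F fst"
    by (subst distr_distr) (auto simp: comp_def \<Omega>_def)
  also have "distr \<Omega> (F \<Otimes>\<^sub>M ?G) fst = F \<Otimes>\<^sub>M ?G" unfolding \<Omega>_def by (rule N.distr_pair_fst)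
  also have "distr (F \<Otimes>\<^sub>M ?G) F fst = F" by (rule G.distr_pair_fst)
  finally show ?thesis .
qed

lemma inputs_square_integrable:
  "integrable \<Omega> (\<lambda>\<omega>. (norm (X1 \<omega>))\<^sup>2)" "integrable \<Omega> (\<lambda>\<omega>. (norm (X2 \<omega>))\<^sup>2)"
proof -
  have m: "(\<lambda>\<omega>. fst (fst \<omega>)) \<in> \<Omega> \<rightarrow>\<^sub>M F" unfolding \<Omega>_def by measurable
  have i1: "integrable F (\<lambda>x. (norm (fst x))\<^sup>2)" and i2: "integrable F (\<lambda>x. (norm (snd x))\<^sup>2)"
    using power by (auto intro!: integrableI_nonneg simp: power_constraint_def intro: le_less_trans)
  then have "integrable (distr \<Omega> F (\<lambda>\<omega>. fst (fst \<omega>))) (\<lambda>x. (norm (fst x))\<^sup>2)"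
    "integrable (distr \<Omega> F (\<lambda>\<omega>. fst (fst \<omega>))) (\<lambda>x. (norm (snd x))\<^sup>2)"
    unfolding distr_fst_fst .
  then show "integrable \<Omega> (\<lambda>\<omega>. (norm (X1 \<omega>))\<^sup>2)" "integrable \<Omega> (\<lambda>\<omega>. (norm (X2 \<omega>))\<^sup>2)"
    by (simp_all add: integrable_distr_eq[OF m] X1_def X2_def)
qed

text \<open>The remaining randomness contains \<open>Z2'\<close>, so \<open>V\<close> can be side
  information for an output with noise \<open>Z2\<close>.\<close>

lemma noise2: "gaussian_noise \<Omega> Z2 ((F \<Otimes>\<^sub>M gauss_measure) \<Otimes>\<^sub>M gauss_measure) (\<lambda>\<omega>. (fst \<omega>, snd (snd \<omega>)))"
  unfolding \<Omega>_def Z2_def[abs_def] by (rule gaussian_noise_factor(3)[OF prob_F\<gamma> prob_space_gauss])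

lemma noise3: "gaussian_noise \<Omega> Z3 ((F \<Otimes>\<^sub>M gauss_measure) \<Otimes>\<^sub>M gauss_measure) (\<lambda>\<omega>. (fst \<omega>, fst (snd \<omega>)))"
  unfolding \<Omega>_def Z3_def[abs_def] by (rule gaussian_noise_factor(2)[OF prob_F\<gamma> prob_space_gauss])

lemma noise23: "gaussian_noise \<Omega> (\<lambda>\<omega>. (Z2 \<omega>, Z3 \<omega>)) (F \<Otimes>\<^sub>M gauss_measure) fst"
proof -
  have "(\<lambda>\<omega>. (Z2 \<omega>, Z3 \<omega>)) = snd" by (auto simp: Z2_def Z3_def)
  then show ?thesis
    unfolding \<Omega>_def gauss_measure_Pair using gaussian_noise_factor(1)[OF prob_F\<gamma> prob_F\<gamma>] by simp
qed

text \<open>The relay noise and its copy come from different factors of \<open>\<Omega>\<close>;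
  \<open>gaussian_cross_moment\<close> works on this joint law.\<close>

lemma noise22': "distributed \<Omega> lborel (\<lambda>\<omega>. (Z2 \<omega>, Z2' \<omega>)) (\<lambda>x. ennreal (gauss x))"
proof (rule distributed_lborelI)
  let ?G = "gauss_measure :: (complex ^ 'r2) measure" and ?G3 = "gauss_measure :: (complex ^ 'r3) measure"
  interpret G: prob_space ?G by (rule prob_space_gauss)
  interpret G3: prob_space ?G3 by (rule prob_space_gauss)
  interpret pp: pair_prob_space ?G ?G ..
  have Z2': "distr (F \<Otimes>\<^sub>M ?G) ?G snd = ?G" by (rule distr_pair_snd[OF prob_F prob_space_gauss])
  have Z2: "distr (?G \<Otimes>\<^sub>M ?G3) ?G fst = ?G" by (rule G3.distr_pair_fst)
  have "distr \<Omega> borel (\<lambda>\<omega>. (Z2 \<omega>, Z2' \<omega>)) = distr (distr \<Omega> (?G \<Otimes>\<^sub>M ?G) (\<lambda>(q, r). (snd q, fst r))) (?G \<Otimes>\<^sub>M ?G) (\<lambda>(x, y). (y, x))"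
    by (subst distr_distr)
      (auto simp: comp_def split_beta' Z2_def Z2'_def borel_prod[symmetric] intro!: distr_cong sets_pair_measure_cong)
  also have "distr \<Omega> (?G \<Otimes>\<^sub>M ?G) (\<lambda>(q, r). (snd q, fst r)) = distr (F \<Otimes>\<^sub>M ?G) ?G snd \<Otimes>\<^sub>M distr (?G \<Otimes>\<^sub>M ?G3) ?G fst"
    unfolding \<Omega>_def
    by (rule pair_measure_distr[symmetric]) (auto simp: Z2 intro: G.sigma_finite_measure_axioms)
  also have "\<dots> = ?G \<Otimes>\<^sub>M ?G" by (simp only: Z2 Z2')
  also have "distr (?G \<Otimes>\<^sub>M ?G) (?G \<Otimes>\<^sub>M ?G) (\<lambda>(x, y). (y, x)) = ?G \<Otimes>\<^sub>M ?G"
    by (rule pp.distr_pair_swap[symmetric])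
  also have "\<dots> = gauss_measure" by (rule gauss_measure_Pair)
  finally show "distr \<Omega> borel (\<lambda>\<omega>. (Z2 \<omega>, Z2' \<omega>)) = gauss_measure" .
  show "(\<lambda>\<omega>. (Z2 \<omega>, Z2' \<omega>)) \<in> borel_measurable \<Omega>" by (simp add: borel_prod[symmetric])
qed measurable

lemma square_integrable_matrix:
  fixes G :: "complex ^ 'n::finite ^ 'm::finite"
  assumes [measurable]: "X \<in> borel_measurable \<Omega>" and "integrable \<Omega> (\<lambda>\<omega>. (norm (X \<omega>))\<^sup>2)"
  shows "integrable \<Omega> (\<lambda>\<omega>. (norm (G *v X \<omega>))\<^sup>2)"
  by (rule bounded_linear_square_integrable[OF bounded_linear_matrix_vector_mult_complex assms])

lemma outputs_square_integrable:
  "integrable \<Omega> (\<lambda>\<omega>. (norm (Y2 \<omega>))\<^sup>2)" "integrable \<Omega> (\<lambda>\<omega>. (norm (Y3 \<omega>))\<^sup>2)"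
  "integrable \<Omega> (\<lambda>\<omega>. (norm (Y2 \<omega>, Y3 \<omega>))\<^sup>2)"
proof -
  note z = gaussian_noise_square_integrable[OF noise2] gaussian_noise_square_integrable[OF noise3]
  show Y2: "integrable \<Omega> (\<lambda>\<omega>. (norm (Y2 \<omega>))\<^sup>2)"
    unfolding Y2_def by (intro norm_add_square_integrable square_integrable_matrix inputs_square_integrable z; measurable)
  show Y3: "integrable \<Omega> (\<lambda>\<omega>. (norm (Y3 \<omega>))\<^sup>2)"
    unfolding Y3_def by (intro norm_add_square_integrable square_integrable_matrix inputs_square_integrable z; measurable)
  show "integrable \<Omega> (\<lambda>\<omega>. (norm (Y2 \<omega>, Y3 \<omega>))\<^sup>2)"
    using Y2 Y3 by (simp add: norm_Pair)
qed

text \<open>Forgetting \<open>Z2'\<close> turns \<open>\<Omega>\<close> into the relay space of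
  \<open>F\<close>, so the cutset rate can be computed on \<open>\<Omega>\<close>, next to the rate
  with the auxiliary variable.\<close>

lemma relay_space_F: "relay_space F = distr \<Omega> (F \<Otimes>\<^sub>M (gauss_measure \<Otimes>\<^sub>M gauss_measure)) (\<lambda>\<omega>. (fst (fst \<omega>), snd \<omega>))"
proof -
  let ?G = "gauss_measure :: (complex ^ 'r2) measure"
  let ?N = "gauss_measure \<Otimes>\<^sub>M gauss_measure :: ((complex ^ 'r2) \<times> (complex ^ 'r3)) measure"
  interpret N: prob_space ?N by (rule prob_space_pair[OF prob_space_gauss prob_space_gauss])
  interpret G: prob_space ?G by (rule prob_space_gauss)
  have "relay_space F = distr (F \<Otimes>\<^sub>M ?G) F fst \<Otimes>\<^sub>M distr ?N ?N (\<lambda>x. x)"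
    unfolding relay_space_def std_cgaussian_eq by (simp add: G.distr_pair_fst distr_id2)
  also have "\<dots> = distr \<Omega> (F \<Otimes>\<^sub>M ?N) (\<lambda>(q, n). (fst q, n))"
    unfolding \<Omega>_def
    by (rule pair_measure_distr) (auto simp: distr_id2 intro: N.sigma_finite_measure_axioms)
  finally show ?thesis by (simp add: split_beta')
qed

text \<open>Discarding \<open>Z2\<close> or discarding \<open>Z2'\<close> leaves the same law of the
  inputs, one relay noise and \<open>Z3\<close>, and both triples are the same function
  \<open>k\<close> of these data. Hence \<open>Y3\<close> has the same entropy given
  \<open>X2\<close> and \<open>V\<close> as given \<open>X2\<close> and \<open>Y2\<close>.\<close>

lemma law_swap:
  assumes [measurable]: "\<phi> \<in> borel \<rightarrow>\<^sub>M R"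
  shows "distr \<Omega> (borel \<Otimes>\<^sub>M (borel \<Otimes>\<^sub>M R)) (\<lambda>\<omega>. (Y3 \<omega>, X2 \<omega>, \<phi> (V \<omega>)))
    = distr \<Omega> (borel \<Otimes>\<^sub>M (borel \<Otimes>\<^sub>M R)) (\<lambda>\<omega>. (Y3 \<omega>, X2 \<omega>, \<phi> (Y2 \<omega>)))"
proof -
  let ?G = "gauss_measure :: (complex ^ 'r2) measure" and ?G3 = "gauss_measure :: (complex ^ 'r3) measure"
  let ?N = "?G \<Otimes>\<^sub>M ?G3" and ?M = "(F \<Otimes>\<^sub>M ?G) \<Otimes>\<^sub>M ?G3"
  define k where "k q = (G31 *v fst (fst (fst q)) + G32 *v snd (fst (fst q)) + snd q, snd (fst (fst q)),
    \<phi> (G21 *v fst (fst (fst q)) + snd (fst q)))" for q :: "(((complex ^ 't1) \<times> (complex ^ 't2)) \<times> (complex ^ 'r2)) \<times> (complex ^ 'r3)"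
  have [measurable]: "k \<in> ?M \<rightarrow>\<^sub>M borel \<Otimes>\<^sub>M (borel \<Otimes>\<^sub>M R)" unfolding k_def[abs_def] by measurable
  interpret G3: prob_space ?G3 by (rule prob_space_gauss)
  have N3: "distr ?N ?G3 snd = ?G3" by (rule distr_pair_snd[OF prob_space_gauss prob_space_gauss])
  have "?M = distr (F \<Otimes>\<^sub>M ?G) (F \<Otimes>\<^sub>M ?G) (\<lambda>x. x) \<Otimes>\<^sub>M distr ?N ?G3 snd"
    by (simp add: N3 distr_id2)
  also have "\<dots> = distr \<Omega> ?M (\<lambda>(q, n). (q, snd n))"
    unfolding \<Omega>_def by (rule pair_measure_distr) (auto simp: N3 intro: G3.sigma_finite_measure_axioms)
  finally have V: "distr \<Omega> ?M (\<lambda>(q, n). (q, snd n)) = ?M" by (rule sym)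
  have "distr (F \<Otimes>\<^sub>M ?N) ?M (\<lambda>\<omega>. ((fst \<omega>, fst (snd \<omega>)), snd (snd \<omega>))) = ?M"
    by (rule distr_pair_assoc(1)[OF prob_F prob_space_gauss prob_space_gauss])
  then have "distr (distr \<Omega> (F \<Otimes>\<^sub>M ?N) (\<lambda>\<omega>. (fst (fst \<omega>), snd \<omega>))) ?M (\<lambda>\<omega>. ((fst \<omega>, fst (snd \<omega>)), snd (snd \<omega>))) = ?M"
    unfolding relay_space_F[symmetric] relay_space_def std_cgaussian_eq .
  then have Y: "distr \<Omega> ?M (\<lambda>\<omega>. ((fst (fst \<omega>), fst (snd \<omega>)), snd (snd \<omega>))) = ?M"
    by (subst (asm) distr_distr) (auto simp: comp_def)
  have "distr \<Omega> (borel \<Otimes>\<^sub>M (borel \<Otimes>\<^sub>M R)) (\<lambda>\<omega>. (Y3 \<omega>, X2 \<omega>, \<phi> (V \<omega>)))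
      = distr (distr \<Omega> ?M (\<lambda>(q, n). (q, snd n))) (borel \<Otimes>\<^sub>M (borel \<Otimes>\<^sub>M R)) k"
    by (subst distr_distr) (auto simp: comp_def k_def rv_defs split_beta')
  also have "\<dots> = distr (distr \<Omega> ?M (\<lambda>\<omega>. ((fst (fst \<omega>), fst (snd \<omega>)), snd (snd \<omega>)))) (borel \<Otimes>\<^sub>M (borel \<Otimes>\<^sub>M R)) k"
    unfolding V Y ..
  also have "\<dots> = distr \<Omega> (borel \<Otimes>\<^sub>M (borel \<Otimes>\<^sub>M R)) (\<lambda>\<omega>. (Y3 \<omega>, X2 \<omega>, \<phi> (Y2 \<omega>)))"
    by (subst distr_distr) (auto simp: comp_def k_def rv_defs)
  finally show ?thesis .
qed

section \<open>The auxiliary input law and both rates on the common sample space\<close>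

definition input_with_aux :: "(complex ^ 'r2 \<Rightarrow> nat \<Rightarrow> complex) \<Rightarrow>
    ((nat \<Rightarrow> complex) \<times> (complex ^ 't1) \<times> (complex ^ 't2)) measure" where
  "input_with_aux \<phi> = distr (F \<Otimes>\<^sub>M gauss_measure) (aux_space CARD('r2) \<Otimes>\<^sub>M (borel \<Otimes>\<^sub>M borel))
     (\<lambda>q. (\<phi> (G21 *v fst (fst q) + snd q), fst q))"

lemma input_with_aux_admissible:
  assumes [measurable]: "\<phi> \<in> borel \<rightarrow>\<^sub>M aux_space CARD('r2)"
  shows "prob_space (input_with_aux \<phi>)"
    and "sets (input_with_aux \<phi>) = sets (aux_space CARD('r2) \<Otimes>\<^sub>M (borel \<Otimes>\<^sub>M borel))"
    and "power_constraint (input_with_aux \<phi>) (\<lambda>(u, x1, x2). x1) P"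
    and "power_constraint (input_with_aux \<phi>) (\<lambda>(u, x1, x2). x2) P"
proof -
  let ?G = "gauss_measure :: (complex ^ 'r2) measure"
  let ?A = "aux_space CARD('r2) \<Otimes>\<^sub>M (borel \<Otimes>\<^sub>M borel)"
  interpret G: prob_space ?G by (rule prob_space_gauss)
  interpret F\<gamma>: prob_space "F \<Otimes>\<^sub>M ?G" by (rule prob_F\<gamma>)
  show "prob_space (input_with_aux \<phi>)"
    unfolding input_with_aux_def by (rule F\<gamma>.prob_space_distr) measurable
  show "sets (input_with_aux \<phi>) = sets ?A" by (simp add: input_with_aux_def)
  have transfer: "(\<integral>\<^sup>+w. k (snd w) \<partial>input_with_aux \<phi>) = (\<integral>\<^sup>+x. k x \<partial>F)"
    if [measurable]: "k \<in> borel_measurable (borel \<Otimes>\<^sub>M borel)" for k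
  proof -
    have "(\<integral>\<^sup>+w. k (snd w) \<partial>input_with_aux \<phi>) = (\<integral>\<^sup>+q. k (fst q) \<partial>(F \<Otimes>\<^sub>M ?G))"
      unfolding input_with_aux_def by (subst nn_integral_distr) auto
    also have "\<dots> = (\<integral>\<^sup>+x. k x \<partial>distr (F \<Otimes>\<^sub>M ?G) F fst)"
      by (rule nn_integral_distr[symmetric]) measurable
    finally show ?thesis by (simp add: G.distr_pair_fst)
  qed
  show "power_constraint (input_with_aux \<phi>) (\<lambda>(u, x1, x2). x1) P"
    "power_constraint (input_with_aux \<phi>) (\<lambda>(u, x1, x2). x2) P"
    using power transfer[of "\<lambda>x. ennreal ((norm (fst x))\<^sup>2)"] transfer[of "\<lambda>x. ennreal ((norm (snd x))\<^sup>2)"]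
    by (simp_all add: power_constraint_def split_beta')
qed

text \<open>The fresh noise is absorbed into the input law, while the channel noises
  \<open>snd \<omega>\<close> are untouched; so \<open>\<Omega>\<close> carries this relay space as
  well.\<close>

lemma relay_space_input_with_aux:
  assumes [measurable]: "\<phi> \<in> borel \<rightarrow>\<^sub>M aux_space CARD('r2)"
  shows "relay_space (input_with_aux \<phi>)
    = distr \<Omega> ((aux_space CARD('r2) \<Otimes>\<^sub>M (borel \<Otimes>\<^sub>M borel)) \<Otimes>\<^sub>M (gauss_measure \<Otimes>\<^sub>M gauss_measure))
      (\<lambda>\<omega>. ((\<phi> (V \<omega>), fst (fst \<omega>)), snd \<omega>))"
proof -
  let ?N = "gauss_measure \<Otimes>\<^sub>M gauss_measure :: ((complex ^ 'r2) \<times> (complex ^ 'r3)) measure"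
  interpret N: prob_space ?N by (rule prob_space_pair[OF prob_space_gauss prob_space_gauss])
  have "relay_space (input_with_aux \<phi>) = input_with_aux \<phi> \<Otimes>\<^sub>M distr ?N ?N (\<lambda>x. x)"
    unfolding relay_space_def std_cgaussian_eq by (simp add: distr_id2)
  also have "\<dots> = distr \<Omega> ((aux_space CARD('r2) \<Otimes>\<^sub>M (borel \<Otimes>\<^sub>M borel)) \<Otimes>\<^sub>M ?N)
      (\<lambda>(q, n). ((\<phi> (G21 *v fst (fst q) + snd q), fst q), n))"
    unfolding \<Omega>_def input_with_aux_def
    by (rule pair_measure_distr) (auto simp: distr_id2 intro: N.sigma_finite_measure_axioms)
  finally show ?thesis by (simp add: split_beta' V_def X1_def Z2'_def)
qed

lemma cutset_rate_eq:
  "cutset_rate G21 G31 G32 F = min (mutual_information 2 (borel \<Otimes>\<^sub>M borel) borel (\<lambda>\<omega>. (X1 \<omega>, X2 \<omega>)) Y3)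
    (mutual_information 2 (borel \<Otimes>\<^sub>M borel) (borel \<Otimes>\<^sub>M borel) (\<lambda>\<omega>. (Y2 \<omega>, Y3 \<omega>)) (\<lambda>\<omega>. (X1 \<omega>, X2 \<omega>))
     - mutual_information 2 (borel \<Otimes>\<^sub>M borel) borel (\<lambda>\<omega>. (Y2 \<omega>, Y3 \<omega>)) X2)"
proof -
  let ?N = "F \<Otimes>\<^sub>M (gauss_measure \<Otimes>\<^sub>M gauss_measure) :: (((complex ^ 't1) \<times> (complex ^ 't2)) \<times> (complex ^ 'r2) \<times> (complex ^ 'r3)) measure"
  have \<pi>: "(\<lambda>\<omega>. (fst (fst \<omega>), snd \<omega>)) \<in> \<Omega> \<rightarrow>\<^sub>M ?N" unfolding \<Omega>_def by measurable
  interpret R: prob_space "relay_space F :: (((complex ^ 't1) \<times> (complex ^ 't2)) \<times> (complex ^ 'r2) \<times> (complex ^ 'r3)) measure" unfolding relay_space_F by (rule prob_space_distr) (rule \<pi>)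
  have tr: "R.mutual_information b S T X Y
    = mutual_information b S T (\<lambda>\<omega>. X (fst (fst \<omega>), snd \<omega>)) (\<lambda>\<omega>. Y (fst (fst \<omega>), snd \<omega>))"
    if "X \<in> ?N \<rightarrow>\<^sub>M S" "Y \<in> ?N \<rightarrow>\<^sub>M T" for b S T X Y
    unfolding relay_space_F by (rule mutual_information_distr_transfer[OF prob_space_axioms \<pi> that])
  show ?thesis
    unfolding cutset_rate_def Let_def R.conditional_mutual_information_def
    by (intro arg_cong2[where f=min] arg_cong2[where f="(-)"]; rule trans[OF tr], measurable)
      (simp_all add: split_beta' rv_defs[abs_def])
qed

text \<open>The first argument of \<open>min\<close> agrees with that in
  \<open>cutset_rate_eq\<close>, as it involves only the inputs and \<open>Y3\<close>. Comparing the
  rates thus means comparing the second arguments.\<close>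

lemma pdf_rate_eq:
  assumes [measurable]: "\<phi> \<in> borel \<rightarrow>\<^sub>M aux_space CARD('r2)"
  shows "pdf_rate G21 G31 G32 CARD('r2) (input_with_aux \<phi>)
    = min (mutual_information 2 (borel \<Otimes>\<^sub>M borel) borel (\<lambda>\<omega>. (X1 \<omega>, X2 \<omega>)) Y3)
    ((mutual_information 2 borel (aux_space CARD('r2) \<Otimes>\<^sub>M borel) Y2 (\<lambda>\<omega>. (\<phi> (V \<omega>), X2 \<omega>))
      - mutual_information 2 borel borel Y2 X2)
     + (mutual_information 2 borel (borel \<Otimes>\<^sub>M (borel \<Otimes>\<^sub>M aux_space CARD('r2))) Y3 (\<lambda>\<omega>. (X1 \<omega>, X2 \<omega>, \<phi> (V \<omega>)))
      - mutual_information 2 borel (borel \<Otimes>\<^sub>M aux_space CARD('r2)) Y3 (\<lambda>\<omega>. (X2 \<omega>, \<phi> (V \<omega>)))))"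
proof -
  let ?N = "(aux_space CARD('r2) \<Otimes>\<^sub>M (borel \<Otimes>\<^sub>M borel)) \<Otimes>\<^sub>M (gauss_measure \<Otimes>\<^sub>M gauss_measure)
    :: (((nat \<Rightarrow> complex) \<times> (complex ^ 't1) \<times> (complex ^ 't2)) \<times> (complex ^ 'r2) \<times> (complex ^ 'r3)) measure"
  have \<pi>: "(\<lambda>\<omega>. ((\<phi> (V \<omega>), fst (fst \<omega>)), snd \<omega>)) \<in> \<Omega> \<rightarrow>\<^sub>M ?N" by measurable
  interpret R: prob_space "relay_space (input_with_aux \<phi>)
    :: (((nat \<Rightarrow> complex) \<times> (complex ^ 't1) \<times> (complex ^ 't2)) \<times> (complex ^ 'r2) \<times> (complex ^ 'r3)) measure"
    unfolding relay_space_input_with_aux[OF assms] by (rule prob_space_distr) (rule \<pi>)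
  have tr: "R.mutual_information b S T X Y
    = mutual_information b S T (\<lambda>\<omega>. X ((\<phi> (V \<omega>), fst (fst \<omega>)), snd \<omega>)) (\<lambda>\<omega>. Y ((\<phi> (V \<omega>), fst (fst \<omega>)), snd \<omega>))"
    if "X \<in> ?N \<rightarrow>\<^sub>M S" "Y \<in> ?N \<rightarrow>\<^sub>M T" for b S T X Y
    unfolding relay_space_input_with_aux[OF assms]
    by (rule mutual_information_distr_transfer[OF prob_space_axioms \<pi> that])
  show ?thesis
    unfolding pdf_rate_def Let_def R.conditional_mutual_information_def
    by (intro arg_cong2[where f=min] arg_cong2[where f="(-)"] arg_cong2[where f="(+)"]; rule trans[OF tr], measurable)
      (simp_all add: split_beta' rv_defs[abs_def])
qed

end

section \<open>Comparison of the two rates for one input law\<close>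

context cutset_input
begin

text \<open>The second cutset term is \<open>h(Y2|X2) + h(Y3|X2,Y2) - h(Z2) - h(Z3)\<close>, the
  competing sum is \<open>h(Y2|X2) - h(Y2|V,X2) + h(Y3|X2,V) - h(Z3)\<close>. After
  \<open>law_swap\<close> all but two entropies cancel, and the remaining difference is at most half
  a bit per real dimension of \<open>'v\<close>.\<close>

lemma rate_gap:
  fixes L :: "'v::euclidean_space \<Rightarrow> complex ^ 'r2"
  assumes L: "linear L" and iso: "\<And>x. norm (L x) = norm x" and range: "range ((*v) G21) \<subseteq> range L"
  shows "\<exists>F'. prob_space F' \<and> sets F' = sets (aux_space CARD('r2) \<Otimes>\<^sub>M (borel \<Otimes>\<^sub>M borel)) \<and>
    power_constraint F' (\<lambda>(u, x1, x2). x1) P \<and> power_constraint F' (\<lambda>(u, x1, x2). x2) P \<and>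
    cutset_rate G21 G31 G32 F \<le> pdf_rate G21 G31 G32 CARD('r2) F' + real DIM('v) / 2"
proof -
  obtain \<phi> :: "complex ^ 'r2 \<Rightarrow> nat \<Rightarrow> complex" and \<psi>
    where \<phi> [measurable]: "\<phi> \<in> borel \<rightarrow>\<^sub>M aux_space CARD('r2)"
      and \<psi> [measurable]: "\<psi> \<in> aux_space CARD('r2) \<rightarrow>\<^sub>M borel" and \<psi>\<phi>: "\<And>v. \<psi> (\<phi> v) = v"
    by (rule aux_space_coordinates) blast
  let ?aux = "aux_space CARD('r2)"
  let ?G = "gauss_measure :: (complex ^ 'r2) measure" and ?G3 = "gauss_measure :: (complex ^ 'r3) measure"

  have h2: "(\<lambda>w. G21 *v fst (fst (fst w))) \<in> borel_measurable ((F \<Otimes>\<^sub>M ?G) \<Otimes>\<^sub>M ?G3)" by measurable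
  have h3: "(\<lambda>w. G31 *v fst (fst (fst w)) + G32 *v snd (fst (fst w))) \<in> borel_measurable ((F \<Otimes>\<^sub>M ?G) \<Otimes>\<^sub>M ?G)"
    by measurable
  have h23: "(\<lambda>q. (G21 *v fst (fst q), G31 *v fst (fst q) + G32 *v snd (fst q))) \<in> borel_measurable (F \<Otimes>\<^sub>M ?G)"
    unfolding borel_prod[symmetric] by measurable
  have eqs: "(\<lambda>\<omega>. G21 *v fst (fst (fst (fst \<omega>, snd (snd \<omega>)))) + Z2 \<omega>) = Y2"
    "(\<lambda>\<omega>. G31 *v fst (fst (fst (fst \<omega>, fst (snd \<omega>)))) + G32 *v snd (fst (fst (fst \<omega>, fst (snd \<omega>)))) + Z3 \<omega>) = Y3"
    "(\<lambda>\<omega>. (G21 *v fst (fst (fst \<omega>)), G31 *v fst (fst (fst \<omega>)) + G32 *v snd (fst (fst \<omega>))) + (Z2 \<omega>, Z3 \<omega>)) = (\<lambda>\<omega>. (Y2 \<omega>, Y3 \<omega>))"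
    by (simp_all add: fun_eq_iff rv_defs)
  \<comment> \<open>The unconditional densities cancel within each conditional information, but
    their logarithms must be integrable before that information can be written as a difference of
    entropies.\<close>
  obtain g2 where g2: "\<And>x. 0 \<le> g2 x" "\<And>x. g2 x \<le> 1" and Dg2: "distributed \<Omega> lborel Y2 (\<lambda>x. ennreal (g2 x))"
    by (rule additive_noise_density[OF noise2 h2, unfolded eqs]) (rule that)
  obtain g3 where g3: "\<And>x. 0 \<le> g3 x" "\<And>x. g3 x \<le> 1" and Dg3: "distributed \<Omega> lborel Y3 (\<lambda>x. ennreal (g3 x))"
    by (rule additive_noise_density[OF noise3 h3, unfolded eqs]) (rule that)
  obtain g23 where g23: "\<And>x. 0 \<le> g23 x" "\<And>x. g23 x \<le> 1"
    and Dg23: "distributed \<Omega> lborel (\<lambda>\<omega>. (Y2 \<omega>, Y3 \<omega>)) (\<lambda>x. ennreal (g23 x))"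
    by (rule additive_noise_density[OF noise23 h23, unfolded eqs]) (rule that)
  note g2i = density_ln(1)[OF Dg2 g2 outputs_square_integrable(1)]
    and g3i = density_ln(1)[OF Dg3 g3 outputs_square_integrable(2)]
    and g23i = density_ln(1)[OF Dg23 g23 outputs_square_integrable(3)]

  have b1: "(\<lambda>w. snd (fst (fst w))) \<in> ((F \<Otimes>\<^sub>M ?G) \<Otimes>\<^sub>M ?G3) \<rightarrow>\<^sub>M borel" by measurable
  have b2: "(\<lambda>w. (snd (fst (fst w)), \<phi> (G21 *v fst (fst (fst w)) + snd (fst w)))) \<in> ((F \<Otimes>\<^sub>M ?G) \<Otimes>\<^sub>M ?G) \<rightarrow>\<^sub>M borel \<Otimes>\<^sub>M ?aux"
    by measurable
  have b3: "(\<lambda>w. (\<phi> (G21 *v fst (fst (fst w)) + snd (fst w)), snd (fst (fst w)))) \<in> ((F \<Otimes>\<^sub>M ?G) \<Otimes>\<^sub>M ?G3) \<rightarrow>\<^sub>M ?aux \<Otimes>\<^sub>M borel"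
    by measurable
  have ceqs:
    "(\<lambda>\<omega>. snd (fst (fst (fst \<omega>, snd (snd \<omega>))))) = X2"
    "(\<lambda>\<omega>. (G21 *v fst (fst (fst (fst \<omega>, snd (snd \<omega>)))) + Z2 \<omega>, snd (fst (fst (fst \<omega>, snd (snd \<omega>)))))) = (\<lambda>\<omega>. (Y2 \<omega>, X2 \<omega>))"
    "(\<lambda>\<omega>. (snd (fst (fst (fst \<omega>, fst (snd \<omega>)))), \<phi> (G21 *v fst (fst (fst (fst \<omega>, fst (snd \<omega>)))) + snd (fst (fst \<omega>, fst (snd \<omega>)))))) = (\<lambda>\<omega>. (X2 \<omega>, \<phi> (V \<omega>)))"
    "(\<lambda>\<omega>. (G31 *v fst (fst (fst (fst \<omega>, fst (snd \<omega>)))) + G32 *v snd (fst (fst (fst \<omega>, fst (snd \<omega>)))) + Z3 \<omega>,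
        snd (fst (fst (fst \<omega>, fst (snd \<omega>)))), \<phi> (G21 *v fst (fst (fst (fst \<omega>, fst (snd \<omega>)))) + snd (fst (fst \<omega>, fst (snd \<omega>)))))) = (\<lambda>\<omega>. (Y3 \<omega>, X2 \<omega>, \<phi> (V \<omega>)))"
    "(\<lambda>\<omega>. (\<phi> (G21 *v fst (fst (fst (fst \<omega>, snd (snd \<omega>)))) + snd (fst (fst \<omega>, snd (snd \<omega>)))), snd (fst (fst (fst \<omega>, snd (snd \<omega>)))))) = (\<lambda>\<omega>. (\<phi> (V \<omega>), X2 \<omega>))"
    "(\<lambda>\<omega>. (G21 *v fst (fst (fst (fst \<omega>, snd (snd \<omega>)))) + Z2 \<omega>,
        \<phi> (G21 *v fst (fst (fst (fst \<omega>, snd (snd \<omega>)))) + snd (fst (fst \<omega>, snd (snd \<omega>)))), snd (fst (fst (fst \<omega>, snd (snd \<omega>)))))) = (\<lambda>\<omega>. (Y2 \<omega>, \<phi> (V \<omega>), X2 \<omega>))"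
    by (simp_all add: fun_eq_iff rv_defs)
  \<comment> \<open>\<open>f1\<close> and \<open>f2\<close> will cancel between the two rates;
    \<open>f3\<close>, the density of \<open>Y2\<close> given the auxiliary variable and
    \<open>X2\<close>, carries the loss.\<close>
  obtain f1 where f1: "\<And>x. 0 \<le> f1 x" "\<And>x. f1 x \<le> 1"
    and Df1: "distributed \<Omega> (lborel \<Otimes>\<^sub>M distr \<Omega> borel X2) (\<lambda>\<omega>. (Y2 \<omega>, X2 \<omega>)) (\<lambda>x. ennreal (f1 x))"
    by (rule additive_noise_conditional_density[OF noise2 h2 b1, unfolded ceqs]) (rule that)
  obtain f2 where f2: "\<And>x. 0 \<le> f2 x" "\<And>x. f2 x \<le> 1"
    and Df2: "distributed \<Omega> (lborel \<Otimes>\<^sub>M distr \<Omega> (borel \<Otimes>\<^sub>M ?aux) (\<lambda>\<omega>. (X2 \<omega>, \<phi> (V \<omega>))))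
      (\<lambda>\<omega>. (Y3 \<omega>, X2 \<omega>, \<phi> (V \<omega>))) (\<lambda>x. ennreal (f2 x))"
    by (rule additive_noise_conditional_density[OF noise3 h3 b2, unfolded ceqs]) (rule that)
  obtain f3 where f3: "\<And>x. 0 \<le> f3 x" "\<And>x. f3 x \<le> 1"
    and Df3: "distributed \<Omega> (lborel \<Otimes>\<^sub>M distr \<Omega> (?aux \<Otimes>\<^sub>M borel) (\<lambda>\<omega>. (\<phi> (V \<omega>), X2 \<omega>)))
      (\<lambda>\<omega>. (Y2 \<omega>, \<phi> (V \<omega>), X2 \<omega>)) (\<lambda>x. ennreal (f3 x))"
    by (rule additive_noise_conditional_density[OF noise2 h2 b3, unfolded ceqs]) (rule that)
  have B1: "X2 \<in> \<Omega> \<rightarrow>\<^sub>M borel" and B2: "(\<lambda>\<omega>. (X2 \<omega>, \<phi> (V \<omega>))) \<in> \<Omega> \<rightarrow>\<^sub>M borel \<Otimes>\<^sub>M ?aux"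
    and B2': "(\<lambda>\<omega>. (X2 \<omega>, \<phi> (Y2 \<omega>))) \<in> \<Omega> \<rightarrow>\<^sub>M borel \<Otimes>\<^sub>M ?aux"
    and B3: "(\<lambda>\<omega>. (\<phi> (V \<omega>), X2 \<omega>)) \<in> \<Omega> \<rightarrow>\<^sub>M ?aux \<Otimes>\<^sub>M borel"
    by measurable
  have f1i: "integrable \<Omega> (\<lambda>\<omega>. ln (f1 (Y2 \<omega>, X2 \<omega>)))"
    by (rule conditional_density_ln_integrable[OF Df1 B1 f1 outputs_square_integrable(1)])
  have f2i: "integrable \<Omega> (\<lambda>\<omega>. ln (f2 (Y3 \<omega>, X2 \<omega>, \<phi> (V \<omega>))))"
    by (rule conditional_density_ln_integrable[OF Df2 B2 f2 outputs_square_integrable(2)])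
  have f3i: "integrable \<Omega> (\<lambda>\<omega>. ln (f3 (Y2 \<omega>, \<phi> (V \<omega>), X2 \<omega>)))"
    by (rule conditional_density_ln_integrable[OF Df3 B3 f3 outputs_square_integrable(1)])

  \<comment> \<open>Exchanging the two copies of the relay noise turns \<open>V\<close> into \<open>Y2\<close>.\<close>
  note swap = law_swap[OF \<phi>]
  have swap2: "distr \<Omega> (borel \<Otimes>\<^sub>M ?aux) (\<lambda>\<omega>. (X2 \<omega>, \<phi> (V \<omega>))) = distr \<Omega> (borel \<Otimes>\<^sub>M ?aux) (\<lambda>\<omega>. (X2 \<omega>, \<phi> (Y2 \<omega>)))"
    using arg_cong[OF swap, of "\<lambda>N. distr N (borel \<Otimes>\<^sub>M ?aux) snd"]
    by (simp add: distr_distr comp_def)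
  let ?N2 = "lborel \<Otimes>\<^sub>M distr \<Omega> (borel \<Otimes>\<^sub>M ?aux) (\<lambda>\<omega>. (X2 \<omega>, \<phi> (Y2 \<omega>))) :: ((complex ^ 'r3) \<times> (complex ^ 't2) \<times> (nat \<Rightarrow> complex)) measure"
  have sets_N2: "sets ?N2 = sets (borel \<Otimes>\<^sub>M (borel \<Otimes>\<^sub>M ?aux))" by (rule sets_pair_measure_cong) simp_all
  have "distr \<Omega> ?N2 (\<lambda>\<omega>. (Y3 \<omega>, X2 \<omega>, \<phi> (V \<omega>))) = distr \<Omega> ?N2 (\<lambda>\<omega>. (Y3 \<omega>, X2 \<omega>, \<phi> (Y2 \<omega>)))"
    using swap by (simp add: distr_cong[OF refl sets_N2 refl])
  moreover have "(\<lambda>\<omega>. (Y3 \<omega>, X2 \<omega>, \<phi> (Y2 \<omega>))) \<in> \<Omega> \<rightarrow>\<^sub>M ?N2" by measurable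
  \<comment> \<open>Having the one density \<open>f2\<close> for both conditionings is what makes
    the terms in \<open>Y3\<close> cancel.\<close>
  ultimately have Df2': "distributed \<Omega> ?N2 (\<lambda>\<omega>. (Y3 \<omega>, X2 \<omega>, \<phi> (Y2 \<omega>))) (\<lambda>x. ennreal (f2 x))"
    using Df2 unfolding swap2 distributed_def by simp
  have f2i': "integrable \<Omega> (\<lambda>\<omega>. ln (f2 (Y3 \<omega>, X2 \<omega>, \<phi> (Y2 \<omega>))))"
    by (rule conditional_density_ln_integrable[OF Df2' B2' f2 outputs_square_integrable(2)])
  have "f2 \<in> borel_measurable ?N2" using f2(1) Df2' by (intro distributed_real_measurable)
  then have [measurable]: "f2 \<in> borel_measurable (borel \<Otimes>\<^sub>M (borel \<Otimes>\<^sub>M ?aux))"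
    using sets_N2 by (simp cong: measurable_cong_sets)
  have f2_swap: "(\<integral>\<omega>. ln (f2 (Y3 \<omega>, X2 \<omega>, \<phi> (V \<omega>))) \<partial>\<Omega>) = (\<integral>\<omega>. ln (f2 (Y3 \<omega>, X2 \<omega>, \<phi> (Y2 \<omega>))) \<partial>\<Omega>)"
    using arg_cong[OF swap, of "\<lambda>N. integral\<^sup>L N (\<lambda>x. ln (f2 x))"] by (simp add: integral_distr)

  \<comment> \<open>By the chain rule this is a density of \<open>(Y2, Y3)\<close> given
    \<open>X2\<close>. Building it from \<open>f1\<close> and \<open>f2\<close>, rather than by
    domination, is what splits its entropy.\<close>
  define f12 where "f12 x = f1 (fst (fst x), snd x) * f2 (snd (fst x), snd x, \<phi> (fst (fst x)))" for x
  have Df12: "distributed \<Omega> (lborel \<Otimes>\<^sub>M distr \<Omega> borel X2) (\<lambda>\<omega>. ((Y2 \<omega>, Y3 \<omega>), X2 \<omega>)) (\<lambda>x. ennreal (f12 x))"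
    unfolding f12_def by (rule conditional_density_chain[where A=Y2 and A'=Y3 and X=X2 and \<phi>=\<phi> and \<psi>=\<psi>, OF Df1 Df2' _ _ _ \<phi> \<psi> \<psi>\<phi> f1(1) f2(1)]) measurable
  have f12_0: "0 \<le> f12 x" for x by (simp add: f12_def f1 f2)
  have f12_1: "f12 x \<le> 1" for x by (simp add: f12_def f1 f2 mult_le_one)
  have f12i: "integrable \<Omega> (\<lambda>\<omega>. ln (f12 ((Y2 \<omega>, Y3 \<omega>), X2 \<omega>)))"
    by (rule conditional_density_ln_integrable[OF Df12 B1 f12_0 f12_1 outputs_square_integrable(3)])
  have f12_ln: "(\<integral>\<omega>. ln (f12 ((Y2 \<omega>, Y3 \<omega>), X2 \<omega>)) \<partial>\<Omega>)
      = (\<integral>\<omega>. ln (f1 (Y2 \<omega>, X2 \<omega>)) \<partial>\<Omega>) + (\<integral>\<omega>. ln (f2 (Y3 \<omega>, X2 \<omega>, \<phi> (V \<omega>))) \<partial>\<Omega>)"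
  proof -
    have "(\<integral>\<omega>. ln (f12 ((Y2 \<omega>, Y3 \<omega>), X2 \<omega>)) \<partial>\<Omega>)
        = (\<integral>\<omega>. ln (f1 (Y2 \<omega>, X2 \<omega>)) + ln (f2 (Y3 \<omega>, X2 \<omega>, \<phi> (Y2 \<omega>))) \<partial>\<Omega>)"
    proof (rule integral_cong_AE)
      show "AE \<omega> in \<Omega>. ln (f12 ((Y2 \<omega>, Y3 \<omega>), X2 \<omega>)) = ln (f1 (Y2 \<omega>, X2 \<omega>)) + ln (f2 (Y3 \<omega>, X2 \<omega>, \<phi> (Y2 \<omega>)))"
        using distributed_density_pos[OF Df1] distributed_density_pos[OF Df2']
        by eventually_elim (simp add: f12_def ln_mult)
    qed (use f12i f1i f2i' in auto)
    then show ?thesis using f1i f2i' by (simp add: f2_swap)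
  qed

  \<comment> \<open>The range inclusion lets the signal pass through \<open>L\<close>.
    \<open>K\<close> is chosen pointwise and enters only through identities at each sample point, so
    it may fail to be measurable.\<close>
  have "\<exists>k. G21 *v x = L k" for x using range by (blast dest: subsetD[OF _ rangeI])
  then obtain K where K: "\<And>x. G21 *v x = L (K x)" by metis
  have gap: "(\<integral>\<omega>. ln (gauss (Z2 \<omega>)) \<partial>\<Omega>) - real DIM('v) / 2 * ln 2 \<le> (\<integral>\<omega>. ln (f3 (Y2 \<omega>, \<phi> (V \<omega>), X2 \<omega>)) \<partial>\<Omega>)"
    by (rule conditional_density_ln_predictive[OF Df3 B3 f3 _ L iso, where \<psi>="\<lambda>b. \<psi> (fst b)" and K="\<lambda>\<omega>. K (X1 \<omega>)" and Z'=Z2'])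
      (auto simp: Y2_def V_def \<psi>\<phi> K noise22')

  have z23: "(\<integral>\<omega>. ln (gauss (Z2 \<omega>, Z3 \<omega>)) \<partial>\<Omega>) = (\<integral>\<omega>. ln (gauss (Z2 \<omega>)) \<partial>\<Omega>) + (\<integral>\<omega>. ln (gauss (Z3 \<omega>)) \<partial>\<Omega>)"
    using integrable_ln_gauss[OF gaussian_noise_square_integrable[OF noise2]]
      integrable_ln_gauss[OF gaussian_noise_square_integrable[OF noise3]]
    by (simp add: gauss_Pair ln_mult less_imp_neq[OF gauss_pos, symmetric])

  have I23_X1X2: "mutual_information 2 (borel \<Otimes>\<^sub>M borel) (borel \<Otimes>\<^sub>M borel) (\<lambda>\<omega>. (Y2 \<omega>, Y3 \<omega>)) (\<lambda>\<omega>. (X1 \<omega>, X2 \<omega>))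
     = ((\<integral>\<omega>. ln (gauss (Z2 \<omega>, Z3 \<omega>)) \<partial>\<Omega>) - (\<integral>\<omega>. ln (g23 (Y2 \<omega>, Y3 \<omega>)) \<partial>\<Omega>)) / ln 2"
    unfolding borel_prod
    by (rule mutual_information_gaussian_channel(1)[OF noise23 _ _ _ _ Dg23 g23 outputs_square_integrable(3),
          where b=fst and h="\<lambda>x. (G21 *v fst x, G31 *v fst x + G32 *v snd x)"])
      (simp_all add: rv_defs borel_prod[symmetric] prod_eq_iff)
  have I23_X2: "mutual_information 2 (borel \<Otimes>\<^sub>M borel) borel (\<lambda>\<omega>. (Y2 \<omega>, Y3 \<omega>)) X2
     = ((\<integral>\<omega>. ln (f12 ((Y2 \<omega>, Y3 \<omega>), X2 \<omega>)) \<partial>\<Omega>) - (\<integral>\<omega>. ln (g23 (Y2 \<omega>, Y3 \<omega>)) \<partial>\<Omega>)) / ln 2"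
    unfolding borel_prod
    by (rule mutual_information_densities(1)[OF sigma_finite_lborel sets_lborel[symmetric] B1 Df12 Dg23 f12_0 g23(1) f12i g23i])
  have I2_UX2: "mutual_information 2 borel (?aux \<Otimes>\<^sub>M borel) Y2 (\<lambda>\<omega>. (\<phi> (V \<omega>), X2 \<omega>))
     = ((\<integral>\<omega>. ln (f3 (Y2 \<omega>, \<phi> (V \<omega>), X2 \<omega>)) \<partial>\<Omega>) - (\<integral>\<omega>. ln (g2 (Y2 \<omega>)) \<partial>\<Omega>)) / ln 2"
    by (rule mutual_information_densities(1)[OF sigma_finite_lborel sets_lborel[symmetric] B3 Df3 Dg2 f3(1) g2(1) f3i g2i])
  have I2_X2: "mutual_information 2 borel borel Y2 X2
     = ((\<integral>\<omega>. ln (f1 (Y2 \<omega>, X2 \<omega>)) \<partial>\<Omega>) - (\<integral>\<omega>. ln (g2 (Y2 \<omega>)) \<partial>\<Omega>)) / ln 2"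
    by (rule mutual_information_densities(1)[OF sigma_finite_lborel sets_lborel[symmetric] B1 Df1 Dg2 f1(1) g2(1) f1i g2i])
  have I3_X2U: "mutual_information 2 borel (borel \<Otimes>\<^sub>M ?aux) Y3 (\<lambda>\<omega>. (X2 \<omega>, \<phi> (V \<omega>)))
     = ((\<integral>\<omega>. ln (f2 (Y3 \<omega>, X2 \<omega>, \<phi> (V \<omega>))) \<partial>\<Omega>) - (\<integral>\<omega>. ln (g3 (Y3 \<omega>)) \<partial>\<Omega>)) / ln 2"
    by (rule mutual_information_densities(1)[OF sigma_finite_lborel sets_lborel[symmetric] B2 Df2 Dg3 f2(1) g3(1) f2i g3i])
  have I3_X1X2U: "mutual_information 2 borel (borel \<Otimes>\<^sub>M (borel \<Otimes>\<^sub>M ?aux)) Y3 (\<lambda>\<omega>. (X1 \<omega>, X2 \<omega>, \<phi> (V \<omega>)))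
     = ((\<integral>\<omega>. ln (gauss (Z3 \<omega>)) \<partial>\<Omega>) - (\<integral>\<omega>. ln (g3 (Y3 \<omega>)) \<partial>\<Omega>)) / ln 2"
    by (rule mutual_information_gaussian_channel(1)[OF noise3 _ _ _ _ Dg3 g3 outputs_square_integrable(2),
          where b="\<lambda>w. (fst (fst (fst w)), snd (fst (fst w)), \<phi> (G21 *v fst (fst (fst w)) + snd (fst w)))"
            and h="\<lambda>x. G31 *v fst x + G32 *v fst (snd x)"])
      (simp_all add: rv_defs)

  have "cutset_rate G21 G31 G32 F \<le> pdf_rate G21 G31 G32 CARD('r2) (input_with_aux \<phi>) + real DIM('v) / 2"
  proof -
    \<comment> \<open>The first arguments of both minima agree, so a nonnegative gap
      \<open>k\<close> between the second ones bounds the gap between the minima.\<close>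
    have "a - b \<le> (c - d + (e - f)) + k \<Longrightarrow> 0 \<le> k \<Longrightarrow> min m (a - b) \<le> min m (c - d + (e - f)) + k"
      for a b c d e f k m :: real by linarith
    \<comment> \<open>Everything cancels except \<open>z2\<close> and \<open>x3\<close>, the mean
      logarithms of the noise density at \<open>Z2\<close> and of \<open>f3\<close>. Division by
      \<open>ln 2\<close> turns nats into bits.\<close>
    moreover have "(z2 + z3 - x23) / ln 2 - (x1 + x2 - x23) / ln 2
        \<le> ((x3 - y2) / ln 2 - (x1 - y2) / ln 2 + ((z3 - y3) / ln 2 - (x2 - y3) / ln 2)) + k"
      if "z2 - k * ln 2 \<le> x3" for z2 z3 x23 x1 x2 x3 y2 y3 k :: real
    proof -
      have "z2 / ln 2 \<le> x3 / ln 2 + k" using that by (simp add: field_simps)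
      then show ?thesis unfolding diff_divide_distrib add_divide_distrib by linarith
    qed
    ultimately show ?thesis
      unfolding cutset_rate_eq pdf_rate_eq[OF \<phi>] I23_X1X2 I23_X2 I2_UX2 I2_X2 I3_X2U I3_X1X2U z23 f12_ln
      using gap by simp
  qed
  then show ?thesis using input_with_aux_admissible[OF \<phi>] by blast
qed

end

subsection \<open>Finiteness of the bounds and conclusion\<close>

text \<open>The information is output entropy minus noise entropy, and the former is at most a
  Gaussian cross entropy, which depends on the second moment only. The bound is crude but uniform
  over all inputs of power \<open>P\<close>, as finiteness of \<open>R_PDF\<close> demands.\<close>

lemma mutual_information_relay_le:
  fixes G31 :: "complex ^ 't1::finite ^ 'r3::finite" and G32 :: "complex ^ 't2::finite ^ 'r3"
  assumes F: "prob_space F" and X1 [measurable]: "X1 \<in> borel_measurable F" and X2 [measurable]: "X2 \<in> borel_measurable F"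
    and P1: "power_constraint F X1 P" and P2: "power_constraint F X2 P" and P: "0 \<le> P"
    and K1: "\<And>x. norm (G31 *v x) \<le> K1 * norm x" and K2: "\<And>x. norm (G32 *v x) \<le> K2 * norm x"
  shows "prob_space.mutual_information (relay_space F :: ('a \<times> (complex ^ 'r2::finite) \<times> (complex ^ 'r3)) measure) 2
      (borel \<Otimes>\<^sub>M borel) borel (\<lambda>\<omega>. (X1 (fst \<omega>), X2 (fst \<omega>))) (\<lambda>\<omega>. G31 *v X1 (fst \<omega>) + G32 *v X2 (fst \<omega>) + snd (snd \<omega>))
    \<le> (4 * K1\<^sup>2 * P + 4 * K2\<^sup>2 * P + 2 * (\<integral>z. (norm z)\<^sup>2 \<partial>(gauss_measure :: (complex ^ 'r3) measure))) / ln 2"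
proof -
  let ?G2 = "gauss_measure :: (complex ^ 'r2) measure" and ?G3 = "gauss_measure :: (complex ^ 'r3) measure"
  let ?M = "F \<Otimes>\<^sub>M (?G2 \<Otimes>\<^sub>M ?G3)"
  let ?Y = "\<lambda>\<omega>. G31 *v X1 (fst \<omega>) + G32 *v X2 (fst \<omega>) + snd (snd \<omega>)"
  interpret M: prob_space ?M
    by (rule prob_space_pair[OF F prob_space_pair[OF prob_space_gauss prob_space_gauss]])
  interpret N: prob_space "?G2 \<Otimes>\<^sub>M ?G3" by (rule prob_space_pair[OF prob_space_gauss prob_space_gauss])
  have noise: "gaussian_noise ?M (\<lambda>\<omega>. snd (snd \<omega>)) (F \<Otimes>\<^sub>M ?G2) (\<lambda>\<omega>. (fst \<omega>, fst (snd \<omega>)))"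
    by (rule gaussian_noise_factor(2)[OF F prob_space_gauss])
  have Zi: "integrable ?M (\<lambda>\<omega>. (norm (snd (snd \<omega>)))\<^sup>2)" by (rule M.gaussian_noise_square_integrable[OF noise])
  have Z: "(\<integral>\<omega>. (norm (snd (snd \<omega>)))\<^sup>2 \<partial>?M) = (\<integral>z. (norm z)\<^sup>2 \<partial>?G3)"
    by (subst M.gaussian_noise_distr[OF noise, symmetric], subst integral_distr) auto
  have input: "integrable ?M (\<lambda>\<omega>. (norm (X (fst \<omega>)))\<^sup>2)" "(\<integral>\<omega>. (norm (X (fst \<omega>)))\<^sup>2 \<partial>?M) \<le> P"
    if [measurable]: "X \<in> borel_measurable F" and p: "power_constraint F X P" for X :: "'a \<Rightarrow> complex ^ 't::finite"
  proof -
    have i: "integrable F (\<lambda>w. (norm (X w))\<^sup>2)"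
      using p by (auto intro!: integrableI_nonneg simp: power_constraint_def intro: le_less_trans)
    then have "integrable (distr ?M F fst) (\<lambda>w. (norm (X w))\<^sup>2)" by (simp add: N.distr_pair_fst)
    then show "integrable ?M (\<lambda>\<omega>. (norm (X (fst \<omega>)))\<^sup>2)" by (subst (asm) integrable_distr_eq) auto
    have "(\<integral>\<omega>. (norm (X (fst \<omega>)))\<^sup>2 \<partial>?M) = (\<integral>w. (norm (X w))\<^sup>2 \<partial>distr ?M F fst)"
      by (rule integral_distr[symmetric]) measurable
    also have "\<dots> = (\<integral>w. (norm (X w))\<^sup>2 \<partial>F)" by (simp add: N.distr_pair_fst)
    also have "\<dots> \<le> P"
      using p i P by (simp add: power_constraint_def nn_integral_eq_integral)
    finally show "(\<integral>\<omega>. (norm (X (fst \<omega>)))\<^sup>2 \<partial>?M) \<le> P" .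
  qed
  note in1 = input[OF X1 P1] and in2 = input[OF X2 P2]
  \<comment> \<open>The factors 4, 4 and 2 come from applying \<open>norm_add_square_le\<close>
    twice.\<close>
  have Y_le: "(norm (?Y \<omega>))\<^sup>2 \<le> 4 * K1\<^sup>2 * (norm (X1 (fst \<omega>)))\<^sup>2 + 4 * K2\<^sup>2 * (norm (X2 (fst \<omega>)))\<^sup>2
      + 2 * (norm (snd (snd \<omega>)))\<^sup>2" (is "_ \<le> ?b \<omega>") for \<omega>
  proof -
    have "(norm (G31 *v X1 (fst \<omega>)))\<^sup>2 \<le> K1\<^sup>2 * (norm (X1 (fst \<omega>)))\<^sup>2"
      "(norm (G32 *v X2 (fst \<omega>)))\<^sup>2 \<le> K2\<^sup>2 * (norm (X2 (fst \<omega>)))\<^sup>2"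
      using power_mono[OF K1, of _ 2] power_mono[OF K2, of _ 2] by (simp_all add: power_mult_distrib)
    then show ?thesis
      using norm_add_square_le[of "G31 *v X1 (fst \<omega>) + G32 *v X2 (fst \<omega>)" "snd (snd \<omega>)"]
        norm_add_square_le[of "G31 *v X1 (fst \<omega>)" "G32 *v X2 (fst \<omega>)"] by linarith
  qed
  have b_int: "integrable ?M ?b" using in1(1) in2(1) Zi by simp
  have Yi: "integrable ?M (\<lambda>\<omega>. (norm (?Y \<omega>))\<^sup>2)"
    by (rule Bochner_Integration.integrable_bound[OF b_int]) (use Y_le in \<open>auto intro: order_trans[OF _ abs_ge_self]\<close>)
  have "(\<integral>\<omega>. (norm (?Y \<omega>))\<^sup>2 \<partial>?M) \<le> (\<integral>\<omega>. ?b \<omega> \<partial>?M)"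
    by (rule integral_mono[OF Yi b_int Y_le])
  also have "\<dots> = 4 * K1\<^sup>2 * (\<integral>\<omega>. (norm (X1 (fst \<omega>)))\<^sup>2 \<partial>?M) + 4 * K2\<^sup>2 * (\<integral>\<omega>. (norm (X2 (fst \<omega>)))\<^sup>2 \<partial>?M)
      + 2 * (\<integral>z. (norm z)\<^sup>2 \<partial>?G3)"
    using in1(1) in2(1) Zi by (simp add: Z)
  also have "\<dots> \<le> 4 * K1\<^sup>2 * P + 4 * K2\<^sup>2 * P + 2 * (\<integral>z. (norm z)\<^sup>2 \<partial>?G3)"
    using in1(2) in2(2) by (intro add_mono mult_left_mono) auto
  finally have EY: "(\<integral>\<omega>. (norm (?Y \<omega>))\<^sup>2 \<partial>?M) \<le> 4 * K1\<^sup>2 * P + 4 * K2\<^sup>2 * P + 2 * (\<integral>z. (norm z)\<^sup>2 \<partial>?G3)" .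
  have h: "(\<lambda>w. G31 *v X1 (fst w) + G32 *v X2 (fst w)) \<in> borel_measurable (F \<Otimes>\<^sub>M ?G2)" by measurable
  obtain g where g: "\<And>x. 0 \<le> g x" "\<And>x. g x \<le> 1" and Dg: "distributed ?M lborel ?Y (\<lambda>x. ennreal (g x))"
    by (rule M.additive_noise_density[OF noise h, unfolded fst_conv]) (rule that)
  have "M.mutual_information 2 (borel \<Otimes>\<^sub>M borel) borel (\<lambda>\<omega>. (X1 (fst \<omega>), X2 (fst \<omega>))) ?Y
    = ((\<integral>\<omega>. ln (gauss (snd (snd \<omega>))) \<partial>?M) - (\<integral>\<omega>. ln (g (?Y \<omega>)) \<partial>?M)) / ln 2"
    by (rule M.mutual_information_gaussian_channel(2)[OF noise _ _ _ _ Dg g Yi,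
          where b="\<lambda>w. (X1 (fst w), X2 (fst w))" and h="\<lambda>x. G31 *v fst x + G32 *v snd x"])
      simp_all
  also have "\<dots> \<le> (\<integral>\<omega>. (norm (?Y \<omega>))\<^sup>2 \<partial>?M) / ln 2"
  proof (rule divide_right_mono)
    \<comment> \<open>Dropping the negative square leaves the normalising constant, which cancels
      against that of the Gaussian reference for the output.\<close>
    have "(\<integral>\<omega>. ln (gauss (snd (snd \<omega>))) \<partial>?M) \<le> (\<integral>\<omega>. - real DIM(complex ^ 'r3) * ln (sqrt pi) \<partial>?M)"
      by (rule integral_mono[OF M.integrable_ln_gauss[OF Zi]]) (simp_all add: ln_gauss)
    moreover have "(\<integral>\<omega>. ln (gauss (?Y \<omega>)) \<partial>?M) = - (\<integral>\<omega>. (norm (?Y \<omega>))\<^sup>2 \<partial>?M) - real DIM(complex ^ 'r3) * ln (sqrt pi)"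
      using Yi by (simp add: ln_gauss M.prob_space)
    ultimately show "(\<integral>\<omega>. ln (gauss (snd (snd \<omega>))) \<partial>?M) - (\<integral>\<omega>. ln (g (?Y \<omega>)) \<partial>?M) \<le> (\<integral>\<omega>. (norm (?Y \<omega>))\<^sup>2 \<partial>?M)"
      using M.density_ln(2)[OF Dg g Yi] by (simp add: M.prob_space)
  qed simp
  also have "\<dots> \<le> (4 * K1\<^sup>2 * P + 4 * K2\<^sup>2 * P + 2 * (\<integral>z. (norm z)\<^sup>2 \<partial>?G3)) / ln 2"
    by (rule divide_right_mono[OF EY]) simp
  finally show ?thesis unfolding relay_space_def std_cgaussian_eq .
qed

text \<open>From above, the first term of the minimum is bounded uniformly over the input laws. From
  below, one admissible law suffices, since each rate is a real number.\<close>

lemma R_PDF_finite: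
  fixes G21 :: "complex ^ 't1::finite ^ 'r2::finite"
    and G31 :: "complex ^ 't1 ^ 'r3::finite" and G32 :: "complex ^ 't2::finite ^ 'r3"
  assumes P: "0 < P"
  shows "\<bar>R_PDF G21 G31 G32 P\<bar> \<noteq> \<infinity>"
proof -
  obtain K1 K2 where K1: "\<And>x. norm (G31 *v x) \<le> norm x * K1" and K2: "\<And>x. norm (G32 *v x) \<le> norm x * K2"
    using bounded_linear.bounded[OF bounded_linear_matrix_vector_mult_complex] by metis
  define c where "c = (4 * K1\<^sup>2 * P + 4 * K2\<^sup>2 * P + 2 * (\<integral>z. (norm z)\<^sup>2 \<partial>(gauss_measure :: (complex ^ 'r3) measure))) / ln 2"
  have "R_PDF G21 G31 G32 P \<le> ereal c"
    unfolding R_PDF_def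
  proof (rule Sup_least, clarify)
    fix m and F :: "((nat \<Rightarrow> complex) \<times> (complex ^ 't1) \<times> (complex ^ 't2)) measure"
    assume F: "prob_space F" and sets_F [measurable_cong]: "sets F = sets (aux_space m \<Otimes>\<^sub>M (borel \<Otimes>\<^sub>M borel))"
      and p: "power_constraint F (\<lambda>(u, x1, x2). x1) P" "power_constraint F (\<lambda>(u, x1, x2). x2) P"
    have "prob_space.mutual_information (relay_space F :: (_ \<times> (complex ^ 'r2) \<times> (complex ^ 'r3)) measure) 2
      (borel \<Otimes>\<^sub>M borel) borel (\<lambda>\<omega>. ((\<lambda>(u, x1, x2). x1) (fst \<omega>), (\<lambda>(u, x1, x2). x2) (fst \<omega>)))
        (\<lambda>\<omega>. G31 *v (\<lambda>(u, x1, x2). x1) (fst \<omega>) + G32 *v (\<lambda>(u, x1, x2). x2) (fst \<omega>) + snd (snd \<omega>)) \<le> c"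
      unfolding c_def
      by (rule mutual_information_relay_le[OF F _ _ p]) (use P K1 K2 in \<open>auto simp: mult.commute\<close>)
    then show "ereal (pdf_rate G21 G31 G32 m F) \<le> ereal c"
      unfolding pdf_rate_def Let_def by (auto simp: split_beta' intro: min.coboundedI1)
  qed
  moreover have "R_PDF G21 G31 G32 P \<noteq> - \<infinity>"
  proof -
    let ?N = "aux_space 0 \<Otimes>\<^sub>M (borel \<Otimes>\<^sub>M borel) :: ((nat \<Rightarrow> complex) \<times> (complex ^ 't1) \<times> (complex ^ 't2)) measure"
    \<comment> \<open>Zero inputs with a zero-dimensional auxiliary vector: on the empty index set
      the only extensional function is constantly \<open>undefined\<close>.\<close>
    let ?x = "(\<lambda>_. undefined, 0, 0) :: (nat \<Rightarrow> complex) \<times> (complex ^ 't1) \<times> (complex ^ 't2)"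
    have x: "?x \<in> space ?N" by (simp add: space_pair_measure aux_space_def space_PiM)
    have "power_constraint (return ?N ?x) (\<lambda>(u, x1, x2). x1) P" "power_constraint (return ?N ?x) (\<lambda>(u, x1, x2). x2) P"
      by (simp_all add: power_constraint_def nn_integral_return[OF x])
    then have "ereal (pdf_rate G21 G31 G32 0 (return ?N ?x)) \<le> R_PDF G21 G31 G32 P"
      unfolding R_PDF_def using prob_space_return[OF x] by (intro Sup_upper) fastforce
    then show ?thesis by auto
  qed
  ultimately show ?thesis by (auto simp: ereal_infty_less_eq)
qed

text \<open>Every cutset input law has its own partner by \<open>rate_gap\<close>, so the gap passes
  to the suprema without any maximiser. The additive form postpones subtraction until finiteness is
  used.\<close>

lemma R_CS_le:
  fixes G21 :: "complex ^ 't1::finite ^ 'r2::finite" and L :: "'v::euclidean_space \<Rightarrow> complex ^ 'r2"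
    and G31 :: "complex ^ 't1 ^ 'r3::finite" and G32 :: "complex ^ 't2::finite ^ 'r3"
  assumes L: "linear L" "\<And>x. norm (L x) = norm x" "range ((*v) G21) \<subseteq> range L"
  shows "R_CS G21 G31 G32 P \<le> R_PDF G21 G31 G32 P + ereal (real DIM('v) / 2)"
  unfolding R_CS_def
proof (rule Sup_least, clarify)
  fix F :: "((complex ^ 't1) \<times> (complex ^ 't2)) measure"
  assume "prob_space F" "sets F = sets (borel \<Otimes>\<^sub>M borel)" "power_constraint F fst P" "power_constraint F snd P"
  then interpret cutset_input G21 G31 G32 P F by (rule cutset_input.intro)
  obtain F' where F': "prob_space F'" "sets F' = sets (aux_space CARD('r2) \<Otimes>\<^sub>M (borel \<Otimes>\<^sub>M borel))"
    "power_constraint F' (\<lambda>(u, x1, x2). x1) P" "power_constraint F' (\<lambda>(u, x1, x2). x2) P"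
    "cutset_rate G21 G31 G32 F \<le> pdf_rate G21 G31 G32 CARD('r2) F' + real DIM('v) / 2"
    using rate_gap[OF L] by blast
  have "ereal (cutset_rate G21 G31 G32 F) \<le> ereal (pdf_rate G21 G31 G32 CARD('r2) F') + ereal (real DIM('v) / 2)"
    using F'(5) by simp
  also have "ereal (pdf_rate G21 G31 G32 CARD('r2) F') \<le> R_PDF G21 G31 G32 P"
    unfolding R_PDF_def using F'(1-4) by (intro Sup_upper) blast
  finally show "ereal (cutset_rate G21 G31 G32 F) \<le> R_PDF G21 G31 G32 P + ereal (real DIM('v) / 2)"
    by (simp add: add_right_mono)
qed

theorem theorem1:
  fixes G21 :: "complex ^ 't1::finite ^ 'r2::finite"
    and G31 :: "complex ^ 't1 ^ 'r3::finite"
    and G32 :: "complex ^ 't2::finite ^ 'r3"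
    and P :: real
  assumes "P > 0"
  shows "R_CS G21 G31 G32 P - R_PDF G21 G31 G32 P \<le> ereal (real (min CARD('t1) CARD('r2)))"
proof -
  have "R_CS G21 G31 G32 P \<le> R_PDF G21 G31 G32 P + ereal (real (min CARD('t1) CARD('r2)))"
  \<comment> \<open>In the first case the range of \<open>G21\<close> fits into an isometric image
    of \<open>complex ^ 't1\<close>; otherwise the identity of \<open>complex ^ 'r2\<close> covers
    it. Real dimensions are twice the complex ones, hence the halving in
    \<open>R_CS_le\<close>.\<close>
  proof (cases "CARD('t1) \<le> CARD('r2)")
    case True
    then obtain L :: "complex ^ 't1 \<Rightarrow> complex ^ 'r2"
      where "linear L" "\<And>x. norm (L x) = norm x" "range ((*v) G21) \<subseteq> range L"
      using isometry_covering_range[of "(*v) G21"] bounded_linear_matrix_vector_mult_complex[of G21]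
      by (auto simp: linear_conv_bounded_linear)
    from R_CS_le[OF this] show ?thesis using True by simp
  next
    case False
    have "R_CS G21 G31 G32 P \<le> R_PDF G21 G31 G32 P + ereal (real DIM(complex ^ 'r2) / 2)"
      by (rule R_CS_le[where L="\<lambda>x. x"]) (auto intro: linear_id[unfolded id_def])
    then show ?thesis using False by simp
  qed
  moreover have "\<bar>R_PDF G21 G31 G32 P\<bar> \<noteq> \<infinity>" using assms by (rule R_PDF_finite)
  ultimately show ?thesis by (simp add: ereal_minus_le add.commute)
qed

end
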